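(* Let $p$ be an odd prime, let $\mu$ be a character of $\mathbb Q_p^\times$ of conductor exponent $n>1$, and let $\eta$ be trivial or $\left(\frac{\cdot}{p}\right)$. If $\mu(-1)=\eta(-1)$, then $V(\mu)_\eta^{K_{2n}}$ is the $2$-dimensional space spanned by the functions $f_1$ and $f_\lambda$, where for $\kappa\in\{1,\lambda\}$ $$f_\kappa(g)=\begin{cases}\mu_B(b)\,\eta(k_0)&\text{if } g=b\,(y(\kappa p^n),1)\,k_0\text{ for some } b\in B,\ k_0\in\overline{K_{2n}},\\ 0&\text{otherwise.}\end{cases}$$ Consequently $c_\eta(\pi_\psi(\mu))=2n$.
   Context: Let $G=\mathrm{SL}_2(\mathbb Q_p)$, $K=\mathrm{SL}_2(\mathbb Z_p)$, $K_m=K_0(p^m)=\{\begin{pmatrix}a&b\\ c&d\end{pmatrix}\in K:c\in p^m\mathbb Z_p\}$. $(\cdot,\cdot)_p$ is the quadratic Hilbert symbol. For $A=\begin{pmatrix}a&b\\ c&d\end{pmatrix}$ put $\tau(A)=c$ if $c\ne0$, $\tau(A)=d$ if $c=0$; for $g\in G$ put $s_p(g)=(c,d)_p$ if $cd\neq0$ and $\mathrm{ord}_p(c)$ is odd, $s_p(g)=1$ otherwise; $c(g,h)=(\tau(gh)\tau(g),\tau(gh)\tau(h))_p\,s_p(g)s_p(h)s_p(gh)$. $\widetilde G=G\times\{\pm1\}$ with $(g,\epsilon_1)(h,\epsilon_2)=(gh,\epsilon_1\epsilon_2c(g,h))$; $\overline S$ is the full inverse image of $S\subset G$. The cover splits over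 $K$ by $k\mapsto (k,1)$. $\eta$ defines the genuine character $\eta((\begin{pmatrix}a&b\\ c&d\end{pmatrix},\epsilon))=\epsilon\eta(d)$ of $\overline{K_m}$ for $m\ge c(\eta)$, $c(\eta)\in\{0,1\}$ being the conductor exponent of $\eta$. $\lambda\in\mathbb Z_p^\times$ is a nonsquare mod $p$; $x(s)=\begin{pmatrix}1&s\\ 0&1\end{pmatrix}$, $y(s)=\begin{pmatrix}1&0\\ s&1\end{pmatrix}$, $h(t)=\mathrm{diag}(t,t^{-1})$. $B\subset\widetilde G$ is the full inverse image of the upper triangular Borel subgroup of $G$. $\psi$ is a nontrivial additive character of $\mathbb Q_p$ of conductor $0$ (trivial on $\mathbb Z_p$, not on $p^{-1}\mathbb Z_p$); $\gamma(\psi')$ is the Weil index of $x\mapsto x^2$ with respect to $\psi'$, and $\gamma(a,\psi)=\gamma(\psi_a)/\gamma(\psi)$, $\psi_a(x)=\psi(ax)$. Put $\mu_B((h(a)x(b),\epsilon))=\epsilon\,|a|\,\mu(a)\,\gamma(a,\psi)^{-1}$. $\pi_\psi(\mu)$ is the right-translation representation of $\widetilde G$ on the space $V(\mu)$ of locally constant $f:\widetilde G\to\mathbb C$ with $f(bg)=\mu_B(b)f(g)$ for $b\in B$. For $m\ge c(\eta)$, $V(\mu)_\eta^{K_m}=\{f\in V(\mu):f(g\tilde k)=f(g)\eta(\tilde k)\ \forall\tilde k\in\overline{K_m}\}$, and the $\eta$-conductor $c_\eta(\pi_\psi(\mu))$ is the least such $m$ with $V(\mu)_\eta^{K_m}\neq0$.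 *)

theory Defs
  imports
    "HOL-Analysis.Analysis"
    "HOL-Library.Function_Algebras"
    "HOL-Number_Theory.Number_Theory"
    "Berlekamp_Zassenhaus.Finite_Field"
    "HOL-Computational_Algebra.Fraction_Field"
begin

section \<open>The ring of p-adic integers\<close>

text \<open>The prime is p = \<open>CARD('p)\<close>, and the ring of p-adic integers is the inverse limit of the
  rings of integers modulo \<open>p ^ n\<close>: an element is the sequence of its reduced residues.\<close>

typedef (overloaded) ('p::prime_card) zp =
  "{x :: nat \<Rightarrow> int. \<forall>n. 0 \<le> x n \<and> x n < int CARD('p) ^ n \<and> x (Suc n) mod int CARD('p) ^ n = x n}"
  morphisms residues_of Abs_zp
proof -
  have "0 < int CARD('p)"
    using prime_card[where 'a='p] by (simp add: prime_gt_0_nat)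
  then show ?thesis
    by (intro exI[of _ "\<lambda>_. 0"]) auto
qed

setup_lifting type_definition_zp

lemma p_pos: "0 < int CARD('p::prime_card)"
  using prime_card[where 'a='p] by (simp add: prime_gt_0_nat)

lemma red_step:
  fixes x y p :: int
  assumes "0 < p" "x mod p ^ n = y mod p ^ n"
  shows "(x mod p ^ Suc n) mod p ^ n = y mod p ^ n"
proof -
  have "(x mod p ^ Suc n) mod p ^ n = x mod p ^ n"
    by (rule mod_mod_cancel) simp
  then show ?thesis using assms by simp
qed

instantiation zp :: (prime_card) comm_ring_1
begin

lift_definition zero_zp :: "'a zp" is "\<lambda>_. 0"
  using p_pos[where 'p='a] by auto

lift_definition one_zp :: "'a zp" is "\<lambda>n. 1 mod int CARD('a) ^ n"
  using p_pos[where 'p='a] by (auto intro!: mod_mod_cancel)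

lift_definition plus_zp :: "'a zp \<Rightarrow> 'a zp \<Rightarrow> 'a zp"
  is "\<lambda>x y n. (x n + y n) mod int CARD('a) ^ n"
  using p_pos[where 'p='a] by (auto simp del: power_Suc intro!: red_step) (metis mod_add_eq)

lift_definition times_zp :: "'a zp \<Rightarrow> 'a zp \<Rightarrow> 'a zp"
  is "\<lambda>x y n. (x n * y n) mod int CARD('a) ^ n"
  using p_pos[where 'p='a] by (auto simp del: power_Suc intro!: red_step) (metis mod_mult_eq)

lift_definition uminus_zp :: "'a zp \<Rightarrow> 'a zp"
  is "\<lambda>x n. (- x n) mod int CARD('a) ^ n"
  using p_pos[where 'p='a] by (auto simp del: power_Suc intro!: red_step) (metis mod_minus_eq)

lift_definition minus_zp :: "'a zp \<Rightarrow> 'a zp \<Rightarrow> 'a zp"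
  is "\<lambda>x y n. (x n - y n) mod int CARD('a) ^ n"
  using p_pos[where 'p='a] by (auto simp del: power_Suc intro!: red_step) (metis mod_diff_eq)

instance
proof
  fix a b c :: "'a zp"
  show "a * b * c = a * (b * c)"
    by transfer (auto simp: fun_eq_iff mod_mult_left_eq mod_mult_right_eq mult.assoc)
  show "a * b = b * a" by transfer (auto simp: mult.commute)
  show "1 * a = a"
    by transfer (auto simp: fun_eq_iff mod_mult_left_eq)
  show "a + b + c = a + (b + c)"
    by transfer (auto simp: fun_eq_iff mod_add_left_eq mod_add_right_eq add.assoc)
  show "a + b = b + a" by transfer (auto simp: add.commute)
  show "0 + a = a" by transfer auto
  show "- a + a = 0" by transfer (auto simp: fun_eq_iff mod_add_left_eq)
  show "a - b = a + - b" by transfer (auto simp: fun_eq_iff mod_add_right_eq)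
  show "(a + b) * c = a * c + b * c"
    by transfer (auto simp: fun_eq_iff mod_add_eq mod_mult_left_eq distrib_right)
  show "(0::'a zp) \<noteq> 1"
  proof
    assume "(0::'a zp) = 1"
    then have "residues_of (0::'a zp) 1 = residues_of (1::'a zp) 1" by simp
    then show False
      using prime_gt_1_int[OF prime_card_int[where 'a='a]]
      by (simp add: zero_zp.rep_eq one_zp.rep_eq)
  qed
qed

end

lemma residues_of_bounds:
  "0 \<le> residues_of (x::'p::prime_card zp) n" "residues_of x n < int CARD('p) ^ n"
  "residues_of x n mod int CARD('p) ^ n = residues_of x n"
  using residues_of[of x] by auto

lemma residues_of_mod:
  "residues_of (x::'p::prime_card zp) (n + k) mod int CARD('p) ^ n = residues_of x n"
proof (induction k)
  case 0
  then show ?case by (simp add: residues_of_bounds)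
next
  case (Suc k)
  have "residues_of x (n + k) = residues_of x (Suc (n + k)) mod int CARD('p) ^ (n + k)"
    using residues_of[of x] by auto
  then have "residues_of x (n + k) mod int CARD('p) ^ n = residues_of x (Suc (n + k)) mod int CARD('p) ^ n"
    by (simp add: mod_mod_cancel le_imp_power_dvd)
  with Suc show ?case by simp
qed

lemma residues_of_eqI: "(\<And>n. residues_of x n = residues_of y n) \<Longrightarrow> x = y"
  by (metis ext residues_of_inject)

lemma residues_of_of_nat:
  "residues_of (of_nat k :: 'p::prime_card zp) n = int k mod int CARD('p) ^ n"
  by (induction k) (simp_all add: zero_zp.rep_eq one_zp.rep_eq plus_zp.rep_eq mod_add_eq)

lemma zp_unitI:
  fixes x :: "'p::prime_card zp"
  assumes "residues_of x 1 \<noteq> 0"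
  shows "\<exists>y. x * y = 1"
proof -
  define p where "p = int CARD('p)"
  have pr: "prime p" unfolding p_def by (rule prime_card_int)
  have p0: "0 < p" using p_pos[where 'p='p] by (simp add: p_def)
  have cop: "coprime (residues_of x n) (p ^ n)" for n
  proof (cases n)
    case 0 then show ?thesis by simp
  next
    case (Suc m)
    have "residues_of x n mod p = residues_of x 1"
      using residues_of_mod[of x 1 m] Suc by (simp add: p_def)
    then have "\<not> p dvd residues_of x n" using assms by (auto simp: dvd_eq_mod_eq_0)
    then show ?thesis
      using pr by (simp add: coprime_commute prime_imp_coprime)
  qed
  have "\<exists>y. 0 \<le> y \<and> y < p ^ n \<and> (residues_of x n * y) mod p ^ n = 1 mod p ^ n" for n
  proof -
    obtain z where "[residues_of x n * z = 1] (mod p ^ n)"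
      using cop[of n] cong_solve_coprime_int by blast
    then show ?thesis
      using p0 by (intro exI[of _ "z mod p ^ n"]) (auto simp: cong_def mod_mult_right_eq)
  qed
  then obtain y where y: "\<And>n. 0 \<le> y n \<and> y n < p ^ n \<and> (residues_of x n * y n) mod p ^ n = 1 mod p ^ n"
    by metis
  have coh: "y (Suc n) mod p ^ n = y n" for n
  proof -
    have dv: "p ^ n dvd p ^ Suc n" by simp
    have "(residues_of x (Suc n) * y (Suc n)) mod p ^ n = 1 mod p ^ n"
      using y[of "Suc n"] by (metis dv mod_mod_cancel)
    moreover have "residues_of x (Suc n) mod p ^ n = residues_of x n"
      using residues_of_mod[of x n 1] by (simp add: p_def)
    ultimately have "(residues_of x n * y (Suc n)) mod p ^ n = 1 mod p ^ n"
      by (metis mod_mult_left_eq)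
    then have "[residues_of x n * y (Suc n) = residues_of x n * y n] (mod p ^ n)"
      using y[of n] by (simp add: cong_def)
    then have "[y (Suc n) = y n] (mod p ^ n)"
      using cop[of n] by (simp add: cong_mult_lcancel)
    then show ?thesis using y[of n] by (simp add: cong_def)
  qed
  have mem: "y \<in> {x. \<forall>n. 0 \<le> x n \<and> x n < int CARD('p) ^ n \<and> x (Suc n) mod int CARD('p) ^ n = x n}"
    using y coh by (auto simp: p_def)
  have "x * Abs_zp y = 1"
    using y by (intro residues_of_eqI)
      (simp add: times_zp.rep_eq one_zp.rep_eq Abs_zp_inverse[OF mem] p_def)
  then show ?thesis by blast
qed

lemma zp_divisible:
  fixes x :: "'p::prime_card zp"
  assumes "residues_of x k = 0"
  obtains y where "x = of_nat CARD('p) ^ k * y"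
    "\<And>n. residues_of y n = residues_of x (n + k) div int CARD('p) ^ k"
proof -
  define p where "p = int CARD('p)"
  define y where "y = (\<lambda>n. residues_of x (n + k) div p ^ k)"
  have p0: "0 < p" using p_pos[where 'p='p] by (simp add: p_def)
  have dv: "p ^ k dvd residues_of x (n + k)" for n
    using residues_of_mod[of x k n] assms by (simp add: p_def add.commute dvd_eq_mod_eq_0)
  then have xy: "residues_of x (n + k) = p ^ k * y n" for n
    by (simp add: y_def)
  have "0 \<le> y n \<and> y n < p ^ n \<and> y (Suc n) mod p ^ n = y n" for n
  proof (intro conjI)
    show "0 \<le> y n" using p0 by (simp add: y_def residues_of_bounds pos_imp_zdiv_nonneg_iff)
    have "p ^ k * y n < p ^ k * p ^ n"
      using residues_of_bounds(2)[of x "n + k"] by (simp only: xy[symmetric] p_def[symmetric] power_add[symmetric] add.commute)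
    then show "y n < p ^ n" using p0 by simp
    have "(p ^ k * y (Suc n)) mod (p ^ k * p ^ n) = p ^ k * y n"
      using residues_of_mod[of x "n + k" 1] xy[of n] xy[of "Suc n"]
      by (simp add: p_def power_add mult.commute)
    then show "y (Suc n) mod p ^ n = y n"
      using p0 by (simp add: mult_mod_right[symmetric])
  qed
  then have mem: "y \<in> {x. \<forall>n. 0 \<le> x n \<and> x n < int CARD('p) ^ n \<and> x (Suc n) mod int CARD('p) ^ n = x n}"
    by (simp add: p_def)
  have res: "residues_of (of_nat CARD('p) ^ k :: 'p zp) n = p ^ k mod p ^ n" for n
    using residues_of_of_nat[of "CARD('p) ^ k" n, where 'p='p] by (simp add: p_def)
  have "residues_of x n = residues_of (of_nat CARD('p) ^ k * Abs_zp y :: 'p zp) n" for n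
  proof -
    have "residues_of x n = (p ^ k * y n) mod p ^ n"
      using residues_of_mod[of x n k] xy[of n] by (simp add: p_def)
    then show ?thesis
      by (simp add: times_zp.rep_eq res Abs_zp_inverse[OF mem] mod_mult_left_eq p_def[symmetric])
  qed
  then have "x = of_nat CARD('p) ^ k * Abs_zp y" by (rule residues_of_eqI)
  moreover have "residues_of (Abs_zp y :: 'p zp) n = residues_of x (n + k) div int CARD('p) ^ k" for n
    by (simp add: Abs_zp_inverse[OF mem]) (simp add: y_def p_def)
  ultimately show thesis by (rule that)
qed

lemma zp_decomp:
  fixes x :: "'p::prime_card zp"
  assumes "x \<noteq> 0"
  obtains k u v where "x = of_nat CARD('p) ^ k * u" "u * v = 1"
proof -
  have "\<exists>m. residues_of x m \<noteq> 0"
    using assms residues_of_eqI[of x 0] by (auto simp: zero_zp.rep_eq)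
  then obtain m where m: "residues_of x m \<noteq> 0" "\<And>i. i < m \<Longrightarrow> residues_of x i = 0"
    using exists_least_iff[of "\<lambda>m. residues_of x m \<noteq> 0"] by blast
  have "residues_of x 0 = 0" using residues_of_bounds[of x 0] by simp
  then obtain k where k: "m = Suc k" using m(1) by (cases m) auto
  obtain y where y: "x = of_nat CARD('p) ^ k * y"
    "\<And>n. residues_of y n = residues_of x (n + k) div int CARD('p) ^ k"
    using zp_divisible[of x k] m(2)[of k] k by auto
  have dv: "int CARD('p) ^ k dvd residues_of x m"
    using residues_of_mod[of x k 1] m(2)[of k] k by (simp add: dvd_eq_mod_eq_0)
  have "residues_of y 1 \<noteq> 0"
  proof
    assume "residues_of y 1 = 0"
    then have "residues_of x m div int CARD('p) ^ k = 0" using y(2)[of 1] k by simp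
    with dv have "residues_of x m = 0" by (metis dvd_div_eq_0_iff)
    with m(1) show False by simp
  qed
  from zp_unitI[OF this] y(1) show thesis by (auto intro: that)
qed

lemma zp_p_power_nonzero: "(of_nat CARD('p) ^ k :: 'p::prime_card zp) \<noteq> 0"
proof
  assume *: "(of_nat CARD('p) ^ k :: 'p zp) = 0"
  have "residues_of (of_nat CARD('p) ^ k :: 'p zp) (Suc k) = int CARD('p) ^ k mod int CARD('p) ^ Suc k"
    using residues_of_of_nat[of "CARD('p) ^ k" "Suc k", where 'p='p] by simp
  moreover have "int CARD('p) ^ k < int CARD('p) ^ Suc k"
    using prime_gt_1_int[OF prime_card_int[where 'a='p]] by simp
  ultimately show False
    using * p_pos[where 'p='p] by (simp add: zero_zp.rep_eq del: power_Suc)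
qed

instance zp :: (prime_card) idom
proof
  fix a b :: "'a zp"
  assume ab: "a \<noteq> 0" "b \<noteq> 0"
  obtain k u u' where a: "a = of_nat CARD('a) ^ k * u" "u * u' = 1" using zp_decomp[OF ab(1)] .
  obtain l v v' where b: "b = of_nat CARD('a) ^ l * v" "v * v' = 1" using zp_decomp[OF ab(2)] .
  show "a * b \<noteq> 0"
  proof
    assume "a * b = 0"
    then have "(a * b) * (u' * v') = 0" by simp
    also have "(a * b) * (u' * v') = of_nat CARD('a) ^ (k + l) * ((u * u') * (v * v'))"
      by (simp add: a(1) b(1) power_add mult_ac)
    finally show False using zp_p_power_nonzero[of "k + l", where 'p='a] by (simp add: a b)
  qed
qed

section \<open>The field of p-adic numbers\<close>

text \<open>A copy of the fraction field, so that it can carry the p-adic metric.\<close>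

typedef (overloaded) ('p::prime_card) qp = "UNIV :: 'p zp fract set"
  by simp

setup_lifting type_definition_qp

instantiation qp :: (prime_card) field
begin

lift_definition zero_qp :: "'a qp" is 0 .
lift_definition one_qp :: "'a qp" is 1 .
lift_definition plus_qp :: "'a qp \<Rightarrow> 'a qp \<Rightarrow> 'a qp" is "(+)" .
lift_definition minus_qp :: "'a qp \<Rightarrow> 'a qp \<Rightarrow> 'a qp" is "(-)" .
lift_definition uminus_qp :: "'a qp \<Rightarrow> 'a qp" is uminus .
lift_definition times_qp :: "'a qp \<Rightarrow> 'a qp \<Rightarrow> 'a qp" is "(*)" .
lift_definition inverse_qp :: "'a qp \<Rightarrow> 'a qp" is inverse .
lift_definition divide_qp :: "'a qp \<Rightarrow> 'a qp \<Rightarrow> 'a qp" is "(/)" .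

instance
  by standard (transfer; simp add: field_simps)+

end

definition qp_of_zp :: "'p::prime_card zp \<Rightarrow> 'p qp" where
  "qp_of_zp x = Abs_qp (Fract x 1)"

lemma Rep_qp_of_zp: "Rep_qp (qp_of_zp x) = Fract x 1"
  by (simp add: qp_of_zp_def Abs_qp_inverse)

definition Zp :: "'p::prime_card qp set" where
  "Zp = range qp_of_zp"

definition Zp_units :: "'p::prime_card qp set" where
  "Zp_units = {u. u \<noteq> 0 \<and> u \<in> Zp \<and> inverse u \<in> Zp}"

abbreviation pp :: "'p::prime_card qp" where
  "pp \<equiv> of_nat CARD('p)"

text \<open>The fractional ideal \<open>p ^ k Zp\<close>.\<close>

definition pZp :: "int \<Rightarrow> 'p::prime_card qp set" where
  "pZp k = (\<lambda>z. pp powi k * z) ` Zp"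

definition ord_p :: "'p::prime_card qp \<Rightarrow> int" where
  "ord_p x = (THE k. \<exists>u\<in>Zp_units. x = pp powi k * u)"

definition abs_p :: "'p::prime_card qp \<Rightarrow> real" where
  "abs_p x = (if x = 0 then 0 else real CARD('p) powi (- ord_p x))"

lemma qp_of_zp_hom:
  "qp_of_zp (0::'p::prime_card zp) = 0" "qp_of_zp (1::'p zp) = 1"
  "qp_of_zp (x + y) = qp_of_zp x + qp_of_zp (y::'p zp)"
  "qp_of_zp (x * y) = qp_of_zp x * qp_of_zp (y::'p zp)"
  "qp_of_zp (- x) = - qp_of_zp (x::'p zp)"
  by (simp_all add: Rep_qp_inject[symmetric] Rep_qp_of_zp zero_qp.rep_eq one_qp.rep_eq
      plus_qp.rep_eq times_qp.rep_eq uminus_qp.rep_eq fract_collapse)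

lemma qp_of_zp_of_nat: "qp_of_zp (of_nat n :: 'p::prime_card zp) = of_nat n"
  by (induction n) (simp_all add: qp_of_zp_hom)

lemma qp_of_zp_power: "qp_of_zp (x ^ n :: 'p::prime_card zp) = qp_of_zp x ^ n"
  by (induction n) (simp_all add: qp_of_zp_hom)

lemma qp_of_zp_eq_iff: "qp_of_zp x = qp_of_zp (y::'p::prime_card zp) \<longleftrightarrow> x = y"
  by (simp add: Rep_qp_inject[symmetric] Rep_qp_of_zp eq_fract)

lemma Zp_closed:
  "(0::'p::prime_card qp) \<in> Zp" "(1::'p qp) \<in> Zp" "of_nat n \<in> (Zp::'p qp set)"
  "x \<in> Zp \<Longrightarrow> y \<in> Zp \<Longrightarrow> x + y \<in> (Zp::'p qp set)"
  "x \<in> Zp \<Longrightarrow> y \<in> Zp \<Longrightarrow> x * y \<in> (Zp::'p qp set)"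
  "x \<in> Zp \<Longrightarrow> - x \<in> (Zp::'p qp set)"
  "x \<in> Zp \<Longrightarrow> x ^ n \<in> (Zp::'p qp set)"
  unfolding Zp_def image_iff
  by (metis UNIV_I qp_of_zp_hom qp_of_zp_of_nat qp_of_zp_power)+

lemma pp_nonzero: "(pp::'p::prime_card qp) \<noteq> 0"
  using zp_p_power_nonzero[of 1, where 'p='p] qp_of_zp_eq_iff[of "of_nat CARD('p)" "0::'p zp"]
  by (simp add: qp_of_zp_of_nat qp_of_zp_hom)

lemma inverse_pp_notin_Zp: "inverse (pp::'p::prime_card qp) \<notin> Zp"
proof
  assume "inverse (pp::'p qp) \<in> Zp"
  then obtain z :: "'p zp" where "inverse (pp::'p qp) = qp_of_zp z" by (auto simp: Zp_def)
  then have "qp_of_zp (of_nat CARD('p) * z) = 1"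
    by (metis pp_nonzero qp_of_zp_hom(4) qp_of_zp_of_nat right_inverse)
  then have "of_nat CARD('p) * z = 1"
    by (metis qp_of_zp_eq_iff qp_of_zp_hom(2))
  then have "residues_of (of_nat CARD('p) * z) 1 = residues_of (1::'p zp) 1" by (simp only:)
  then show False
    using prime_gt_1_int[OF prime_card_int[where 'a='p]]
    by (simp add: times_zp.rep_eq one_zp.rep_eq residues_of_of_nat)
qed

lemma qp_decomp:
  fixes x :: "'p::prime_card qp"
  assumes "x \<noteq> 0"
  obtains k u where "u \<in> Zp_units" "x = pp powi k * u"
proof -
  have dec: "\<exists>k u. u \<in> Zp_units \<and> qp_of_zp a = pp powi k * u" if "a \<noteq> 0" for a :: "'p zp"
  proof -
    obtain k u v where a: "a = of_nat CARD('p) ^ k * u" "u * v = 1" using zp_decomp[OF \<open>a \<noteq> 0\<close>] .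
    have uv: "qp_of_zp u * qp_of_zp v = 1" using a(2) by (metis qp_of_zp_hom(2,4))
    then have "qp_of_zp u \<noteq> 0" "inverse (qp_of_zp u) = qp_of_zp v"
      by (auto simp: inverse_unique)
    then have "qp_of_zp u \<in> Zp_units" by (auto simp: Zp_units_def Zp_def)
    moreover have "qp_of_zp a = pp powi int k * qp_of_zp u"
      by (simp add: a(1) qp_of_zp_hom qp_of_zp_power qp_of_zp_of_nat)
    ultimately show ?thesis by blast
  qed
  obtain a b :: "'p zp" where ab: "b \<noteq> 0" "x = qp_of_zp a / qp_of_zp b"
  proof -
    obtain a b :: "'p zp" where ab: "Rep_qp x = Fract a b" "b \<noteq> 0"
      using Fract_cases[of "Rep_qp x"] by metis
    then have "x = qp_of_zp a / qp_of_zp b"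
      by (simp add: Rep_qp_inject[symmetric] Rep_qp_of_zp divide_qp.rep_eq)
    with ab(2) show ?thesis by (rule that)
  qed
  with assms have "a \<noteq> 0" by (auto simp: qp_of_zp_hom)
  then obtain k u where u: "u \<in> Zp_units" "qp_of_zp a = pp powi k * u" using dec by blast
  obtain l v where v: "v \<in> Zp_units" "qp_of_zp b = pp powi l * v" using dec ab(1) by blast
  have "u * inverse v \<in> Zp_units"
    using u(1) v(1) by (auto simp: Zp_units_def Zp_closed)
  moreover have "x = pp powi (k - l) * (u * inverse v)"
    unfolding ab(2) u(2) v(2) power_int_diff[OF disjI1[OF pp_nonzero[where 'p='p]]]
    by (simp add: divide_inverse mult_ac)
  ultimately show thesis by (rule that)
qed

lemma ord_p_eqI:
  fixes u :: "'p::prime_card qp"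
  assumes "u \<in> Zp_units"
  shows "ord_p (pp powi k * u) = k"
proof -
  have aux: "False" if "v \<in> Zp_units" "w \<in> Zp_units" "i < j" "pp powi i * v = pp powi j * w"
    for v w :: "'p qp" and i j
  proof -
    have "v = (pp powi i * v) / pp powi i"
      using pp_nonzero[where 'p='p] by simp
    also have "\<dots> = pp powi (j - i) * w"
      unfolding that(4) power_int_diff[OF disjI1[OF pp_nonzero[where 'p='p]]] by simp
    also have "pp powi (j - i) = (pp::'p qp) ^ nat (j - i)"
      using that(3) by (simp add: power_int_def)
    also have "\<dots> = pp * pp ^ (nat (j - i) - 1)"
      using that(3) by (simp add: power_eq_if)
    finally have v: "v = pp * pp ^ (nat (j - i) - 1) * w" .
    have "v * inverse v = 1" using that(1) by (simp add: Zp_units_def)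
    then have "pp * (pp ^ (nat (j - i) - 1) * w * inverse v) = 1"
      by (subst (asm) (1) v) (simp only: mult.assoc)
    then have "inverse pp = pp ^ (nat (j - i) - 1) * w * inverse v"
      by (rule inverse_unique)
    also have "\<dots> \<in> Zp"
      using that by (auto simp: Zp_units_def intro!: Zp_closed)
    finally show False using inverse_pp_notin_Zp by blast
  qed
  show ?thesis
    unfolding ord_p_def
  proof (rule the_equality)
    show "\<exists>v\<in>Zp_units. pp powi k * u = pp powi k * v" using assms by blast
    fix l assume "\<exists>v\<in>Zp_units. pp powi k * u = pp powi l * v"
    then show "l = k" using aux assms by (metis linorder_neqE)
  qed
qed

lemma ord_p_uminus:
  assumes "x \<noteq> 0"
  shows "ord_p (- x) = ord_p (x::'p::prime_card qp)"
proof -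
  obtain k u where u: "u \<in> Zp_units" "x = pp powi k * u" using qp_decomp[OF assms] .
  then have "- u \<in> Zp_units" by (simp add: Zp_units_def Zp_closed)
  then have "ord_p (pp powi k * - u) = k" by (rule ord_p_eqI)
  with ord_p_eqI[OF u(1), of k] u(2) show ?thesis by simp
qed

lemma ord_p_Zp: "z \<in> Zp \<Longrightarrow> z \<noteq> 0 \<Longrightarrow> 0 \<le> ord_p (z::'p::prime_card qp)"
proof -
  assume z: "z \<in> Zp" "z \<noteq> 0"
  then obtain a :: "'p zp" where a: "z = qp_of_zp a" by (auto simp: Zp_def)
  with z have "a \<noteq> 0" by (auto simp: qp_of_zp_hom)
  then obtain k u v where d: "a = of_nat CARD('p) ^ k * u" "u * v = 1" using zp_decomp by blast
  have uv: "qp_of_zp u * qp_of_zp v = 1" using d(2) by (metis qp_of_zp_hom(2,4))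
  then have "qp_of_zp u \<noteq> 0" "inverse (qp_of_zp u) = qp_of_zp v"
    by (auto simp: inverse_unique)
  then have "qp_of_zp u \<in> Zp_units" by (auto simp: Zp_units_def Zp_def)
  moreover have "z = pp powi int k * qp_of_zp u"
    by (simp add: a d(1) qp_of_zp_hom qp_of_zp_power qp_of_zp_of_nat)
  ultimately show "0 \<le> ord_p z" using ord_p_eqI by (metis of_nat_0_le_iff)
qed

lemma ord_p_add:
  fixes x y :: "'p::prime_card qp"
  assumes "x \<noteq> 0" "y \<noteq> 0" "x + y \<noteq> 0"
  shows "min (ord_p x) (ord_p y) \<le> ord_p (x + y)"
proof -
  have aux: "ord_p x \<le> ord_p (x + y)"
    if ne: "x \<noteq> 0" "y \<noteq> 0" "x + y \<noteq> 0" and le: "ord_p x \<le> ord_p y" for x y :: "'p qp"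
  proof -
    obtain i u where x: "u \<in> Zp_units" "x = pp powi i * u" using qp_decomp[OF ne(1)] .
    obtain j v where y: "v \<in> Zp_units" "y = pp powi j * v" using qp_decomp[OF ne(2)] .
    have ij: "i \<le> j" using le by (simp add: x y ord_p_eqI)
    define z where "z = u + pp ^ nat (j - i) * v"
    have "pp powi j = pp powi i * (pp::'p qp) ^ nat (j - i)"
      using ij pp_nonzero[where 'p='p] power_int_add[of "pp::'p qp" i "j - i"]
      by (simp add: power_int_def[of _ "j - i"])
    then have xy: "x + y = pp powi i * z" by (simp add: x y z_def algebra_simps)
    have z: "z \<in> Zp" "z \<noteq> 0"
      using x(1) y(1) xy ne(3) by (simp_all add: z_def Zp_units_def Zp_closed del: of_nat_power)
    obtain k w where w: "w \<in> Zp_units" "z = pp powi k * w" using qp_decomp[OF z(2)] .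
    have "x + y = pp powi (i + k) * w"
      using pp_nonzero[where 'p='p] by (simp add: xy w power_int_add)
    then have "ord_p (x + y) = i + ord_p z" using w ord_p_eqI by metis
    then show ?thesis using ord_p_Zp[OF z] ord_p_eqI[OF x(1), of i] x(2) by simp
  qed
  show ?thesis
  proof (cases "ord_p x \<le> ord_p y")
    case True
    with aux[of x y] assms show ?thesis by simp
  next
    case False
    with aux[of y x] assms show ?thesis by (simp add: add.commute)
  qed
qed

lemma abs_p_nonneg: "0 \<le> abs_p x"
  by (simp add: abs_p_def)

lemma abs_p_uminus: "abs_p (- x) = abs_p x"
  by (simp add: abs_p_def ord_p_uminus)

lemma abs_p_eq_0_iff: "abs_p (x::'p::prime_card qp) = 0 \<longleftrightarrow> x = 0"
  using prime_card[where 'a='p] by (auto simp: abs_p_def)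

lemma abs_p_ultra: "abs_p (x + y) \<le> max (abs_p x) (abs_p (y::'p::prime_card qp))"
proof (cases "x = 0 \<or> y = 0 \<or> x + y = 0")
  case True
  then show ?thesis using abs_p_nonneg[of x] abs_p_nonneg[of y] by (auto simp: abs_p_def le_max_iff_disj)
next
  case False
  have p1: "1 \<le> real CARD('p)"
    using prime_gt_1_nat[OF prime_card[where 'a='p]] by simp
  have "real CARD('p) powi (- ord_p (x + y)) \<le> real CARD('p) powi (- min (ord_p x) (ord_p y))"
    using ord_p_add[of x y] False p1 by (intro power_int_increasing) auto
  then show ?thesis using False by (auto simp: abs_p_def min_def max_def split: if_splits)
qed

instantiation qp :: (prime_card) metric_space
begin

definition dist_qp :: "'a qp \<Rightarrow> 'a qp \<Rightarrow> real" where
  "dist_qp x y = abs_p (x - y)"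

definition uniformity_qp :: "('a qp \<times> 'a qp) filter" where
  "uniformity_qp = (INF e\<in>{0 <..}. principal {(x, y). dist x y < e})"

definition open_qp :: "'a qp set \<Rightarrow> bool" where
  "open_qp U \<longleftrightarrow> (\<forall>x\<in>U. eventually (\<lambda>(x', y). x' = x \<longrightarrow> y \<in> U) uniformity)"

instance
proof
  fix x y z :: "'a qp"
  show "dist x y = 0 \<longleftrightarrow> x = y" by (simp add: dist_qp_def abs_p_eq_0_iff)
  have "abs_p (x - y) \<le> max (abs_p (x - z)) (abs_p (- (y - z)))"
    using abs_p_ultra[of "x - z" "- (y - z)"] by (simp only: minus_diff_eq diff_add_cancel add_diff_eq)
  then have "abs_p (x - y) \<le> max (abs_p (x - z)) (abs_p (y - z))"
    by (simp only: abs_p_uminus)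
  then show "dist x y \<le> dist x z + dist y z"
    using abs_p_nonneg[of "x - z"] abs_p_nonneg[of "y - z"]
    by (simp add: dist_qp_def)
qed (simp_all add: uniformity_qp_def open_qp_def)

end

definition locally_constant :: "('a::topological_space \<Rightarrow> 'b) \<Rightarrow> bool" where
  "locally_constant f \<longleftrightarrow> (\<forall>x. \<exists>U. open U \<and> x \<in> U \<and> (\<forall>y\<in>U. f y = f x))"

section \<open>Characters\<close>

definition additive_character :: "('p::prime_card qp \<Rightarrow> complex) \<Rightarrow> bool" where
  "additive_character \<psi> \<longleftrightarrow>
     (\<forall>x y. \<psi> (x + y) = \<psi> x * \<psi> y) \<and> (\<forall>x. norm (\<psi> x) = 1) \<and> continuous_on UNIV \<psi>"

definition conductor_zero :: "('p::prime_card qp \<Rightarrow> complex) \<Rightarrow> bool" where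
  "conductor_zero \<psi> \<longleftrightarrow> (\<forall>x\<in>Zp. \<psi> x = 1) \<and> (\<exists>x\<in>pZp (-1). \<psi> x \<noteq> 1)"

text \<open>The value of a multiplicative character at 0 is irrelevant.\<close>

definition multiplicative_character :: "('p::prime_card qp \<Rightarrow> complex) \<Rightarrow> bool" where
  "multiplicative_character \<mu> \<longleftrightarrow>
     (\<forall>x. x \<noteq> 0 \<longrightarrow> \<mu> x \<noteq> 0) \<and>
     (\<forall>x y. x \<noteq> 0 \<longrightarrow> y \<noteq> 0 \<longrightarrow> \<mu> (x * y) = \<mu> x * \<mu> y) \<and>
     continuous_on (- {0}) \<mu>"

definition unit_filtration :: "nat \<Rightarrow> 'p::prime_card qp set" where
  "unit_filtration m = (if m = 0 then Zp_units else {u. u - 1 \<in> pZp (int m)})"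

text \<open>This is used both for characters of the multiplicative group of the field and for characters
  of the group of units.\<close>

definition conductor_exponent :: "('p::prime_card qp \<Rightarrow> complex) \<Rightarrow> nat" where
  "conductor_exponent \<theta> = (LEAST m. \<forall>u\<in>unit_filtration m. \<theta> u = 1)"

text \<open>The trivial character is also given the value 1 at non-units, which occur as lower right
  entries of elements of \<open>K_level 0\<close>.\<close>

definition trivial_char :: "'p::prime_card qp \<Rightarrow> complex" where
  "trivial_char = (\<lambda>_. 1)"

definition residue_mod_p :: "'p::prime_card qp \<Rightarrow> int" where
  "residue_mod_p x = (THE a. 0 \<le> a \<and> a < int CARD('p) \<and> x - of_int a \<in> pZp 1)"

definition legendre_char :: "'p::prime_card qp \<Rightarrow> complex" where
  "legendre_char u = of_int (Legendre (residue_mod_p u) (int CARD('p)))"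

section \<open>The Weil index\<close>

definition schwartz :: "('p::prime_card qp \<Rightarrow> complex) \<Rightarrow> bool" where
  "schwartz \<phi> \<longleftrightarrow> locally_constant \<phi> \<and> compact (closure {x. \<phi> x \<noteq> 0})"

text \<open>The integral of a Schwartz function against the Haar measure giving \<open>Zp\<close> volume 1. If the
  function is supported in \<open>p ^ -N Zp\<close> and invariant under \<open>p ^ N Zp\<close>, then it is the sum of the
  values at the representatives \<open>j / p ^ N\<close>, \<open>0 \<le> j < p ^ (2 * N)\<close>, of \<open>p ^ -N Zp\<close> modulo
  \<open>p ^ N Zp\<close>, times the volume of \<open>p ^ N Zp\<close>; so the sequence is eventually constant.\<close>

definition haar_integral :: "('p::prime_card qp \<Rightarrow> complex) \<Rightarrow> complex" where
  "haar_integral \<phi> =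
     lim (\<lambda>N. (\<Sum>j<CARD('p) ^ (2 * N). \<phi> (of_nat j / pp ^ N)) / of_nat (CARD('p) ^ N))"

definition fourier :: "real \<Rightarrow> ('p::prime_card qp \<Rightarrow> complex) \<Rightarrow> ('p qp \<Rightarrow> complex) \<Rightarrow> 'p qp \<Rightarrow> complex"
  where "fourier c \<psi> \<phi> y = of_real c * haar_integral (\<lambda>x. \<phi> x * \<psi> (x * y))"

text \<open>The factor by which the Haar measure giving \<open>Zp\<close> volume 1 has to be scaled to be self-dual
  for the pairing \<open>\<psi> (x * y)\<close>.\<close>

definition self_dual_factor :: "('p::prime_card qp \<Rightarrow> complex) \<Rightarrow> real" where
  "self_dual_factor \<psi> =
     (THE c. 0 < c \<and> (\<forall>\<phi>. schwartz \<phi> \<longrightarrow> (\<forall>x. fourier c \<psi> (fourier c \<psi> \<phi>) x = \<phi> (- x))))"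

text \<open>The Weil index of the character of second degree \<open>q x = \<psi> (x\<^sup>2)\<close>. Since
  \<open>q (x + y) = q x * q y * \<psi> (2 * x * y)\<close>, the symmetric isomorphism attached to \<open>q\<close> is
  \<open>\<rho> x = 2 * x\<close>, and Weil's theorem states that the Fourier transform of the distribution \<open>q\<close> is the
  Weil index times \<open>\<bar>\<rho>\<bar> powr (-1/2)\<close> times the distribution \<open>x \<mapsto> 1 / q (x / 2)\<close>.\<close>

definition weil_index :: "('p::prime_card qp \<Rightarrow> complex) \<Rightarrow> complex" where
  "weil_index \<psi> = (let c = self_dual_factor \<psi> in
     (THE w. \<forall>\<phi>. schwartz \<phi> \<longrightarrow>
        of_real c * haar_integral (\<lambda>x. fourier c \<psi> \<phi> x * \<psi> (x\<^sup>2)) =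
        w * of_real (abs_p (2::'p qp) powr (- 1 / 2)) *
          (of_real c * haar_integral (\<lambda>x. \<phi> x * \<psi> (- (x / 2)\<^sup>2)))))"

definition weil_ratio :: "'p::prime_card qp \<Rightarrow> ('p qp \<Rightarrow> complex) \<Rightarrow> complex" where
  "weil_ratio a \<psi> = weil_index (\<lambda>x. \<psi> (a * x)) / weil_index \<psi>"

section \<open>The group SL2 and its metaplectic double cover\<close>

typedef (overloaded) ('p::prime_card) sl2 = "{A :: 'p qp ^ 2 ^ 2. det A = 1}"
  morphisms mat_of Abs_sl2
  by (intro exI[of _ "mat 1"]) simp

setup_lifting type_definition_sl2

instantiation sl2 :: (prime_card) monoid_mult
begin

lift_definition one_sl2 :: "'a sl2" is "mat 1" by simp

lift_definition times_sl2 :: "'a sl2 \<Rightarrow> 'a sl2 \<Rightarrow> 'a sl2" is "(**)"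
  by (simp add: det_mul)

instance
  by standard (transfer; simp add: matrix_mul_assoc)+

end

abbreviation entry :: "'p::prime_card sl2 \<Rightarrow> 2 \<Rightarrow> 2 \<Rightarrow> 'p qp" where
  "entry g i j \<equiv> mat_of g $ i $ j"

definition lower_unip :: "'p::prime_card qp \<Rightarrow> 'p sl2" where
  "lower_unip s = Abs_sl2 (vector [vector [1, 0], vector [s, 1]])"

lemma mat_of_lower_unip: "mat_of (lower_unip s) = vector [vector [1, 0], vector [s, 1]]"
  by (simp add: lower_unip_def Abs_sl2_inverse det_2)

definition hilbert_symbol :: "'p::prime_card qp \<Rightarrow> 'p qp \<Rightarrow> int" where
  "hilbert_symbol a b =
     (if \<exists>x y z. (x, y, z) \<noteq> (0, 0, 0) \<and> z\<^sup>2 = a * x\<^sup>2 + b * y\<^sup>2 then 1 else - 1)"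

definition kubota_tau :: "'p::prime_card sl2 \<Rightarrow> 'p qp" where
  "kubota_tau g = (if entry g 2 1 \<noteq> 0 then entry g 2 1 else entry g 2 2)"

definition kubota_s :: "'p::prime_card sl2 \<Rightarrow> int" where
  "kubota_s g = (if entry g 2 1 * entry g 2 2 \<noteq> 0 \<and> odd (ord_p (entry g 2 1))
     then hilbert_symbol (entry g 2 1) (entry g 2 2) else 1)"

definition cocycle :: "'p::prime_card sl2 \<Rightarrow> 'p sl2 \<Rightarrow> int" where
  "cocycle g h =
     hilbert_symbol (kubota_tau (g * h) * kubota_tau g) (kubota_tau (g * h) * kubota_tau h) *
     kubota_s g * kubota_s h * kubota_s (g * h)"

lemma cocycle_sign: "cocycle g h \<in> {1, - 1}"
proof -
  have h: "hilbert_symbol a b \<in> {1, - 1}" for a b :: "'a qp"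
    unfolding hilbert_symbol_def by (simp only: insert_iff split: if_split) blast
  have s: "kubota_s g \<in> {1, - 1}" for g :: "'a sl2"
    unfolding kubota_s_def using h by (simp only: insert_iff split: if_split) blast
  have m: "x * y \<in> {1, - 1}" if "x \<in> {1, - 1}" "y \<in> {1, - 1}" for x y :: int
    using that by auto
  show ?thesis unfolding cocycle_def by (intro m h s)
qed

typedef (overloaded) ('p::prime_card) mp = "(UNIV :: 'p sl2 set) \<times> {1, - 1 :: int}"
  morphisms pair_of Mp
  by blast

definition mp_proj :: "'p::prime_card mp \<Rightarrow> 'p sl2" where
  "mp_proj x = fst (pair_of x)"

definition mp_sign :: "'p::prime_card mp \<Rightarrow> int" where
  "mp_sign x = snd (pair_of x)"

definition mp_lift :: "'p::prime_card sl2 \<Rightarrow> 'p mp" where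
  "mp_lift g = Mp (g, 1)"

instantiation mp :: (prime_card) times
begin

definition times_mp :: "'a mp \<Rightarrow> 'a mp \<Rightarrow> 'a mp" where
  "x * y = Mp (mp_proj x * mp_proj y,
     mp_sign x * mp_sign y * cocycle (mp_proj x) (mp_proj y))"

instance ..

end

lemma mp_proj_times: "mp_proj (x * y) = mp_proj x * mp_proj y"
  and mp_sign_times: "mp_sign (x * y) = mp_sign x * mp_sign y * cocycle (mp_proj x) (mp_proj y)"
proof -
  have "mp_sign x \<in> {1, - 1}" "mp_sign y \<in> {1, - 1}"
    using pair_of[of x] pair_of[of y] by (auto simp: mp_sign_def)
  then have "(mp_proj x * mp_proj y, mp_sign x * mp_sign y * cocycle (mp_proj x) (mp_proj y))
      \<in> UNIV \<times> {1, - 1}"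
    using cocycle_sign[of "mp_proj x" "mp_proj y"] by auto
  then have "pair_of (x * y) =
      (mp_proj x * mp_proj y, mp_sign x * mp_sign y * cocycle (mp_proj x) (mp_proj y))"
    unfolding times_mp_def by (rule Mp_inverse)
  then show "mp_proj (x * y) = mp_proj x * mp_proj y"
    "mp_sign (x * y) = mp_sign x * mp_sign y * cocycle (mp_proj x) (mp_proj y)"
    unfolding mp_proj_def[of "x * y"] mp_sign_def[of "x * y"] by (simp_all only: fst_conv snd_conv)
qed

lemma mp_lift_simps: "mp_proj (mp_lift g) = g" "mp_sign (mp_lift g) = 1"
  by (simp_all add: mp_proj_def mp_sign_def mp_lift_def Mp_inverse)

definition full_preimage :: "'p::prime_card sl2 set \<Rightarrow> 'p mp set" where
  "full_preimage S = {g. mp_proj g \<in> S}"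

definition K_level :: "nat \<Rightarrow> 'p::prime_card sl2 set" where
  "K_level m = {g. (\<forall>i j. entry g i j \<in> Zp) \<and> entry g 2 1 \<in> pZp (int m)}"

definition principal_congruence :: "nat \<Rightarrow> 'p::prime_card sl2 set" where
  "principal_congruence m = {g. \<forall>i j. entry g i j - mat 1 $ i $ j \<in> pZp (int m)}"

lemma pZp_mono: "m \<le> n \<Longrightarrow> pZp (int n) \<subseteq> (pZp (int m) :: 'p::prime_card qp set)"
proof
  fix x :: "'p qp" assume mn: "m \<le> n" and "x \<in> pZp (int n)"
  then obtain z where z: "z \<in> Zp" "x = pp ^ n * z"
    unfolding pZp_def power_int_of_nat by (elim imageE)
  have "(pp ^ n :: 'p qp) = pp ^ m * pp ^ (n - m)"
    by (metis mn le_add_diff_inverse power_add)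
  then have "x = pp ^ m * (pp ^ (n - m) * z)"
    unfolding z(2) by (simp only: mult.assoc)
  moreover have "pp ^ (n - m) * z \<in> Zp" by (intro Zp_closed(3,5,7) z(1))
  ultimately show "x \<in> pZp (int m)"
    unfolding pZp_def power_int_of_nat by (rule image_eqI)
qed

lemma principal_congruence_mono:
  "m \<le> n \<Longrightarrow> principal_congruence n \<subseteq> principal_congruence m"
  unfolding principal_congruence_def using pZp_mono by blast

text \<open>The topology of the double cover is the one of a topological group in which
  \<open>k \<mapsto> (k, 1)\<close> maps \<open>SL2(Zp)\<close> homeomorphically onto an open subgroup: the translates of the images
  of the principal congruence subgroups are the basic neighbourhoods. It is not the product topology
  of \<open>SL2\<close> and the set of signs, because the cocycle is not locally constant.\<close>

instantiation mp :: (prime_card) topological_space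
begin

definition open_mp :: "'a mp set \<Rightarrow> bool" where
  "open_mp U \<longleftrightarrow> (\<forall>g\<in>U. \<exists>m. \<forall>k\<in>principal_congruence m. g * mp_lift k \<in> U)"

instance
proof
  show "open (UNIV :: 'a mp set)" by (simp add: open_mp_def)
  fix S T :: "'a mp set" and A :: "'a mp set set"
  show "open (\<Union>A)" if "\<forall>U\<in>A. open U"
    using that unfolding open_mp_def by (meson UnionE UnionI)
  show "open (S \<inter> T)" if ST: "open S" "open T"
    unfolding open_mp_def
  proof
    fix g assume "g \<in> S \<inter> T"
    then obtain m n where
      "\<forall>k\<in>principal_congruence m. g * mp_lift k \<in> S" "\<forall>k\<in>principal_congruence n. g * mp_lift k \<in> T"
      using ST unfolding open_mp_def by blast
    then have "\<forall>k\<in>principal_congruence (max m n). g * mp_lift k \<in> S \<inter> T"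
      using principal_congruence_mono[of m "max m n"] principal_congruence_mono[of n "max m n"]
      by auto
    then show "\<exists>m. \<forall>k\<in>principal_congruence m. g * mp_lift k \<in> S \<inter> T" by blast
  qed
qed

end

section \<open>The principal series representation and its fixed vectors\<close>

definition Borel :: "'p::prime_card mp set" where
  "Borel = full_preimage {g. entry g 2 1 = 0}"

text \<open>The matrix \<open>h(a) x(b)\<close> has rows \<open>(a, a * b)\<close> and \<open>(0, 1 / a)\<close>, so that \<open>a\<close> is its upper left
  entry.\<close>

definition mu_B :: "('p::prime_card qp \<Rightarrow> complex) \<Rightarrow> ('p qp \<Rightarrow> complex) \<Rightarrow> 'p mp \<Rightarrow> complex" where
  "mu_B \<psi> \<mu> b = (let a = entry (mp_proj b) 1 1 in
     of_int (mp_sign b) * of_real (abs_p a) * \<mu> a * inverse (weil_ratio a \<psi>))"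

definition V :: "('p::prime_card qp \<Rightarrow> complex) \<Rightarrow> ('p qp \<Rightarrow> complex) \<Rightarrow> ('p mp \<Rightarrow> complex) set" where
  "V \<psi> \<mu> = {f. locally_constant f \<and> (\<forall>b\<in>Borel. \<forall>g. f (b * g) = mu_B \<psi> \<mu> b * f g)}"

definition eta_cover :: "('p::prime_card qp \<Rightarrow> complex) \<Rightarrow> 'p mp \<Rightarrow> complex" where
  "eta_cover \<eta> k = of_int (mp_sign k) * \<eta> (entry (mp_proj k) 2 2)"

text \<open>The equivariance condition reads \<open>\<pi>(k) f = \<eta>(k) f\<close>, where \<open>\<pi>\<close> is right translation.\<close>

definition V_eta :: "('p::prime_card qp \<Rightarrow> complex) \<Rightarrow> ('p qp \<Rightarrow> complex) \<Rightarrow> ('p qp \<Rightarrow> complex) \<Rightarrow>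
    nat \<Rightarrow> ('p mp \<Rightarrow> complex) set" where
  "V_eta \<psi> \<mu> \<eta> m =
     {f \<in> V \<psi> \<mu>. \<forall>g. \<forall>k\<in>full_preimage (K_level m). f (g * k) = f g * eta_cover \<eta> k}"

definition eta_conductor ::
  "('p::prime_card qp \<Rightarrow> complex) \<Rightarrow> ('p qp \<Rightarrow> complex) \<Rightarrow> ('p qp \<Rightarrow> complex) \<Rightarrow> nat" where
  "eta_conductor \<psi> \<mu> \<eta> = (LEAST m. conductor_exponent \<eta> \<le> m \<and> V_eta \<psi> \<mu> \<eta> m \<noteq> {0})"

text \<open>Independence of the chosen factorisation of \<open>g\<close> is not built into the definition.\<close>

definition f_kappa :: "('p::prime_card qp \<Rightarrow> complex) \<Rightarrow> ('p qp \<Rightarrow> complex) \<Rightarrow> ('p qp \<Rightarrow> complex) \<Rightarrow>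
    nat \<Rightarrow> 'p qp \<Rightarrow> 'p mp \<Rightarrow> complex" where
  "f_kappa \<psi> \<mu> \<eta> n \<kappa> g =
     (let fact = (\<lambda>(b, k). b \<in> Borel \<and> k \<in> full_preimage (K_level (2 * n)) \<and>
                    g = b * mp_lift (lower_unip (\<kappa> * pp ^ n)) * k)
      in if \<exists>bk. fact bk
         then (case (SOME bk. fact bk) of (b, k) \<Rightarrow> mu_B \<psi> \<mu> b * eta_cover \<eta> k)
         else 0)"

global_interpretation fun_space: vector_space "\<lambda>(c::complex) (f :: 'a \<Rightarrow> complex) x. c * f x"
  by standard (auto simp: fun_eq_iff algebra_simps)

end

theory Submission
  imports Defs
begin

text \<open>By the Iwasawa decomposition, an equivariant function is determined by its values at \<open>y(s)\<close> with
  \<open>s\<close> in \<open>p Zp\<close> or \<open>s = 1\<close>. For \<open>a \<equiv> 1\<close> modulo \<open>p ^ r\<close> some matrix with rows \<open>(a, e)\<close> and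
  \<open>(0, 1 / a)\<close> is conjugated into \<open>K_level m\<close> by \<open>y(s)\<close>, where \<open>r\<close> is the smaller one of \<open>ord_p s\<close> and
  \<open>m - ord_p s\<close>; hence a nonzero value at \<open>y(s)\<close> forces \<open>\<mu>\<close> to be trivial on \<open>1 + p ^ r Zp\<close>, that is
  \<open>n \<le> ord_p s \<le> m - n\<close>. For \<open>m < 2 * n\<close> nothing is left, and for \<open>m = 2 * n\<close> only \<open>ord_p s = n\<close>, where
  conjugation by the torus reduces \<open>s / p ^ n\<close> to its square class. Conversely, the stabiliser of
  \<open>y(\<kappa> p ^ n)\<close> has \<open>a \<equiv> \<plusminus>1\<close> modulo \<open>p ^ n\<close>, so \<open>\<mu>(-1) = \<eta>(-1)\<close> makes \<open>f_kappa\<close> well defined.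

  This needs that the double cover is a group which splits over \<open>SL2(Zp)\<close>, and that the ratio of Weil
  indices is a character up to the Hilbert symbol. For odd \<open>p\<close> the Hilbert symbol is an explicit bilinear
  form in the parity of the order and the quadratic character of the unit part, and the Steinberg
  relation gives the cocycle identity. The Weil index is a normalised Gauss sum, obtained from
  Fourier analysis on indicator functions of balls.\<close>

section \<open>Orders, ideals and compactness\<close>

text \<open>The range of \<open>ord_p s\<close> comes from one formula: the conjugate by
  \<open>y(s)\<close> of the matrix with rows \<open>(a, e)\<close> and \<open>(0, 1 / a)\<close>
  has lower left entry \<open>s * (1 / a - a - e * s)\<close>. With \<open>e = 0\<close> it is
  divisible by \<open>p ^ m\<close> as soon as \<open>a\<close> is 1 modulo
  \<open>p ^ (m - ord_p s)\<close>; with \<open>e = (1 / a - a) / s\<close> it vanishes, and this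
  \<open>e\<close> is integral as soon as \<open>a\<close> is 1 modulo \<open>p ^ ord_p s\<close>.
  The conductor supplies an \<open>a\<close> with \<open>\<mu> a \<noteq> 1\<close> at every
  positive level below \<open>n\<close>, and \<open>n > 1\<close> makes level 1 one of these. The
  obstacle is the cocycle, which has simple values only on two subgroups: it is 1 on
  \<open>SL2(Zp)\<close>, and on the Borel subgroup it is the Hilbert symbol of the upper left
  entries, exactly the defect of the Weil ratio. All computations in the cover are therefore
  arranged so that each product takes place inside one of these subgroups or uses only the group
  law. The Haar integral, the self-dual factor, the Weil index and \<open>f_kappa\<close> are
  defined by limits, descriptions or choice, so each of them is first turned into an explicit
  expression.\<close>

lemma one_in_Zp_units: "(1::'p::prime_card qp) \<in> Zp_units"
  by (simp add: Zp_units_def Zp_closed)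

lemma Zp_units_mult: "u \<in> Zp_units \<Longrightarrow> v \<in> Zp_units \<Longrightarrow> u * v \<in> (Zp_units :: 'p::prime_card qp set)"
  by (auto simp: Zp_units_def Zp_closed)

lemma Zp_units_inverse: "u \<in> Zp_units \<Longrightarrow> inverse u \<in> (Zp_units :: 'p::prime_card qp set)"
  by (auto simp: Zp_units_def Zp_closed)

lemma ord_p_pp_powi: "ord_p (pp powi k :: 'p::prime_card qp) = k"
  using ord_p_eqI[OF one_in_Zp_units, of k, where 'p='p] by simp

lemma ord_p_pp: "ord_p (pp :: 'p::prime_card qp) = 1"
  using ord_p_pp_powi[of 1, where 'p='p] by simp

lemma ord_p_1: "ord_p (1 :: 'p::prime_card qp) = 0"
  using ord_p_pp_powi[of 0, where 'p='p] by simp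

lemma pp_powi_nonzero: "(pp powi k :: 'p::prime_card qp) \<noteq> 0"
  using pp_nonzero[where 'p='p] by (simp add: power_int_eq_0_iff)

lemma pp_powi_add: "(pp powi (i + j) :: 'p::prime_card qp) = pp powi i * pp powi j"
  by (rule power_int_add) (simp add: pp_nonzero)

lemma ord_p_mult:
  fixes x y :: "'p::prime_card qp"
  assumes "x \<noteq> 0" "y \<noteq> 0"
  shows "ord_p (x * y) = ord_p x + ord_p y"
proof -
  obtain i u where x: "u \<in> Zp_units" "x = pp powi i * u" using qp_decomp[OF assms(1)] .
  obtain j v where y: "v \<in> Zp_units" "y = pp powi j * v" using qp_decomp[OF assms(2)] .
  have "x * y = pp powi (i + j) * (u * v)"
    by (simp add: x y pp_powi_add mult_ac)
  then have "ord_p (x * y) = i + j"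
    using ord_p_eqI[OF Zp_units_mult[OF x(1) y(1)]] by simp
  then show ?thesis using ord_p_eqI[OF x(1)] ord_p_eqI[OF y(1)] x y by simp
qed

lemma ord_p_inverse: "x \<noteq> 0 \<Longrightarrow> ord_p (inverse x) = - ord_p (x::'p::prime_card qp)"
  using ord_p_mult[of x "inverse x"] by (simp add: ord_p_1)

lemma ord_p_divide: "x \<noteq> 0 \<Longrightarrow> y \<noteq> 0 \<Longrightarrow> ord_p (x / y) = ord_p x - ord_p (y::'p::prime_card qp)"
  by (simp add: divide_inverse ord_p_mult ord_p_inverse)

lemma ord_p_power: "x \<noteq> 0 \<Longrightarrow> ord_p (x ^ n) = int n * ord_p (x::'p::prime_card qp)"
  by (induction n) (simp_all add: ord_p_1 ord_p_mult algebra_simps)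

lemma mem_Zp_units_iff: "u \<in> Zp_units \<longleftrightarrow> u \<noteq> 0 \<and> ord_p (u::'p::prime_card qp) = 0"
proof
  assume "u \<in> Zp_units"
  then show "u \<noteq> 0 \<and> ord_p u = 0"
    using ord_p_eqI[of u 0] by (simp add: Zp_units_def)
next
  assume u: "u \<noteq> 0 \<and> ord_p u = 0"
  then obtain k v where "v \<in> Zp_units" "u = pp powi k * v" using qp_decomp by blast
  then show "u \<in> Zp_units" using ord_p_eqI[of v k] u by simp
qed

lemma mem_Zp_iff: "x \<in> Zp \<longleftrightarrow> x = 0 \<or> 0 \<le> ord_p (x::'p::prime_card qp)"
proof
  assume "x \<in> Zp" then show "x = 0 \<or> 0 \<le> ord_p x" using ord_p_Zp by blast
next
  assume *: "x = 0 \<or> 0 \<le> ord_p x"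
  show "x \<in> Zp"
  proof (cases "x = 0")
    case False
    then obtain k u where u: "u \<in> Zp_units" "x = pp powi k * u" using qp_decomp by blast
    then have "k \<ge> 0" using * False ord_p_eqI by metis
    then have "pp powi k = (pp::'p qp) ^ nat k" by (simp add: power_int_def)
    then show ?thesis using u Zp_closed(3)[of "CARD('p)"] by (auto simp: Zp_units_def intro!: Zp_closed)
  qed (simp add: Zp_closed)
qed

lemma mem_pZp_iff: "x \<in> pZp k \<longleftrightarrow> x = 0 \<or> k \<le> ord_p (x::'p::prime_card qp)"
proof -
  have "x \<in> pZp k \<longleftrightarrow> x / pp powi k \<in> Zp"
    unfolding pZp_def using pp_powi_nonzero[of k, where 'p='p] by (auto simp: image_iff field_simps intro: bexI[of _ "x / pp powi k"])
  also have "\<dots> \<longleftrightarrow> x = 0 \<or> k \<le> ord_p x"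
    using pp_powi_nonzero[of k, where 'p='p] pp_nonzero[where 'p='p]
    by (cases "x = 0") (simp_all add: mem_Zp_iff ord_p_divide ord_p_pp_powi)
  finally show ?thesis .
qed

lemma pZp_0: "pZp 0 = (Zp :: 'p::prime_card qp set)"
  by (auto simp: mem_pZp_iff mem_Zp_iff)

lemma zero_in_pZp: "0 \<in> (pZp k :: 'p::prime_card qp set)"
  by (simp add: mem_pZp_iff)

lemma pZp_uminus: "- x \<in> pZp k \<longleftrightarrow> x \<in> (pZp k :: 'p::prime_card qp set)"
  by (cases "x = 0") (simp_all add: mem_pZp_iff ord_p_uminus)

lemma pZp_add:
  assumes "x \<in> pZp k" "y \<in> pZp k" shows "x + y \<in> (pZp k :: 'p::prime_card qp set)"
proof (cases "x = 0 \<or> y = 0 \<or> x + y = 0")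
  case True then show ?thesis using assms by (auto simp: mem_pZp_iff)
next
  case False then show ?thesis using assms ord_p_add[of x y] by (auto simp: mem_pZp_iff)
qed

lemma pZp_diff: "x \<in> pZp k \<Longrightarrow> y \<in> pZp k \<Longrightarrow> x - y \<in> (pZp k :: 'p::prime_card qp set)"
  using pZp_add[of x k "- y"] by (simp add: pZp_uminus)

lemma pZp_diff_sym: "x - y \<in> pZp k \<longleftrightarrow> y - x \<in> (pZp k :: 'p::prime_card qp set)"
  using pZp_uminus[of "x - y" k] by simp

lemma pZp_diff_trans: "x - y \<in> pZp k \<Longrightarrow> y - z \<in> pZp k \<Longrightarrow> x - z \<in> (pZp k :: 'p::prime_card qp set)"
  using pZp_add[of "x - y" k "y - z"] by simp

lemma pZp_add_cancel: "y \<in> pZp k \<Longrightarrow> x + y \<in> pZp k \<longleftrightarrow> x \<in> (pZp k :: 'p::prime_card qp set)"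
  using pZp_add[of x k y] pZp_diff[of "x + y" k y] by auto

lemma pZp_mult: "x \<in> pZp i \<Longrightarrow> y \<in> pZp j \<Longrightarrow> x * y \<in> (pZp (i + j) :: 'p::prime_card qp set)"
  by (cases "x = 0 \<or> y = 0") (auto simp: mem_pZp_iff ord_p_mult)

lemma pZp_mult_Zp: "x \<in> pZp i \<Longrightarrow> y \<in> Zp \<Longrightarrow> x * y \<in> (pZp i :: 'p::prime_card qp set)"
  using pZp_mult[of x i y 0] by (simp add: pZp_0)

lemma pZp_le: "i \<le> j \<Longrightarrow> x \<in> pZp j \<Longrightarrow> x \<in> (pZp i :: 'p::prime_card qp set)"
  by (auto simp: mem_pZp_iff)

lemma pZp_imp_Zp: "0 \<le> j \<Longrightarrow> x \<in> pZp j \<Longrightarrow> x \<in> (Zp :: 'p::prime_card qp set)"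
  using pZp_le[of 0 j x] by (simp add: pZp_0)

lemma mult_pp_powi_mem_pZp_iff: "pp powi i * x \<in> pZp j \<longleftrightarrow> x \<in> (pZp (j - i) :: 'p::prime_card qp set)"
  using pp_powi_nonzero[of i, where 'p='p]
  by (cases "x = 0") (auto simp: mem_pZp_iff ord_p_mult ord_p_pp_powi)

lemma unit_mult_mem_pZp_iff: "u \<in> Zp_units \<Longrightarrow> u * x \<in> pZp j \<longleftrightarrow> x \<in> (pZp j :: 'p::prime_card qp set)"
  by (cases "x = 0") (auto simp: mem_Zp_units_iff mem_pZp_iff ord_p_mult)

lemma mult_mem_pZp_iff: "u \<noteq> 0 \<Longrightarrow> u * x \<in> pZp j \<longleftrightarrow> x \<in> (pZp (j - ord_p u) :: 'p::prime_card qp set)"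
  by (cases "x = 0") (auto simp: mem_pZp_iff ord_p_mult)

lemma Zp_diff: "x \<in> Zp \<Longrightarrow> y \<in> Zp \<Longrightarrow> x - y \<in> (Zp :: 'p::prime_card qp set)"
  using pZp_diff[of x 0 y] by (simp add: pZp_0)

lemma Zp_of_int: "of_int k \<in> (Zp :: 'p::prime_card qp set)"
  by (cases k rule: int_diff_cases) (simp add: Zp_diff Zp_closed)

lemma unit_iff_not_mem_pZp: "x \<in> Zp \<Longrightarrow> x \<in> Zp_units \<longleftrightarrow> x \<notin> (pZp 1 :: 'p::prime_card qp set)"
  by (auto simp: mem_Zp_iff mem_pZp_iff mem_Zp_units_iff)

lemma one_plus_pZp_unit:
  assumes "u - 1 \<in> pZp k" "k \<ge> 1" shows "u \<in> (Zp_units :: 'p::prime_card qp set)"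
proof -
  have u: "u - 1 \<in> pZp 1" using pZp_le assms by blast
  have "u = (u - 1) + 1" by simp
  then have "u \<in> Zp" using pZp_imp_Zp[OF _ u] by (metis Zp_closed(2,4) zero_le_one)
  moreover have "u \<notin> pZp 1"
  proof
    assume "u \<in> pZp 1"
    with u have "u - (u - 1) \<in> pZp 1" by (rule pZp_diff[rotated])
    then show False by (simp add: mem_pZp_iff ord_p_1)
  qed
  ultimately show ?thesis by (simp add: unit_iff_not_mem_pZp)
qed

lemma unit_add_pZp: "u \<in> Zp_units \<Longrightarrow> x \<in> pZp 1 \<Longrightarrow> u + x \<in> (Zp_units :: 'p::prime_card qp set)"
  using pZp_add_cancel[of x 1 u] pZp_imp_Zp[of 1 x] unit_iff_not_mem_pZp[of u] unit_iff_not_mem_pZp[of "u + x"]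
  by (simp add: Zp_units_def Zp_closed)

text \<open>In the harder direction a Bezout relation \<open>a * p + b * j = 1\<close> would put 1
  into \<open>pZp 1\<close>.\<close>

lemma of_int_mem_pZp_1_iff: "(of_int j :: 'p::prime_card qp) \<in> pZp 1 \<longleftrightarrow> int CARD('p) dvd j"
proof
  assume "int CARD('p) dvd j"
  then obtain i where "j = int CARD('p) * i" by (elim dvdE)
  then have "(of_int j :: 'p qp) = pp * of_int i" by simp
  then show "(of_int j :: 'p qp) \<in> pZp 1"
    using mult_pp_powi_mem_pZp_iff[of 1 "of_int i :: 'p qp" 1] Zp_of_int[of i] by (simp add: pZp_0)
next
  assume j: "(of_int j :: 'p qp) \<in> pZp 1"
  show "int CARD('p) dvd j"
  proof (rule ccontr)
    assume "\<not> int CARD('p) dvd j"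
    then have "coprime (int CARD('p)) j" by (rule prime_imp_coprime[OF prime_card_int])
    then obtain a b where ab: "a * int CARD('p) + b * j = 1" using bezout_int[of "int CARD('p)" j] by auto
    have "(1::'p qp) = of_int a * pp + of_int b * of_int j"
      using arg_cong[OF ab, of "of_int :: int \<Rightarrow> 'p qp"] by simp
    moreover have "of_int a * pp \<in> (pZp 1 :: 'p qp set)"
      using pZp_mult_Zp[OF _ Zp_of_int[of a], of pp 1] by (simp add: mem_pZp_iff ord_p_pp mult.commute)
    moreover have "of_int b * of_int j \<in> (pZp 1 :: 'p qp set)"
      using pZp_mult_Zp[OF j Zp_of_int[of b]] by (simp add: mult.commute)
    ultimately have "(1::'p qp) \<in> pZp 1" using pZp_add by metis
    then show False by (simp add: mem_pZp_iff ord_p_1)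
  qed
qed

text \<open>Vanishing of the \<open>N\<close>-th residue means divisibility by \<open>p ^ N\<close>,
  so congruences in the field can be read off the inverse limit.\<close>

lemma qp_of_zp_diff_mem_pZp_iff:
  "qp_of_zp a - qp_of_zp b \<in> (pZp (int N) :: 'p::prime_card qp set) \<longleftrightarrow> residues_of a N = residues_of b N"
proof -
  have 1: "qp_of_zp c \<in> (pZp (int N) :: 'p qp set) \<longleftrightarrow> residues_of c N = 0" for c :: "'p zp"
  proof
    assume "residues_of c N = 0"
    then obtain y where "c = of_nat CARD('p) ^ N * y" using zp_divisible by blast
    then have "qp_of_zp c = pp powi int N * qp_of_zp y"
      by (simp add: qp_of_zp_hom qp_of_zp_power qp_of_zp_of_nat)
    then show "qp_of_zp c \<in> pZp (int N)" by (auto simp: pZp_def Zp_def)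
  next
    assume "qp_of_zp c \<in> pZp (int N)"
    then obtain y where "qp_of_zp c = pp powi int N * qp_of_zp y" by (auto simp: pZp_def Zp_def)
    then have "qp_of_zp c = qp_of_zp (of_nat CARD('p) ^ N * y)"
      by (simp add: qp_of_zp_hom qp_of_zp_power qp_of_zp_of_nat)
    then have "c = of_nat CARD('p) ^ N * y" by (simp only: qp_of_zp_eq_iff)
    then show "residues_of c N = 0"
      using residues_of_of_nat[of "CARD('p) ^ N" N, where 'p='p] by (simp add: times_zp.rep_eq)
  qed
  have "qp_of_zp a - qp_of_zp b = qp_of_zp (a - b)"
    using qp_of_zp_hom(3)[of a "- b"] qp_of_zp_hom(5)[of b] by simp
  then have "qp_of_zp a - qp_of_zp b \<in> pZp (int N) \<longleftrightarrow> (residues_of a N - residues_of b N) mod int CARD('p) ^ N = 0"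
    by (simp add: 1 minus_zp.rep_eq)
  also have "\<dots> \<longleftrightarrow> residues_of a N = residues_of b N"
    using residues_of_bounds(3)[of a N] residues_of_bounds(3)[of b N] mod_eq_dvd_iff by (metis dvd_eq_mod_eq_0)
  finally show ?thesis .
qed

lemma Zp_approx:
  assumes "x \<in> Zp"
  obtains j where "j < CARD('p) ^ N" "x - of_nat j \<in> (pZp (int N) :: 'p::prime_card qp set)"
proof -
  obtain a where a: "x = qp_of_zp a" using assms by (auto simp: Zp_def)
  let ?j = "nat (residues_of a N)"
  have "?j < CARD('p) ^ N"
    using residues_of_bounds(1,2)[of a N] by (simp add: nat_less_iff)
  moreover have "residues_of a N = residues_of (of_nat ?j :: 'p zp) N"
    using residues_of_bounds[of a N] by (simp add: residues_of_of_nat del: of_nat_nat)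
  then have "x - of_nat ?j \<in> pZp (int N)"
    using qp_of_zp_diff_mem_pZp_iff[of a "of_nat ?j" N] by (simp add: a qp_of_zp_of_nat)
  ultimately show thesis by (rule that)
qed

section \<open>Balls as cosets, completeness and compactness\<close>

lemma abs_p_le_iff: "abs_p x \<le> real CARD('p) powi (- k) \<longleftrightarrow> x \<in> (pZp k :: 'p::prime_card qp set)"
proof (cases "x = 0")
  case True
  then show ?thesis by (simp add: abs_p_def mem_pZp_iff)
next
  case False
  have p1: "1 < real CARD('p)"
    using prime_gt_1_nat[OF prime_card[where 'a='p]] by simp
  have "real CARD('p) powi (- ord_p x) \<le> real CARD('p) powi (- k) \<longleftrightarrow> - ord_p x \<le> - k"
    using p1 power_int_strict_increasing[of "- k" "- ord_p x" "real CARD('p)"]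
      power_int_increasing[of "- ord_p x" "- k" "real CARD('p)"] by linarith
  then show ?thesis using False by (simp add: abs_p_def mem_pZp_iff)
qed

lemma powi_less_obtain:
  assumes "0 < e" obtains N where "real CARD('p::prime_card) powi (- int N) < e"
proof -
  have p1: "1 < real CARD('p)"
    using prime_gt_1_nat[OF prime_card[where 'a='p]] by simp
  obtain N where "inverse (real CARD('p)) ^ N < e"
    using real_arch_pow_inv[OF assms, of "inverse (real CARD('p))"] p1 by (auto simp: field_simps)
  then have "real CARD('p) powi (- int N) < e" by (simp add: power_int_minus power_inverse)
  then show thesis by (rule that)
qed

text \<open>Balls are cosets of the ideals \<open>pZp (int N)\<close>, whose radii tend to 0; this
  turns openness into a statement about congruences.\<close>

lemma open_qp_iff: "open U \<longleftrightarrow> (\<forall>x\<in>U. \<exists>N. \<forall>y. y - x \<in> pZp (int N) \<longrightarrow> y \<in> (U :: 'p::prime_card qp set))"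
proof
  assume U: "open U"
  show "\<forall>x\<in>U. \<exists>N. \<forall>y. y - x \<in> pZp (int N) \<longrightarrow> y \<in> U"
  proof
    fix x assume "x \<in> U"
    with U obtain e where e: "e > 0" "\<And>y. dist y x < e \<Longrightarrow> y \<in> U" by (auto simp: open_dist)
    obtain N where "real CARD('p) powi (- int N) < e" using powi_less_obtain[OF e(1)] .
    then show "\<exists>N. \<forall>y. y - x \<in> pZp (int N) \<longrightarrow> y \<in> U"
      using e(2) by (intro exI[of _ N]) (auto simp: abs_p_le_iff[symmetric] dist_qp_def)
  qed
next
  assume *: "\<forall>x\<in>U. \<exists>N. \<forall>y. y - x \<in> pZp (int N) \<longrightarrow> y \<in> U"
  show "open U" unfolding open_dist
  proof
    fix x assume "x \<in> U"
    then obtain N where N: "\<And>y. y - x \<in> pZp (int N) \<Longrightarrow> y \<in> U" using * by blast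
    have "0 < real CARD('p) powi (- int N)" using p_pos[where 'p='p] by simp
    then show "\<exists>e>0. \<forall>y. dist y x < e \<longrightarrow> y \<in> U"
      using N by (intro exI[of _ "real CARD('p) powi (- int N)"])
        (auto simp: abs_p_le_iff[symmetric] dist_qp_def less_imp_le)
  qed
qed

lemma open_coset: "open {y. y - x \<in> (pZp k :: 'p::prime_card qp set)}"
  unfolding open_qp_iff
proof (intro ballI exI allI impI)
  fix y z assume "y \<in> {y. y - x \<in> pZp k}" "z - y \<in> pZp (int (nat k))"
  then show "z \<in> {y. y - x \<in> pZp k}"
    using pZp_le[of k "int (nat k)" "z - y"] pZp_diff_trans[of z y k x] by simp
qed

lemma closed_coset: "closed {y. y - x \<in> (pZp k :: 'p::prime_card qp set)}"
  unfolding closed_def open_qp_iff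
proof (intro ballI exI allI impI)
  fix y z assume y: "y \<in> - {y. y - x \<in> pZp k}" "z - y \<in> pZp (int (nat k))"
  then have "y - z \<in> pZp k"
    using pZp_le[of k "int (nat k)" "z - y"] pZp_diff_sym[of y z k] by simp
  then show "z \<in> - {y. y - x \<in> pZp k}"
    using pZp_diff_trans[of y z k x] y by auto
qed

lemma eq_if_all_pZp: 
  assumes "\<And>N. x - y \<in> pZp (int N)" shows "x = (y :: 'p::prime_card qp)"
proof (rule ccontr)
  assume "x \<noteq> y"
  with assms[of "Suc (nat (ord_p (x - y)))"] show False by (simp add: mem_pZp_iff split: if_splits)
qed

text \<open>For each \<open>N\<close> the \<open>N\<close>-th residues of a Cauchy sequence are
  eventually constant. The eventual values form a coherent sequence, which is the limit.\<close>

lemma complete_Zp: "complete (Zp :: 'p::prime_card qp set)"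
  unfolding complete_def
proof (intro allI impI)
  fix f :: "nat \<Rightarrow> 'p qp" assume f: "(\<forall>n. f n \<in> Zp) \<and> Cauchy f"
  then have "\<forall>n. \<exists>a. f n = qp_of_zp a" by (auto simp: Zp_def)
  then obtain a where a: "\<And>n. f n = qp_of_zp (a n)" by metis
  have "\<exists>M. \<forall>m\<ge>M. f m - f M \<in> pZp (int N)" for N
  proof -
    have "0 < real CARD('p) powi (- int N)" using p_pos[where 'p='p] by simp
    then obtain M where "\<forall>m\<ge>M. \<forall>n\<ge>M. dist (f m) (f n) < real CARD('p) powi (- int N)"
      using f unfolding Cauchy_def by blast
    then have "\<forall>m\<ge>M. f m - f M \<in> pZp (int N)"
      by (auto simp: abs_p_le_iff[symmetric] dist_qp_def less_imp_le)
    then show ?thesis by blast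
  qed
  then obtain M where M: "\<And>N m. m \<ge> M N \<Longrightarrow> f m - f (M N) \<in> pZp (int N)" by metis
  define r where "r = (\<lambda>N. residues_of (a (M N)) N)"
  have M': "residues_of (a m) N = r N" if "m \<ge> M N" for m N
    using M[OF that] by (simp add: a qp_of_zp_diff_mem_pZp_iff r_def)
  have "r (Suc N) mod int CARD('p) ^ N = r N" for N
  proof -
    let ?m = "max (M N) (M (Suc N))"
    have "residues_of (a ?m) (Suc N) mod int CARD('p) ^ N = residues_of (a ?m) N"
      using residues_of_mod[of "a ?m" N 1] by simp
    then show ?thesis by (simp add: M')
  qed
  then have mem: "r \<in> {x. \<forall>n. 0 \<le> x n \<and> x n < int CARD('p) ^ n \<and> x (Suc n) mod int CARD('p) ^ n = x n}"
    using residues_of_bounds by (auto simp: r_def)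
  define z where "z = (Abs_zp r :: 'p zp)"
  have z: "residues_of z N = r N" for N by (simp add: z_def Abs_zp_inverse[OF mem])
  have lim: "f m - qp_of_zp z \<in> pZp (int N)" if "m \<ge> M N" for m N
    using M'[OF that] by (simp add: a qp_of_zp_diff_mem_pZp_iff z)
  have "f \<longlonglongrightarrow> qp_of_zp z"
    unfolding lim_sequentially
  proof (intro allI impI)
    fix e :: real assume "0 < e"
    then obtain N where N: "real CARD('p) powi (- int N) < e" using powi_less_obtain by metis
    show "\<exists>no. \<forall>n\<ge>no. dist (f n) (qp_of_zp z) < e"
      using lim N by (intro exI[of _ "M N"]) (fastforce simp: dist_qp_def abs_p_le_iff[symmetric])
  qed
  then show "\<exists>l\<in>Zp. f \<longlonglongrightarrow> l" by (auto simp: Zp_def)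
qed

lemma compact_Zp: "compact (Zp :: 'p::prime_card qp set)"
  unfolding compact_eq_totally_bounded
proof (intro conjI complete_Zp allI impI)
  fix e :: real assume "0 < e"
  then obtain N where N: "real CARD('p) powi (- int N) < e" using powi_less_obtain by metis
  have "x \<in> (\<Union>y\<in>of_nat ` {..<CARD('p) ^ N}. ball y e)" if x: "x \<in> Zp" for x :: "'p qp"
  proof -
    obtain j where j: "j < CARD('p) ^ N" "x - of_nat j \<in> pZp (int N)" using Zp_approx[OF x] .
    have "abs_p (of_nat j - x) \<le> real CARD('p) powi (- int N)"
      using j(2) pZp_diff_sym[of x] by (simp only: abs_p_le_iff)
    then show ?thesis using N j(1)
      by (auto simp: dist_qp_def intro!: bexI[of _ j])
  qed
  then show "\<exists>k. finite k \<and> (Zp :: 'p qp set) \<subseteq> (\<Union>x\<in>k. ball x e)"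
    by (intro exI[of _ "of_nat ` {..<CARD('p) ^ N}"]) auto
qed

text \<open>The coset is an affine image of \<open>Zp\<close>, and the affine map multiplies all
  distances by one constant.\<close>

lemma compact_coset: "compact {y. y - x \<in> (pZp k :: 'p::prime_card qp set)}"
proof -
  let ?f = "\<lambda>z. x + pp powi k * z :: 'p qp"
  have ex: "\<exists>e>0. \<forall>x'. dist x' y < e \<longrightarrow> dist (?f x') (?f y) < d" if "d > 0" for y d
  proof -
    obtain N where N: "real CARD('p) powi (- int N) < d" using powi_less_obtain[OF \<open>d > 0\<close>] .
    have "dist (?f x') (?f y) < d" if "dist x' y < real CARD('p) powi (- (int N - k))" for x'
    proof -
      have "x' - y \<in> pZp (int N - k)"
        using that by (simp only: dist_qp_def abs_p_le_iff[symmetric] less_imp_le)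
      then have "pp powi k * (x' - y) \<in> pZp (int N)" by (simp add: mult_pp_powi_mem_pZp_iff)
      then show ?thesis using N
        by (simp add: dist_qp_def abs_p_le_iff[symmetric] algebra_simps)
    qed
    moreover have "0 < real CARD('p) powi (- (int N - k))" using p_pos[where 'p='p] by simp
    ultimately show ?thesis by blast
  qed
  have "continuous_on Zp ?f" unfolding continuous_on_iff using ex by meson
  then have "compact (?f ` Zp)" using compact_Zp by (rule compact_continuous_image)
  moreover have "?f ` Zp = {y. y - x \<in> pZp k}"
    unfolding pZp_def by (force simp: image_iff algebra_simps)
  ultimately show ?thesis by simp
qed

section \<open>Squares near 1 for odd p\<close>

lemma ord_p_2:
  assumes "odd CARD('p::prime_card)" shows "(2::'p qp) \<noteq> 0" "ord_p (2::'p qp) = 0"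
proof -
  have "\<not> int CARD('p) dvd 2"
    using assms prime_gt_1_int[OF prime_card_int[where 'a='p]] zdvd_imp_le[of "int CARD('p)" 2]
    by (cases "int CARD('p) = 2") auto
  then have "(of_int 2 :: 'p qp) \<notin> pZp 1" using of_int_mem_pZp_1_iff[of 2, where 'p='p] by simp
  then show "(2::'p qp) \<noteq> 0" "ord_p (2::'p qp) = 0"
    using Zp_of_int[of 2, where 'p='p] unit_iff_not_mem_pZp[of "2::'p qp"] mem_Zp_units_iff[of "2::'p qp"]
    by auto
qed

text \<open>Newton approximation gives square roots modulo every power of \<open>p\<close>; a limit point of them in
  the compact set \<open>Zp\<close> is a square root.\<close>

lemma one_plus_pZp_square:
  fixes a :: "'p::prime_card qp"
  assumes odd: "odd CARD('p)" and a: "a - 1 \<in> pZp 1"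
  obtains t where "t\<^sup>2 = a" "t - 1 \<in> pZp 1"
proof -
  have approx: "\<exists>t. t - 1 \<in> pZp 1 \<and> t\<^sup>2 - a \<in> pZp (int (Suc N))" for N
  proof (induction N)
    case 0
    show ?case using a pZp_diff_sym[of 1 a 1] by (intro exI[of _ 1]) (simp add: zero_in_pZp)
  next
    case (Suc N)
    then obtain t where t: "t - 1 \<in> pZp 1" "t\<^sup>2 - a \<in> pZp (int (Suc N))" by blast
    have tu: "t \<in> Zp_units" using one_plus_pZp_unit[OF t(1)] by simp
    \<comment> \<open>The Newton correction. The linear terms cancel, so the new error is exactly
      \<open>h * h\<close>, of order at least twice that of \<open>h\<close>; the denominator is a
      unit because \<open>p\<close> is odd.\<close>
    define h where "h = (t\<^sup>2 - a) / (2 * t)"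
    have tn: "2 * t \<noteq> 0" "ord_p (2 * t) = 0"
      using tu ord_p_2[OF odd] by (simp_all add: mem_Zp_units_iff ord_p_mult)
    have "t\<^sup>2 - a = (2 * t) * h" using tn by (simp add: h_def)
    then have h: "h \<in> pZp (int (Suc N))" using t(2) mult_mem_pZp_iff[OF tn(1), of h] tn(2) by simp
    have "(t - h)\<^sup>2 - a = (t\<^sup>2 - a) - (2 * t) * h + h * h" by (simp add: power2_eq_square algebra_simps)
    also have "\<dots> = h * h" using tn by (simp add: h_def)
    finally have "(t - h)\<^sup>2 - a = h * h" .
    moreover have "h * h \<in> pZp (int (Suc (Suc N)))"
      using pZp_le[OF _ pZp_mult[OF h h], of "int (Suc (Suc N))"] by simp
    moreover have "(t - h) - 1 \<in> pZp 1"
      using pZp_diff[OF t(1) pZp_le[OF _ h, of 1]] by (simp add: algebra_simps)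
    ultimately show ?case by (intro exI[of _ "t - h"]) simp
  qed
  then obtain t where t: "\<And>N. t N - 1 \<in> pZp 1" "\<And>N. (t N)\<^sup>2 - a \<in> pZp (int (Suc N))" by metis
  have tZ: "t N \<in> Zp" for N using one_plus_pZp_unit[OF t(1)[of N]] by (simp add: Zp_units_def)
  obtain l r where l: "l \<in> Zp" "strict_mono r" "(t \<circ> r) \<longlonglongrightarrow> l"
    using compact_Zp[unfolded compact_def] tZ by metis
  have near: "\<exists>M. \<forall>n\<ge>M. t (r n) - l \<in> pZp (int N)" for N
  proof -
    have "0 < real CARD('p) powi (- int N)" using p_pos[where 'p='p] by simp
    then obtain M where "\<forall>n\<ge>M. dist ((t \<circ> r) n) l < real CARD('p) powi (- int N)"
      using l(3) unfolding lim_sequentially by blast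
    then have "\<forall>n\<ge>M. t (r n) - l \<in> pZp (int N)"
      by (auto simp: dist_qp_def abs_p_le_iff[symmetric] less_imp_le)
    then show ?thesis by blast
  qed
  have "l\<^sup>2 - a \<in> pZp (int N)" for N
  proof -
    obtain M where M: "\<forall>n\<ge>M. t (r n) - l \<in> pZp (int N)" using near by blast
    define n where "n = max M N"
    have "N \<le> r n" using seq_suble[OF l(2), of n] by (simp add: n_def)
    then have 1: "(t (r n))\<^sup>2 - a \<in> pZp (int N)" using pZp_le[OF _ t(2)[of "r n"], of "int N"] by simp
    have "(t (r n) - l) * (t (r n) + l) \<in> pZp (int N)"
      using M tZ l(1) by (intro pZp_mult_Zp Zp_closed) (simp_all add: n_def)
    from pZp_diff[OF 1 this] show ?thesis by (simp add: power2_eq_square algebra_simps)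
  qed
  then have "l\<^sup>2 = a" by (rule eq_if_all_pZp)
  moreover obtain n where "t (r n) - l \<in> pZp (int 1)" using near by blast
  then have "l - 1 \<in> pZp 1" using pZp_diff_trans[OF _ t(1)] pZp_diff_sym by fastforce
  ultimately show thesis by (rule that)
qed

section \<open>The quadratic character and the Hilbert symbol\<close>

locale odd_residue_char =
  fixes prime_type :: "'p::prime_card itself"
  assumes odd_p: "odd CARD('p)"
begin

lemma p_gt_2: "2 < CARD('p)"
  using odd_p prime_ge_2_nat[OF prime_card[where 'a='p]] by (cases "CARD('p) = 2") auto

lemma two_nonzero: "(2::'p qp) \<noteq> 0" and ord_p_two: "ord_p (2::'p qp) = 0"
  using ord_p_2[OF odd_p] by auto

lemma two_unit: "(2::'p qp) \<in> Zp_units"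
  by (simp add: mem_Zp_units_iff two_nonzero ord_p_two)

section \<open>The quadratic character of the units\<close>

lemma residue_mod_p_unique:
  assumes "x \<in> (Zp :: 'p qp set)"
  shows "\<exists>!a. 0 \<le> a \<and> a < int CARD('p) \<and> x - of_int a \<in> pZp 1"
proof -
  obtain j where j: "j < CARD('p)" "x - of_nat j \<in> pZp 1" using Zp_approx[OF assms, of 1] by auto
  show ?thesis
  proof (rule ex1I[of _ "int j"])
    show "0 \<le> int j \<and> int j < int CARD('p) \<and> x - of_int (int j) \<in> pZp 1" using j by simp
    fix a assume a: "0 \<le> a \<and> a < int CARD('p) \<and> x - of_int a \<in> pZp 1"
    then have "of_int (int j) - of_int a \<in> (pZp 1 :: 'p qp set)"
      using pZp_diff[of "x - of_int a" 1 "x - of_nat j"] j by simp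
    then have "int CARD('p) dvd int j - a" using of_int_mem_pZp_1_iff[of "int j - a", where 'p='p] by simp
    then have "int j mod int CARD('p) = a mod int CARD('p)" by (simp add: mod_eq_dvd_iff)
    then show "a = int j" using a j by simp
  qed
qed

lemma residue_mod_p:
  assumes "x \<in> (Zp :: 'p qp set)"
  shows "0 \<le> residue_mod_p x" "residue_mod_p x < int CARD('p)" "x - of_int (residue_mod_p x) \<in> pZp 1"
  using theI'[OF residue_mod_p_unique[OF assms]] unfolding residue_mod_p_def by auto

lemma residue_mod_p_cong:
  assumes "x \<in> (Zp :: 'p qp set)" "x - of_int a \<in> pZp 1"
  shows "[residue_mod_p x = a] (mod int CARD('p))"
proof -
  have "of_int (residue_mod_p x - a) \<in> (pZp 1 :: 'p qp set)"
    using pZp_diff[OF assms(2) residue_mod_p(3)[OF assms(1)]] by simp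
  then show ?thesis by (simp only: of_int_mem_pZp_1_iff cong_iff_dvd_diff)
qed

lemma Legendre_cong: "[a = b] (mod p) \<Longrightarrow> Legendre a p = Legendre b p"
  unfolding Legendre_def QuadRes_def cong_def by simp

text \<open>Integer valued, unlike \<open>legendre_char\<close>, so that it can be compared directly
  with the Hilbert symbol.\<close>

definition chi :: "'p qp \<Rightarrow> int" where
  "chi u = Legendre (residue_mod_p u) (int CARD('p))"

lemma legendre_char_eq_chi: "legendre_char u = of_int (chi u)"
  by (simp add: legendre_char_def chi_def)

lemma chi_eq: "x \<in> Zp \<Longrightarrow> x - of_int a \<in> pZp 1 \<Longrightarrow> chi x = Legendre a (int CARD('p))"
  unfolding chi_def by (intro Legendre_cong residue_mod_p_cong)

lemma chi_cong:
  assumes "x \<in> Zp" "y - x \<in> pZp 1" shows "chi y = chi x"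
proof -
  have "y = (y - x) + x" by simp
  then have y: "y \<in> Zp" using assms pZp_imp_Zp[of 1 "y - x"] by (metis Zp_closed(4) zero_le_one)
  have "chi y = Legendre (residue_mod_p x) (int CARD('p))"
    by (rule chi_eq[OF y pZp_diff_trans[OF assms(2) residue_mod_p(3)[OF assms(1)]]])
  then show ?thesis by (simp add: chi_def)
qed

lemma chi_of_int: "chi (of_int a) = Legendre a (int CARD('p))"
  by (rule chi_eq) (simp_all add: Zp_of_int zero_in_pZp)

text \<open>Euler's criterion gives the identity modulo \<open>p\<close>. Both sides are -1, 0 or 1,
  so they differ by at most 2, which is less than \<open>p\<close>.\<close>

lemma Legendre_mult: "Legendre (a * b) (int CARD('p)) = Legendre a (int CARD('p)) * Legendre b (int CARD('p))"
proof -
  let ?p = "CARD('p)"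
  have pr: "prime ?p" by (rule prime_card)
  have "[Legendre (a * b) ?p = (a * b) ^ ((?p - 1) div 2)] (mod int ?p)"
    using euler_criterion[OF pr p_gt_2, of "a * b"] .
  moreover have "[Legendre a ?p * Legendre b ?p = a ^ ((?p - 1) div 2) * b ^ ((?p - 1) div 2)] (mod int ?p)"
    by (intro cong_mult euler_criterion[OF pr p_gt_2])
  ultimately have "[Legendre (a * b) ?p = Legendre a ?p * Legendre b ?p] (mod int ?p)"
    unfolding power_mult_distrib by (meson cong_sym cong_trans)
  then have dv: "int ?p dvd Legendre (a * b) ?p - Legendre a ?p * Legendre b ?p"
    by (simp add: cong_iff_dvd_diff)
  have L: "Legendre c ?p \<in> {-1, 0, 1}" for c by (simp add: Legendre_def)
  have "\<bar>Legendre (a * b) ?p - Legendre a ?p * Legendre b ?p\<bar> \<le> 2"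
    using L[of a] L[of b] L[of "a * b"] by auto
  then have "\<bar>Legendre (a * b) ?p - Legendre a ?p * Legendre b ?p\<bar> < int ?p" using p_gt_2 by linarith
  then show ?thesis using dv by (meson dvd_abs_iff eq_iff_diff_eq_0 zdvd_not_zless zero_less_abs_iff)
qed

lemma chi_mult:
  assumes "x \<in> Zp" "y \<in> Zp" shows "chi (x * y) = chi x * chi y"
proof -
  let ?a = "residue_mod_p x" and ?b = "residue_mod_p y"
  have "x * y - of_int (?a * ?b) = (x - of_int ?a) * y + (y - of_int ?b) * of_int ?a"
    by (simp add: algebra_simps)
  also have "\<dots> \<in> pZp 1"
    using assms by (intro pZp_add pZp_mult_Zp residue_mod_p Zp_of_int)
  finally have "chi (x * y) = Legendre (?a * ?b) (int CARD('p))"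
    using assms by (intro chi_eq Zp_closed)
  then show ?thesis by (simp add: Legendre_mult chi_def)
qed

lemma QuadRes_residue_iff:
  assumes "u \<in> (Zp :: 'p qp set)"
  shows "QuadRes (int CARD('p)) (residue_mod_p u) \<longleftrightarrow> (\<exists>x\<in>Zp. u - x\<^sup>2 \<in> pZp 1)"
proof
  assume "QuadRes (int CARD('p)) (residue_mod_p u)"
  then obtain y where "[y\<^sup>2 = residue_mod_p u] (mod int CARD('p))" by (auto simp: QuadRes_def)
  then have "of_int (y\<^sup>2 - residue_mod_p u) \<in> (pZp 1 :: 'p qp set)"
    unfolding of_int_mem_pZp_1_iff by (simp add: cong_iff_dvd_diff)
  then have "u - (of_int y)\<^sup>2 \<in> pZp 1"
    using pZp_diff[OF residue_mod_p(3)[OF assms]] by fastforce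
  then show "\<exists>x\<in>Zp. u - x\<^sup>2 \<in> pZp 1" using Zp_of_int by blast
next
  assume "\<exists>x\<in>Zp. u - x\<^sup>2 \<in> pZp 1"
  then obtain x where x: "x \<in> Zp" "u - x\<^sup>2 \<in> pZp 1" by blast
  let ?y = "residue_mod_p x"
  have "x\<^sup>2 - of_int (?y\<^sup>2) = (x - of_int ?y) * (x + of_int ?y)" by (simp add: power2_eq_square algebra_simps)
  also have "\<dots> \<in> pZp 1"
    using x by (intro pZp_mult_Zp residue_mod_p Zp_closed Zp_of_int)
  finally have "u - of_int (?y\<^sup>2) \<in> pZp 1" by (rule pZp_diff_trans[OF x(2)])
  then have "[residue_mod_p u = ?y\<^sup>2] (mod int CARD('p))" by (rule residue_mod_p_cong[OF assms])
  then show "QuadRes (int CARD('p)) (residue_mod_p u)" unfolding QuadRes_def using cong_sym by blast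
qed

lemma chi_unit:
  assumes "u \<in> Zp_units"
  shows "chi u = (if \<exists>x\<in>Zp. u - x\<^sup>2 \<in> pZp 1 then 1 else - 1)"
proof -
  have u: "u \<in> Zp" using assms by (simp add: Zp_units_def)
  have "\<not> [residue_mod_p u = 0] (mod int CARD('p))"
  proof
    assume "[residue_mod_p u = 0] (mod int CARD('p))"
    then have "of_int (residue_mod_p u) \<in> (pZp 1 :: 'p qp set)"
      by (simp only: of_int_mem_pZp_1_iff cong_0_iff)
    then have "u \<in> pZp 1" using pZp_add[OF residue_mod_p(3)[OF u]] by fastforce
    then show False using assms u by (simp add: unit_iff_not_mem_pZp)
  qed
  then show ?thesis using QuadRes_residue_iff[OF u] by (simp add: chi_def Legendre_def)
qed

lemma chi_unit_cases: "u \<in> Zp_units \<Longrightarrow> chi u = 1 \<or> chi u = - 1"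
  by (simp add: chi_unit)

lemma chi_1: "chi 1 = 1"
  using chi_unit[OF one_in_Zp_units] zero_in_pZp[of 1] by (auto intro: bexI[of _ 1] simp: Zp_closed)

text \<open>Hensel's lemma in two stages: a square root \<open>x\<close> modulo \<open>p\<close>
  reduces the claim to \<open>u / x\<^sup>2\<close>, which is 1 modulo \<open>p\<close> and has a
  square root by \<open>one_plus_pZp_square\<close>.\<close>

lemma unit_square:
  assumes "u \<in> Zp_units" "chi u = 1"
  obtains t where "t \<in> Zp_units" "t\<^sup>2 = u"
proof -
  obtain x where x: "x \<in> Zp" "u - x\<^sup>2 \<in> pZp 1" using assms chi_unit by (auto split: if_splits)
  have "x \<in> Zp_units"
  proof (rule ccontr)
    assume "x \<notin> Zp_units"
    then have "x \<in> pZp 1" using x(1) unit_iff_not_mem_pZp by blast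
    then have "x\<^sup>2 \<in> pZp 1" using x(1) by (simp add: power2_eq_square pZp_mult_Zp)
    then have "u \<in> pZp 1" using pZp_add[OF x(2)] by fastforce
    then show False using assms(1) unit_iff_not_mem_pZp[of u] by (simp add: Zp_units_def)
  qed
  then have x0: "x \<noteq> 0" "ord_p x = 0" by (simp_all add: mem_Zp_units_iff)
  have "x\<^sup>2 * (u / x\<^sup>2 - 1) = u - x\<^sup>2" using x0 by (simp add: field_simps)
  then have "u / x\<^sup>2 - 1 \<in> pZp 1"
    using x(2) mult_mem_pZp_iff[of "x\<^sup>2" "u / x\<^sup>2 - 1" 1] x0 by (simp add: ord_p_power)
  then obtain t where t: "t\<^sup>2 = u / x\<^sup>2" "t - 1 \<in> pZp 1" using one_plus_pZp_square[OF odd_p] by metis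
  have "t * x \<in> Zp_units" using one_plus_pZp_unit[OF t(2)] \<open>x \<in> Zp_units\<close> by (simp add: Zp_units_mult)
  moreover have "(t * x)\<^sup>2 = u" using t x0 by (simp add: power_mult_distrib)
  ultimately show thesis by (rule that)
qed

lemma chi_square: "t \<in> Zp_units \<Longrightarrow> chi (t\<^sup>2) = 1"
  using chi_unit_cases[of t] by (auto simp: power2_eq_square chi_mult Zp_units_def)

lemma pp_powi_double: "(pp powi (2 * k) :: 'p qp) = (pp powi k)\<^sup>2"
  using pp_powi_add[of k k, where 'p='p] by (simp add: power2_eq_square flip: mult_2)

section \<open>Square classes as pairs of parities\<close>

definition oddord :: "'p qp \<Rightarrow> bool" where
  "oddord x = odd (ord_p x)"

definition unit_part :: "'p qp \<Rightarrow> 'p qp" where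
  "unit_part x = x / pp powi ord_p x"

text \<open>Together with \<open>oddord\<close> this records the class of a nonzero \<open>x\<close>
  modulo squares; both are additive modulo 2.\<close>

definition nonres :: "'p qp \<Rightarrow> bool" where
  "nonres x = (chi (unit_part x) = - 1)"

lemma unit_part_unit: "x \<noteq> 0 \<Longrightarrow> unit_part x \<in> Zp_units"
  by (simp add: unit_part_def mem_Zp_units_iff ord_p_divide ord_p_pp_powi pp_nonzero)

lemma unit_part_mult: "x \<noteq> 0 \<Longrightarrow> y \<noteq> 0 \<Longrightarrow> unit_part (x * y) = unit_part x * unit_part y"
  by (simp add: unit_part_def ord_p_mult pp_powi_add)

lemma oddord_mult: "x \<noteq> 0 \<Longrightarrow> y \<noteq> 0 \<Longrightarrow> oddord (x * y) = (oddord x \<noteq> oddord y)"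
  by (auto simp: oddord_def ord_p_mult)

lemma nonres_mult: "x \<noteq> 0 \<Longrightarrow> y \<noteq> 0 \<Longrightarrow> nonres (x * y) = (nonres x \<noteq> nonres y)"
  using chi_unit_cases[OF unit_part_unit[of x]] chi_unit_cases[OF unit_part_unit[of y]]
    unit_part_unit[of x] unit_part_unit[of y]
  by (auto simp: nonres_def unit_part_mult chi_mult Zp_units_def)

lemma oddord_unit: "u \<in> Zp_units \<Longrightarrow> \<not> oddord u"
  by (simp add: oddord_def mem_Zp_units_iff)

lemma nonres_unit: "u \<in> Zp_units \<Longrightarrow> nonres u \<longleftrightarrow> chi u = - 1"
  by (simp add: nonres_def unit_part_def mem_Zp_units_iff)

lemma oddord_uminus: "x \<noteq> 0 \<Longrightarrow> oddord (- x) = oddord x"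
  by (simp add: oddord_def ord_p_uminus)

lemma nonres_uminus: "x \<noteq> 0 \<Longrightarrow> nonres (- x) = (nonres x \<noteq> nonres (- 1))"
  using nonres_mult[of "- 1" x] by auto

lemma nonres_1: "\<not> nonres 1"
  by (simp add: nonres_unit one_in_Zp_units chi_1)

lemma oddord_inverse: "x \<noteq> 0 \<Longrightarrow> oddord (inverse x) = oddord x"
  by (simp add: oddord_def ord_p_inverse)

lemma nonres_inverse: "x \<noteq> 0 \<Longrightarrow> nonres (inverse x) = nonres x"
  using nonres_mult[of "inverse x" x] by (simp add: nonres_1)

section \<open>Solvability of the equation behind the Hilbert symbol\<close>

definition isotropic :: "'p qp \<Rightarrow> 'p qp \<Rightarrow> bool" where
  "isotropic a b \<longleftrightarrow> (\<exists>x y z. (x, y, z) \<noteq> (0, 0, 0) \<and> z\<^sup>2 = a * x\<^sup>2 + b * y\<^sup>2)"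

lemma isotropicI: "z\<^sup>2 = a * x\<^sup>2 + b * y\<^sup>2 \<Longrightarrow> x \<noteq> 0 \<or> y \<noteq> 0 \<or> z \<noteq> 0 \<Longrightarrow> isotropic a b"
  unfolding isotropic_def by blast

lemma isotropic_sym: "isotropic a b \<Longrightarrow> isotropic b a"
  unfolding isotropic_def by (metis add.commute prod.inject)

lemma isotropic_mult_square: "t \<noteq> 0 \<Longrightarrow> isotropic a b \<Longrightarrow> isotropic (a * t\<^sup>2) b"
proof -
  assume t: "t \<noteq> 0" and "isotropic a b"
  then obtain x y z where xyz: "x \<noteq> 0 \<or> y \<noteq> 0 \<or> z \<noteq> 0" "z\<^sup>2 = a * x\<^sup>2 + b * y\<^sup>2"
    unfolding isotropic_def by auto
  then show ?thesis using t by (intro isotropicI[of z _ "x / t" _ y]) (auto simp: power_divide)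
qed

lemma isotropic_mult_square_iff: "t \<noteq> 0 \<Longrightarrow> isotropic (a * t\<^sup>2) b \<longleftrightarrow> isotropic a b"
  using isotropic_mult_square[of t a b] isotropic_mult_square[of "inverse t" "a * t\<^sup>2" b]
  by (auto simp: power_inverse field_simps)

lemma isotropic_square: "isotropic (t\<^sup>2) b"
  by (rule isotropicI[of t _ 1 _ 0]) simp_all

text \<open>Both conditions say that \<open>b\<close> is a norm from the extension by a square root of \<open>a\<close>; the second
  one only multiplies \<open>b\<close> by the norm \<open>- a\<close>.\<close>

lemma isotropic_neg_mult: "a \<noteq> 0 \<Longrightarrow> isotropic a (- a * b) \<longleftrightarrow> isotropic a b"
proof -
  have *: "isotropic a (- a * b)" if a: "a \<noteq> 0" and "isotropic a b" for a b
  proof -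
    obtain x y z where xyz: "x \<noteq> 0 \<or> y \<noteq> 0 \<or> z \<noteq> 0" "z\<^sup>2 = a * x\<^sup>2 + b * y\<^sup>2"
      using \<open>isotropic a b\<close> unfolding isotropic_def by auto
    have "(a * x)\<^sup>2 = a * z\<^sup>2 + (- a * b) * y\<^sup>2" unfolding xyz(2) by (simp add: power2_eq_square algebra_simps)
    then show ?thesis using a xyz(1) by (intro isotropicI[of "a * x" _ z _ y]) auto
  qed
  assume a: "a \<noteq> 0"
  have "isotropic a b" if "isotropic a (- a * b)"
  proof -
    have "isotropic a (b * a\<^sup>2)" using *[OF a that] by (simp add: power2_eq_square mult_ac)
    then show ?thesis using isotropic_mult_square_iff[OF a, of b a] isotropic_sym by blast
  qed
  then show ?thesis using *[OF a] by blast
qed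

text \<open>Some non-residue is the successor of a square, and all units that are not squares lie in its
  square class.\<close>

lemma isotropic_units:
  assumes "u \<in> Zp_units" "v \<in> Zp_units" shows "isotropic u v"
proof (cases "chi u = 1 \<or> chi v = 1")
  case True
  then show ?thesis using unit_square assms isotropic_square isotropic_sym by metis
next
  case False
  then have uv: "chi u = - 1" "chi v = - 1" using assms chi_unit_cases by blast+
  have "chi (of_int (residue_mod_p u)) = - 1" using uv(1) by (simp only: chi_of_int) (simp only: chi_def)
  then have "chi (of_nat (nat (residue_mod_p u))) = - 1"
    using residue_mod_p(1)[of u] assms(1) by (simp add: Zp_units_def)
  then have ex: "\<exists>m. chi (of_nat m) = - 1" by blast
  \<comment> \<open>The least natural number with character -1 is at most \<open>p\<close>, so its
    predecessor is not divisible by \<open>p\<close> and is a square.\<close>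
  define m where "m = (LEAST m. chi (of_nat m) = - 1)"
  have m: "chi (of_nat m) = - 1" unfolding m_def by (rule LeastI_ex[OF ex])
  have least: "chi (of_nat i) \<noteq> - 1" if "i < m" for i using not_less_Least that unfolding m_def by blast
  have L: "Legendre i (int CARD('p)) = 0 \<longleftrightarrow> int CARD('p) dvd i" for i
    by (simp add: Legendre_def cong_0_iff)
  have chi0: "chi (of_nat i) = 0 \<longleftrightarrow> int CARD('p) dvd int i" for i
    using chi_of_int[of "int i"] L[of "int i"] by simp
  have unit: "of_nat i \<in> (Zp_units :: 'p qp set)" if "chi (of_nat i) \<noteq> 0" for i
    using that chi0[of i] of_int_mem_pZp_1_iff[of "int i", where 'p='p] unit_iff_not_mem_pZp[of "of_nat i :: 'p qp"]
    by (simp add: Zp_closed)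
  have "m \<noteq> 0" using m chi0[of 0] by (cases m) simp_all
  moreover have "m \<noteq> 1" using m chi_1 by auto
  ultimately obtain k where k: "m = Suc k" "k \<noteq> 0" by (cases m) auto
  have "m \<le> CARD('p)"
  proof (rule ccontr)
    assume "\<not> m \<le> CARD('p)"
    then have "CARD('p) + (m - CARD('p)) = m" "m - CARD('p) < m" using p_gt_2 by auto
    moreover have "chi (of_nat (CARD('p) + (m - CARD('p)))) = chi (of_nat (m - CARD('p)))"
      by (rule chi_cong) (simp_all add: Zp_closed mem_pZp_iff ord_p_pp)
    ultimately have "m - CARD('p) < m" "chi (of_nat (m - CARD('p))) = - 1" using m by simp_all
    then show False using least by blast
  qed
  then have "k < CARD('p)" using k by simp
  then have "chi (of_nat k) \<noteq> 0" using chi0[of k] k zdvd_not_zless[of "int k" "int CARD('p)"] by auto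
  then have "k \<noteq> 0" "of_nat k \<in> (Zp_units :: 'p qp set)" "chi (of_nat k) = 1"
    using unit[of k] least[of k] chi_unit_cases[of "of_nat k"] k by auto
  then obtain s where s: "s \<in> Zp_units" "s\<^sup>2 = (of_nat k :: 'p qp)" using unit_square by blast
  have mu: "of_nat m \<in> (Zp_units :: 'p qp set)" using m unit[of m] by simp
  have quot: "\<exists>t\<in>Zp_units. w = of_nat m * t\<^sup>2" if "w \<in> Zp_units" "chi w = - 1" for w
  proof -
    have iu: "w * of_nat m \<in> Zp_units" using that(1) mu by (rule Zp_units_mult)
    have "chi (w * of_nat m) = 1" using that mu m by (simp add: chi_mult Zp_units_def)
    then obtain t where t: "t \<in> Zp_units" "t\<^sup>2 = w * of_nat m" using unit_square[OF iu] by blast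
    have m0: "(of_nat m :: 'p qp) \<noteq> 0" using mu by (simp add: Zp_units_def)
    have "of_nat m * (t * inverse (of_nat m))\<^sup>2 = t\<^sup>2 / of_nat m"
      using m0 by (simp add: power2_eq_square field_simps)
    then have "w = of_nat m * (t * inverse (of_nat m))\<^sup>2"
      using m0 by (simp add: t(2))
    then show ?thesis using t(1) Zp_units_inverse[OF mu] Zp_units_mult by blast
  qed
  obtain a b where ab: "a \<in> Zp_units" "u = of_nat m * a\<^sup>2" "b \<in> Zp_units" "v = of_nat m * b\<^sup>2"
    using quot[OF assms(1) uv(1)] quot[OF assms(2) uv(2)] by blast
  then have "a \<noteq> 0" "b \<noteq> 0" by (simp_all add: Zp_units_def)
  \<comment> \<open>With \<open>m = k + 1\<close> and \<open>s\<^sup>2 = k\<close> the right side is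
    \<open>m * k + m\<close>.\<close>
  then have "(of_nat m)\<^sup>2 = u * (s / a)\<^sup>2 + v * (1 / b)\<^sup>2"
    by (simp add: ab power_divide s(2) k(1)) (simp add: power2_eq_square algebra_simps)
  then show ?thesis by (rule isotropicI) (use mu in \<open>simp add: Zp_units_def\<close>)
qed

text \<open>If \<open>u\<close> is not a square modulo \<open>p\<close>, every value
  \<open>r\<^sup>2 - u\<close> is nonzero of even order, whereas \<open>b * y\<^sup>2\<close> has
  odd order for \<open>y \<noteq> 0\<close>.\<close>

lemma isotropic_unit_oddord:
  assumes u: "u \<in> Zp_units" and b: "b \<noteq> 0" "oddord b"
  shows "isotropic u b \<longleftrightarrow> chi u = 1"
proof
  assume "chi u = 1"
  then show "isotropic u b" using unit_square[OF u] isotropic_square by metis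
next
  assume "isotropic u b"
  then obtain x y z where xyz: "x \<noteq> 0 \<or> y \<noteq> 0 \<or> z \<noteq> 0" "z\<^sup>2 = u * x\<^sup>2 + b * y\<^sup>2"
    unfolding isotropic_def by auto
  show "chi u = 1"
  proof (rule ccontr)
    assume "chi u \<noteq> 1"
    then have non: "\<not> (\<exists>r\<in>Zp. u - r\<^sup>2 \<in> pZp 1)" using chi_unit[OF u] by argo
    have even: "r\<^sup>2 - u \<noteq> 0 \<and> \<not> oddord (r\<^sup>2 - u)" for r
    proof (cases "r \<in> Zp")
      case True
      then have "r\<^sup>2 - u \<notin> pZp 1" using non True pZp_diff_sym[of u "r\<^sup>2" 1] by blast
      moreover have "r\<^sup>2 - u \<in> Zp" using True u by (simp add: Zp_diff Zp_closed Zp_units_def)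
      ultimately have "r\<^sup>2 - u \<in> Zp_units" by (simp add: unit_iff_not_mem_pZp)
      then show ?thesis using oddord_unit by (auto simp: Zp_units_def)
    next
      case False
      then have r: "r \<noteq> 0" "ord_p r < 0" by (auto simp: mem_Zp_iff)
      define w where "w = 1 - u / r\<^sup>2"
      have "u \<noteq> 0" "ord_p u = 0" using u by (simp_all add: mem_Zp_units_iff)
      then have "1 - w \<in> pZp 1" using r by (simp add: w_def mem_pZp_iff ord_p_divide ord_p_power)
      then have w: "w \<in> Zp_units" using one_plus_pZp_unit[of w 1] pZp_diff_sym[of 1 w] by simp
      have "r\<^sup>2 - u = r * r * w" using r by (simp add: w_def power2_eq_square field_simps)
      then show ?thesis using r w oddord_unit[OF w] by (simp add: oddord_mult Zp_units_def)
    qed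
    show False
    proof (cases "x = 0")
      case True
      then have "y \<noteq> 0" using xyz by auto
      moreover have "z * z = b * (y * y)" using True xyz(2) by (simp add: power2_eq_square)
      moreover from calculation have "z \<noteq> 0" using b by auto
      ultimately have "oddord (z * z) = oddord (b * (y * y))" by simp
      then show False using \<open>y \<noteq> 0\<close> \<open>z \<noteq> 0\<close> b by (simp add: oddord_mult)
    next
      case False
      have "b * (y / x)\<^sup>2 = (z / x)\<^sup>2 - u"
        using False xyz(2) by (simp add: power_divide field_simps)
      moreover from this have "y \<noteq> 0" using even[of "z / x"] by auto
      then have "y / x * (y / x) \<noteq> 0" "\<not> oddord (y / x * (y / x))"
        using False oddord_mult[of "y / x" "y / x"] by simp_all
      ultimately show False using even[of "z / x"] oddord_mult[of b "y / x * (y / x)"] b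
        by (simp only: power2_eq_square) simp
    qed
  qed
qed

text \<open>The exponent of -1 in the classical formula for odd \<open>p\<close>: for
  \<open>a = p ^ i * u\<close> and \<open>b = p ^ j * v\<close> the symbol is
  \<open>chi (- 1) ^ (i * j) * chi v ^ i * chi u ^ j\<close>.\<close>

definition hpair :: "'p qp \<Rightarrow> 'p qp \<Rightarrow> bool" where
  "hpair a b = ((oddord a \<and> oddord b \<and> nonres (- 1)) \<noteq> ((oddord a \<and> nonres b) \<noteq> (nonres a \<and> oddord b)))"

lemma isotropic_even:
  assumes "a \<noteq> 0" "b \<noteq> 0" "\<not> oddord a"
  shows "isotropic a b \<longleftrightarrow> \<not> hpair a b"
proof -
  let ?u = "unit_part a"
  obtain k where k: "ord_p a = 2 * k" using assms(3) by (auto simp: oddord_def elim: evenE)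
  have "a = ?u * (pp powi k)\<^sup>2"
    by (simp add: unit_part_def k pp_powi_double pp_nonzero)
  then have au: "isotropic a b \<longleftrightarrow> isotropic ?u b"
    using isotropic_mult_square_iff[OF pp_powi_nonzero] by metis
  have u: "?u \<in> Zp_units" using assms(1) by (rule unit_part_unit)
  show ?thesis
  proof (cases "oddord b")
    case True
    then show ?thesis using au isotropic_unit_oddord[OF u assms(2)] assms chi_unit_cases[OF u]
      by (auto simp: hpair_def nonres_def)
  next
    case False
    let ?v = "unit_part b"
    obtain l where l: "ord_p b = 2 * l" using False by (auto simp: oddord_def elim: evenE)
    have "b = ?v * (pp powi l)\<^sup>2"
      by (simp add: unit_part_def l pp_powi_double pp_nonzero)
    then have "isotropic b ?u \<longleftrightarrow> isotropic ?v ?u"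
      using isotropic_mult_square_iff[OF pp_powi_nonzero] by metis
    then have "isotropic a b" using au isotropic_sym isotropic_units[OF u unit_part_unit[OF assms(2)]] by blast
    then show ?thesis using assms False by (simp add: hpair_def)
  qed
qed

text \<open>If both orders are odd, \<open>- a * b\<close> has even order and may replace
  \<open>b\<close> without affecting solvability, which leads back to the even case.\<close>

lemma isotropic_iff:
  assumes "a \<noteq> 0" "b \<noteq> 0"
  shows "isotropic a b \<longleftrightarrow> \<not> hpair a b"
proof (cases "oddord a \<and> oddord b")
  case False
  then show ?thesis using isotropic_even[of a b] isotropic_even[of b a] isotropic_sym[of a b]
      isotropic_sym[of b a] assms by (auto simp: hpair_def)
next
  case True
  have "isotropic a b \<longleftrightarrow> isotropic (- a * b) a"
    using isotropic_neg_mult[OF assms(1)] isotropic_sym by blast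
  also have "\<dots> \<longleftrightarrow> \<not> hpair (- a * b) a"
    using True assms by (intro isotropic_even) (simp_all add: oddord_mult oddord_uminus)
  also have "\<dots> \<longleftrightarrow> \<not> hpair a b"
    using True assms nonres_uminus[of "a * b"] oddord_uminus[of "a * b"]
    by (auto simp: hpair_def oddord_mult nonres_mult)
  finally show ?thesis .
qed

definition sgnb :: "bool \<Rightarrow> int" where
  "sgnb b = (if b then - 1 else 1)"

lemma sgnb_mult: "sgnb a * sgnb b = sgnb (a \<noteq> b)"
  by (simp add: sgnb_def)

lemma hilbert_eq: "a \<noteq> 0 \<Longrightarrow> b \<noteq> 0 \<Longrightarrow> hilbert_symbol a b = sgnb (hpair a b)"
  using isotropic_iff[of a b] unfolding hilbert_symbol_def isotropic_def sgnb_def by argo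

text \<open>The point \<open>x = y = z = 1\<close> solves the equation.\<close>

lemma steinberg:
  assumes "a \<noteq> 0" "b \<noteq> 0" "a + b = 1" shows "\<not> hpair a b"
  using isotropic_iff[OF assms(1,2)] isotropicI[of 1 a 1 b 1] assms(3) by simp

end

section \<open>The double cover is a group, split over the maximal compact subgroup\<close>

lemma entry_mult: "entry (g * h) i j = entry g i 1 * entry h 1 j + entry g i 2 * entry h 2 j"
  by (simp add: times_sl2.rep_eq matrix_matrix_mult_def sum_2)

lemma entry_1: "entry 1 1 1 = 1" "entry 1 1 2 = 0" "entry 1 2 1 = 0" "entry 1 2 2 = 1"
  by (simp_all add: one_sl2.rep_eq mat_def)

lemma entry_det: "entry g 1 1 * entry g 2 2 - entry g 1 2 * entry g 2 1 = 1"
  using mat_of[of g] by (simp add: det_2)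

lemma sl2_eqI:
  assumes "entry g 1 1 = entry h 1 1" "entry g 1 2 = entry h 1 2"
    "entry g 2 1 = entry h 2 1" "entry g 2 2 = entry h 2 2"
  shows "g = h"
  using assms by (simp add: mat_of_inject[symmetric] vec_eq_iff forall_2)

definition mk_sl2 :: "'p::prime_card qp \<Rightarrow> 'p qp \<Rightarrow> 'p qp \<Rightarrow> 'p qp \<Rightarrow> 'p sl2" where
  "mk_sl2 a b c d = Abs_sl2 (vector [vector [a, b], vector [c, d]])"

lemma entry_mk_sl2:
  assumes "a * d - b * c = 1"
  shows "entry (mk_sl2 a b c d) 1 1 = a" "entry (mk_sl2 a b c d) 1 2 = b"
    "entry (mk_sl2 a b c d) 2 1 = c" "entry (mk_sl2 a b c d) 2 2 = d"
  using assms by (simp_all add: mk_sl2_def Abs_sl2_inverse det_2)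

lemma entry_lower_unip:
  "entry (lower_unip s) 1 1 = 1" "entry (lower_unip s) 1 2 = 0"
  "entry (lower_unip s) 2 1 = s" "entry (lower_unip s) 2 2 = 1"
  by (simp_all add: mat_of_lower_unip)

definition sl2_inv :: "'p::prime_card sl2 \<Rightarrow> 'p sl2" where
  "sl2_inv g = mk_sl2 (entry g 2 2) (- entry g 1 2) (- entry g 2 1) (entry g 1 1)"

lemma entry_sl2_inv:
  "entry (sl2_inv g) 1 1 = entry g 2 2" "entry (sl2_inv g) 1 2 = - entry g 1 2"
  "entry (sl2_inv g) 2 1 = - entry g 2 1" "entry (sl2_inv g) 2 2 = entry g 1 1"
  unfolding sl2_inv_def by (rule entry_mk_sl2; use entry_det[of g] in \<open>simp add: algebra_simps\<close>)+

lemma sl2_inv_left: "sl2_inv g * g = 1"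
  using entry_det[of g] by (intro sl2_eqI) (simp_all add: entry_mult entry_sl2_inv entry_1 algebra_simps)

lemma kubota_tau_nonzero: "kubota_tau g \<noteq> 0"
  using entry_det[of g] by (auto simp: kubota_tau_def)

text \<open>Identities between products of Hilbert symbols are polynomial identities over the field with two
  elements in the parities of orders and the residue classes. The constant below is its addition; it
  keeps the simplifier from treating sums as negated equations, so that ordered rewriting normalises.\<close>

definition xor2 :: "bool \<Rightarrow> bool \<Rightarrow> bool" where
  "xor2 a b = (a \<noteq> b)"

lemma xor2_ring:
  "xor2 a b = xor2 b a" "xor2 (xor2 a b) c = xor2 a (xor2 b c)" "xor2 a (xor2 b c) = xor2 b (xor2 a c)"
  "xor2 a a = False" "xor2 a (xor2 a b) = b" "xor2 False a = a" "xor2 a False = a"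
  "(xor2 a b \<and> c) = xor2 (a \<and> c) (b \<and> c)" "(c \<and> xor2 a b) = xor2 (c \<and> a) (c \<and> b)"
  by (auto simp: xor2_def)

lemma xor2_eq_False: "xor2 a b = False \<Longrightarrow> a = b"
  by (simp add: xor2_def)

context odd_residue_char
begin

lemma sgnb_xor2: "sgnb a * sgnb b = sgnb (xor2 a b)"
  by (simp add: sgnb_mult xor2_def)

lemma hpair_xor2:
  "hpair a b = xor2 (oddord a \<and> oddord b \<and> nonres (- 1)) (xor2 (oddord a \<and> nonres b) (nonres a \<and> oddord b))"
  by (simp add: hpair_def xor2_def)

lemma parity_xor2:
  assumes "a \<noteq> 0"
  shows "b \<noteq> 0 \<Longrightarrow> oddord (a * b) = xor2 (oddord a) (oddord b)"
    "b \<noteq> 0 \<Longrightarrow> nonres (a * b) = xor2 (nonres a) (nonres b)"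
    "b \<noteq> 0 \<Longrightarrow> oddord (a / b) = xor2 (oddord a) (oddord b)"
    "b \<noteq> 0 \<Longrightarrow> nonres (a / b) = xor2 (nonres a) (nonres b)"
    "oddord (- a) = oddord a" "nonres (- a) = xor2 (nonres a) (nonres (- 1))"
  using assms by (auto simp: xor2_def divide_inverse oddord_mult nonres_mult oddord_uminus
      nonres_uminus[of a] oddord_inverse nonres_inverse)

lemmas symbol_ring = hpair_xor2 parity_xor2 mult_eq_0_iff divide_eq_0_iff neg_equal_0_iff_equal
  xor2_ring conj_ac simp_thms

section \<open>The cocycle identity\<close>

definition tau_pair :: "'p qp \<Rightarrow> 'p qp \<Rightarrow> 'p qp \<Rightarrow> bool" where
  "tau_pair A x y = hpair (A * x) (A * y)"

abbreviation sqclass_eq :: "'p qp \<Rightarrow> 'p qp \<Rightarrow> bool" where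
  "sqclass_eq a b \<equiv> oddord a = oddord b \<and> nonres a = nonres b"

context
  fixes x y z A B C :: "'p qp"
  assumes nz: "x \<noteq> 0" "y \<noteq> 0" "z \<noteq> 0" "A \<noteq> 0" "B \<noteq> 0" "C \<noteq> 0"
begin

text \<open>Here \<open>x\<close>, \<open>y\<close>, \<open>z\<close> stand for
  \<open>kubota_tau\<close> of \<open>g\<close>, \<open>h\<close>, \<open>k\<close>, and
  \<open>A\<close>, \<open>B\<close>, \<open>C\<close> for that of \<open>g * h\<close>,
  \<open>h * k\<close>, \<open>g * h * k\<close>. The first six lemmas correspond to the vanishing
  of one of the six lower left entries, which shows up only as relations between square classes; the
  last one is the generic case.\<close>

abbreviation tau_condition :: bool where
  "tau_condition \<equiv> xor2 (tau_pair A x y) (tau_pair C A z) = xor2 (tau_pair C x B) (tau_pair B y z)"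

lemma tau_cocycle_upper_right:
  assumes "sqclass_eq B (y * z)" "sqclass_eq C (A * z)"
  shows tau_condition
  unfolding tau_pair_def by (simp only: symbol_ring nz assms)

lemma tau_cocycle_upper_left:
  assumes "sqclass_eq A (x * y)" "sqclass_eq C (x * B)"
  shows tau_condition
  unfolding tau_pair_def by (simp only: symbol_ring nz assms)

lemma tau_cocycle_upper_middle:
  assumes "sqclass_eq A (x * y)" "sqclass_eq B (y * z)"
  shows tau_condition
  unfolding tau_pair_def by (simp only: symbol_ring nz assms)

lemma tau_cocycle_left_product:
  assumes "sqclass_eq A (- (x * y))" "sqclass_eq C (A * z)"
  shows tau_condition
  unfolding tau_pair_def by (simp only: symbol_ring nz assms)

lemma tau_cocycle_right_product:
  assumes "sqclass_eq B (- (y * z))" "sqclass_eq C (x * B)"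
  shows tau_condition
  unfolding tau_pair_def by (simp only: symbol_ring nz assms)

lemma tau_cocycle_total_product:
  assumes "sqclass_eq C (- (A * z))" "sqclass_eq B (A * (x * z))"
  shows tau_condition
  unfolding tau_pair_def by (simp only: symbol_ring nz assms)

text \<open>Division by \<open>A * B\<close> turns the hypothesis into a sum of two nonzero elements
  equal to 1, and by bilinearity the symbol of these two elements is the defect of the cocycle
  identity.\<close>

lemma tau_cocycle_generic:
  assumes "A * B = x * z + y * C"
  shows tau_condition
proof (rule xor2_eq_False)
  have "x * z + y * C \<noteq> 0" using nz(4,5) by (simp flip: assms)
  then have "hpair (x * z / (A * B)) (y * C / (A * B)) = False"
    using nz assms steinberg[of "x * z / (A * B)" "y * C / (A * B)"]
    by (simp add: add_divide_distrib[symmetric])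
  moreover have "xor2 (xor2 (tau_pair A x y) (tau_pair C A z)) (xor2 (tau_pair C x B) (tau_pair B y z)) =
    hpair (x * z / (A * B)) (y * C / (A * B))"
    unfolding tau_pair_def by (simp only: symbol_ring nz)
  ultimately show "xor2 (xor2 (tau_pair A x y) (tau_pair C A z)) (xor2 (tau_pair C x B) (tau_pair B y z)) = False"
    by simp
qed

end

lemma sqclass_eqI:
  assumes "a \<noteq> 0" "t \<noteq> 0" "b = a * t\<^sup>2" shows "sqclass_eq a b"
  using assms by (auto simp: power2_eq_square oddord_mult nonres_mult)

definition tau_cocycle :: "'p sl2 \<Rightarrow> 'p sl2 \<Rightarrow> bool" where
  "tau_cocycle g h = tau_pair (kubota_tau (g * h)) (kubota_tau g) (kubota_tau h)"

text \<open>In the generic case this is the Steinberg relation applied to the Pluecker relation between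
  the lower left entries of \<open>g\<close>, \<open>h\<close>, \<open>k\<close>, \<open>g h\<close>, \<open>h k\<close> and \<open>g h k\<close>.\<close>

lemma tau_cocycle_assoc:
  "xor2 (tau_cocycle g h) (tau_cocycle (g * h) k) = xor2 (tau_cocycle g (h * k)) (tau_cocycle h k)"
proof -
  note nz = kubota_tau_nonzero[of g] kubota_tau_nonzero[of h] kubota_tau_nonzero[of k]
    kubota_tau_nonzero[of "g * h"] kubota_tau_nonzero[of "h * k"] kubota_tau_nonzero[of "g * (h * k)"]
  have up_right: "sqclass_eq (kubota_tau (u * v)) (kubota_tau u * kubota_tau v)"
    if v: "entry v 2 1 = 0" for u v :: "'p sl2"
  proof -
    have d: "entry v 1 1 * entry v 2 2 = 1" using entry_det[of v] v by simp
    then have d0: "entry v 1 1 \<noteq> 0" "entry v 2 2 \<noteq> 0" by auto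
    show ?thesis
    proof (cases "entry u 2 1 = 0")
      case True
      then show ?thesis using v by (simp add: kubota_tau_def entry_mult)
    next
      case False
      have "kubota_tau u * kubota_tau v = kubota_tau (u * v) * (entry v 2 2)\<^sup>2"
        using v d d0 False by (simp add: kubota_tau_def entry_mult power2_eq_square algebra_simps)
      then show ?thesis using d0 by (intro sqclass_eqI[of _ "entry v 2 2"] kubota_tau_nonzero)
    qed
  qed
  have up_left: "sqclass_eq (kubota_tau (u * v)) (kubota_tau u * kubota_tau v)"
    if u: "entry u 2 1 = 0" for u v :: "'p sl2"
  proof -
    have "entry u 1 1 * entry u 2 2 = 1" using entry_det[of u] u by simp
    then have "entry u 2 2 \<noteq> 0" by auto
    then have "kubota_tau (u * v) = kubota_tau u * kubota_tau v"
      using u by (simp add: kubota_tau_def entry_mult)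
    then show ?thesis by simp
  qed
  have opp: "sqclass_eq (kubota_tau (u * v)) (- (kubota_tau u * kubota_tau v))"
    if uv: "entry u 2 1 \<noteq> 0" "entry v 2 1 \<noteq> 0" "entry (u * v) 2 1 = 0" for u v :: "'p sl2"
  proof -
    \<comment> \<open>The lower row of \<open>u\<close> is that of \<open>u * v\<close> times the
      inverse of \<open>v\<close>. If the latter row starts with 0, its second entry times
      \<open>- entry v 2 1\<close> is the lower left entry of \<open>u\<close>.\<close>
    have "entry v 2 1 * entry (u * v) 2 2 = - entry u 2 1 * (entry v 1 1 * entry v 2 2 - entry v 1 2 * entry v 2 1)
      + entry v 2 2 * entry (u * v) 2 1"
      by (simp add: entry_mult algebra_simps)
    then have "entry v 2 1 * entry (u * v) 2 2 = - entry u 2 1" using uv(3) entry_det[of v] by simp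
    then have "- (kubota_tau u * kubota_tau v) = kubota_tau (u * v) * (entry v 2 1)\<^sup>2"
      using uv by (simp add: kubota_tau_def power2_eq_square algebra_simps)
    then show ?thesis using uv(2) by (intro sqclass_eqI[of _ "entry v 2 1"] kubota_tau_nonzero)
  qed
  have pluecker: "entry (g * h) 2 1 * entry (h * k) 2 1
      = entry g 2 1 * entry k 2 1 + entry h 2 1 * entry (g * (h * k)) 2 1"
  proof -
    have "entry (g * h) 2 1 * entry (h * k) 2 1 - entry h 2 1 * entry (g * (h * k)) 2 1
       = entry g 2 1 * entry k 2 1 * (entry h 1 1 * entry h 2 2 - entry h 1 2 * entry h 2 1)"
      by (simp add: entry_mult algebra_simps)
    then show ?thesis using entry_det[of h] by (simp add: algebra_simps)
  qed
  have "xor2 (tau_pair (kubota_tau (g * h)) (kubota_tau g) (kubota_tau h))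
      (tau_pair (kubota_tau (g * (h * k))) (kubota_tau (g * h)) (kubota_tau k)) =
    xor2 (tau_pair (kubota_tau (g * (h * k))) (kubota_tau g) (kubota_tau (h * k)))
      (tau_pair (kubota_tau (h * k)) (kubota_tau h) (kubota_tau k))"
  proof (cases "entry k 2 1 = 0")
    case True
    with up_right[of k h] up_right[of k "g * h"] nz
    show ?thesis
      by (intro tau_cocycle_upper_right) (simp_all add: mult.assoc)
  next
    case k: False
    show ?thesis
    proof (cases "entry g 2 1 = 0")
      case True
      with up_left[of g h] up_left[of g "h * k"] nz
      show ?thesis by (intro tau_cocycle_upper_left) simp_all
    next
      case g: False
      show ?thesis
      proof (cases "entry h 2 1 = 0")
        case True
        with up_right[of h g] up_left[of h k] nz
        show ?thesis by (intro tau_cocycle_upper_middle) simp_all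
      next
        case h: False
        show ?thesis
        proof (cases "entry (g * h) 2 1 = 0")
          case True
          with opp[OF g h] up_left[of "g * h" k] nz
          show ?thesis by (intro tau_cocycle_left_product) (simp_all add: mult.assoc)
        next
          case gh: False
          show ?thesis
          proof (cases "entry (h * k) 2 1 = 0")
            case True
            with opp[OF h k] up_right[of "h * k" g] nz
            show ?thesis by (intro tau_cocycle_right_product) simp_all
          next
            case hk: False
            show ?thesis
            proof (cases "entry (g * (h * k)) 2 1 = 0")
              case True
              \<comment> \<open>The last term of the Pluecker relation vanishes here; what remains
                is multiplied by \<open>kubota_tau (g * h)\<close> to exhibit a square
                factor.\<close>
              have "kubota_tau (g * h) * (kubota_tau g * kubota_tau k) = kubota_tau (h * k) * (kubota_tau (g * h))\<^sup>2"
                using g h k gh hk True pluecker by (simp add: kubota_tau_def power2_eq_square mult_ac)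
              then have "sqclass_eq (kubota_tau (h * k)) (kubota_tau (g * h) * (kubota_tau g * kubota_tau k))"
                by (intro sqclass_eqI[of _ "kubota_tau (g * h)"] kubota_tau_nonzero)
              with True opp[OF gh k] nz
              show ?thesis by (intro tau_cocycle_total_product) (simp_all add: mult.assoc)
            next
              case False
              then show ?thesis using g h k gh hk pluecker nz
                by (intro tau_cocycle_generic) (simp_all add: kubota_tau_def)
            qed
          qed
        qed
      qed
    qed
  qed
  then show ?thesis by (simp only: tau_cocycle_def mult.assoc)
qed

definition s_sign :: "'p sl2 \<Rightarrow> bool" where
  "s_sign g = (entry g 2 1 * entry g 2 2 \<noteq> 0 \<and> oddord (entry g 2 1) \<and> hpair (entry g 2 1) (entry g 2 2))"

lemma kubota_s_eq: "kubota_s g = sgnb (s_sign g)"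
  unfolding kubota_s_def s_sign_def oddord_def by (auto simp: hilbert_eq sgnb_def)

lemma cocycle_eq:
  "cocycle g h = sgnb (xor2 (tau_cocycle g h) (xor2 (s_sign g) (xor2 (s_sign h) (s_sign (g * h)))))"
  unfolding cocycle_def kubota_s_eq tau_cocycle_def tau_pair_def
  by (simp add: hilbert_eq kubota_tau_nonzero sgnb_xor2 xor2_ring)

text \<open>The factors from \<open>s_sign\<close> form a coboundary and cancel, so the identity is
  inherited from the symbol part \<open>tau_cocycle\<close>.\<close>

lemma cocycle_assoc:
  fixes g h k :: "'p sl2"
  shows "cocycle g h * cocycle (g * h) k = cocycle g (h * k) * cocycle h k"
proof -
  have "xor2 (xor2 (tau_cocycle g h) (xor2 (s_sign g) (xor2 (s_sign h) (s_sign (g * h)))))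
      (xor2 (tau_cocycle (g * h) k) (xor2 (s_sign (g * h)) (xor2 (s_sign k) (s_sign (g * (h * k))))))
    = xor2 (xor2 (tau_cocycle g h) (tau_cocycle (g * h) k))
       (xor2 (s_sign g) (xor2 (s_sign h) (xor2 (s_sign k) (s_sign (g * (h * k))))))"
    by (simp only: xor2_ring)
  also have "\<dots> = xor2 (xor2 (tau_cocycle g (h * k)) (xor2 (s_sign g) (xor2 (s_sign (h * k)) (s_sign (g * (h * k))))))
      (xor2 (tau_cocycle h k) (xor2 (s_sign h) (xor2 (s_sign k) (s_sign (h * k)))))"
    unfolding tau_cocycle_assoc by (simp only: xor2_ring)
  finally show ?thesis
    by (simp only: cocycle_eq sgnb_xor2 mult.assoc)
qed

section \<open>Splitting over SL2(Zp)\<close>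

lemma nonres_cong:
  assumes "u \<in> Zp_units" "v - u \<in> pZp 1" shows "nonres v = nonres u" "v \<in> Zp_units"
proof -
  show v: "v \<in> Zp_units" using unit_add_pZp[OF assms] by simp
  show "nonres v = nonres u"
    using chi_cong[of u v] assms v by (simp add: nonres_unit Zp_units_def)
qed

definition integral_sl2 :: "'p sl2 \<Rightarrow> bool" where
  "integral_sl2 g \<longleftrightarrow> (\<forall>i j. entry g i j \<in> Zp)"

lemma integral_sl2_iff:
  "integral_sl2 g \<longleftrightarrow> entry g 1 1 \<in> Zp \<and> entry g 1 2 \<in> Zp \<and> entry g 2 1 \<in> Zp \<and> entry g 2 2 \<in> Zp"
  by (auto simp: integral_sl2_def forall_2)

lemma integral_sl2_entry: "integral_sl2 g \<Longrightarrow> entry g i j \<in> Zp"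
  by (simp add: integral_sl2_def)

lemma integral_sl2_mult: "integral_sl2 g \<Longrightarrow> integral_sl2 h \<Longrightarrow> integral_sl2 (g * h)"
  by (simp add: integral_sl2_def entry_mult Zp_closed)

lemma integral_sl2_inv: "integral_sl2 g \<Longrightarrow> integral_sl2 (sl2_inv g)"
  by (simp add: integral_sl2_iff entry_sl2_inv Zp_closed)

lemma lower_right_unit:
  assumes "integral_sl2 g" "entry g 2 1 \<in> pZp 1"
  shows "entry g 2 2 \<in> Zp_units" "entry g 1 1 \<in> Zp_units"
proof -
  note Z = integral_sl2_entry[OF assms(1)]
  have "entry g 1 1 * entry g 2 2 - 1 = entry g 2 1 * entry g 1 2"
    using entry_det[of g] by (simp add: algebra_simps)
  then have "entry g 1 1 * entry g 2 2 - 1 \<in> pZp 1" using assms(2) Z by (simp add: pZp_mult_Zp)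
  then have ad: "entry g 1 1 * entry g 2 2 \<in> Zp_units" by (rule one_plus_pZp_unit) simp
  show "entry g 2 2 \<in> Zp_units"
  proof (rule ccontr)
    assume "entry g 2 2 \<notin> Zp_units"
    then have "entry g 2 2 * entry g 1 1 \<in> pZp 1" using unit_iff_not_mem_pZp[OF Z] pZp_mult_Zp Z by blast
    then show False using ad unit_iff_not_mem_pZp[of "entry g 1 1 * entry g 2 2"]
      by (simp add: Zp_units_def mult.commute)
  qed
  show "entry g 1 1 \<in> Zp_units"
  proof (rule ccontr)
    assume "entry g 1 1 \<notin> Zp_units"
    then have "entry g 1 1 * entry g 2 2 \<in> pZp 1" using unit_iff_not_mem_pZp[OF Z] pZp_mult_Zp Z by blast
    then show False using ad unit_iff_not_mem_pZp[of "entry g 1 1 * entry g 2 2"]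
      by (simp add: Zp_units_def)
  qed
qed

lemma s_sign_integral:
  assumes "integral_sl2 g"
  shows "s_sign g = (entry g 2 1 \<in> pZp 1 \<and> entry g 2 1 \<noteq> 0 \<and> oddord (entry g 2 1) \<and> nonres (entry g 2 2))"
proof (cases "entry g 2 1 \<in> pZp 1")
  case True
  have "entry g 2 2 \<in> Zp_units" using lower_right_unit[OF assms True] by simp
  then have "entry g 2 2 \<noteq> 0" "\<not> oddord (entry g 2 2)" by (simp_all add: Zp_units_def oddord_unit)
  then show ?thesis using True by (auto simp: s_sign_def hpair_def)
next
  case False
  then have "\<not> oddord (entry g 2 1)"
    using unit_iff_not_mem_pZp integral_sl2_entry[OF assms] oddord_unit by blast
  then show ?thesis using False by (simp add: s_sign_def)
qed

text \<open>Symbols of two units are trivial, so only lower left entries divisible by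
  \<open>p\<close> contribute. Congruences modulo such an entry relate the residue classes of the
  others, and the one case not settled by them is a Steinberg relation. This property is the purpose
  of \<open>kubota_s\<close>: it is a primitive of the symbol part on integral matrices.\<close>

lemma tau_cocycle_integral:
  assumes K: "integral_sl2 g" "integral_sl2 h"
  shows "tau_cocycle g h = xor2 (s_sign g) (xor2 (s_sign h) (s_sign (g * h)))"
proof -
  define c d where "c = entry g 2 1" and "d = entry g 2 2"
  define a' b' c' d' where "a' = entry h 1 1" and "b' = entry h 1 2" and "c' = entry h 2 1" and "d' = entry h 2 2"
  define c'' d'' where "c'' = entry (g * h) 2 1" and "d'' = entry (g * h) 2 2"
  have K': "integral_sl2 (g * h)" using K by (rule integral_sl2_mult)
  have c'': "c'' = c * a' + d * c'" and d'': "d'' = c * b' + d * d'"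
    by (simp_all add: c''_def d''_def c_def d_def a'_def b'_def c'_def d'_def entry_mult)
  have det': "a' * d' = 1 + b' * c'" using entry_det[of h]
    by (simp add: a'_def b'_def c'_def d'_def algebra_simps)
  have Z: "c \<in> Zp" "d \<in> Zp" "a' \<in> Zp" "b' \<in> Zp" "c' \<in> Zp" "d' \<in> Zp" "c'' \<in> Zp" "d'' \<in> Zp"
    using K K' by (simp_all add: c_def d_def a'_def b'_def c'_def d'_def c''_def d''_def integral_sl2_entry)
  note s = s_sign_integral[OF K(1), folded c_def d_def] s_sign_integral[OF K(2), folded c'_def d'_def]
    s_sign_integral[OF K', folded c''_def d''_def]
  note tau = kubota_tau_def[of g, folded c_def d_def] kubota_tau_def[of h, folded c'_def d'_def]
    kubota_tau_def[of "g * h", folded c''_def d''_def]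
  have unit: "x \<noteq> 0 \<and> oddord x = False" if "x \<in> Zp_units" for x
    using that oddord_unit by (simp add: Zp_units_def)
  have nonres_rel: "nonres y = nonres x" if "x \<in> Zp_units" "y - x = z * w" "z \<in> pZp 1" "w \<in> Zp" for x y z w
    using nonres_cong(1)[OF that(1), of y] pZp_mult_Zp[OF that(3,4)] that(2) by simp
  note ring = symbol_ring s tau tau_cocycle_def tau_pair_def if_True if_False HOL.if_cancel
  show ?thesis
  proof (cases "c \<in> pZp 1"; cases "c' \<in> pZp 1")
    assume cp: "c \<notin> pZp 1" "c' \<notin> pZp 1"
    then have u: "c \<in> Zp_units" "c' \<in> Zp_units" using Z unit_iff_not_mem_pZp by blast+
    show ?thesis
    proof (cases "c'' \<in> pZp 1")
      case False
      then have "c'' \<in> Zp_units" using Z unit_iff_not_mem_pZp by blast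
      then show ?thesis using cp False u[THEN unit] unit[of c''] by (simp only: ring)
    next
      case True
      then have d''u: "d'' \<in> Zp_units" using lower_right_unit[OF K'] by (simp add: c''_def d''_def)
      \<comment> \<open>Modulo the nonunit \<open>c''\<close> the unit
        \<open>- (c * c') * d''\<close> is the square \<open>c * c\<close>, which fixes the residue
        class of \<open>d''\<close>.\<close>
      have "- (c * c') * d'' - c * c * (a' * d' - b' * c') = c'' * (- (c * d'))"
        unfolding c'' d'' by (simp add: algebra_simps)
      then have "- (c * c') * d'' - c * c = c'' * (- (c * d'))" by (simp add: det')
      then have "nonres (- (c * c') * d'') = nonres (c * c)"
        using True Z by (intro nonres_rel[of _ _ c'' "- (c * d')"] Zp_units_mult u Zp_closed)
      then have n: "xor2 (nonres (- 1)) (xor2 (nonres c) (xor2 (nonres c') (nonres d''))) = False"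
        using u[THEN unit] d''u[THEN unit] by (simp only: symbol_ring)
      show ?thesis
      proof (cases "c'' = 0")
        case True
        then show ?thesis using cp u[THEN unit] d''u[THEN unit] zero_in_pZp[of 1] by (simp only: ring)
      next
        case False
        have nd: "nonres d'' = xor2 (nonres (- 1)) (xor2 (nonres c) (nonres c'))"
          using n by (auto simp: xor2_def)
        show ?thesis using cp True False u[THEN unit] d''u[THEN unit] by (simp only: ring nd)
      qed
    qed
  next
    assume cp: "c \<notin> pZp 1" "c' \<in> pZp 1"
    then have u: "c \<in> Zp_units" "d' \<in> Zp_units" "a' \<in> Zp_units"
      using Z unit_iff_not_mem_pZp lower_right_unit[OF K(2)] by (auto simp: a'_def c'_def d'_def)
    have "d' * c'' - c = c' * (c * b' + d * d') + c * (a' * d' - b' * c' - 1)"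
      unfolding c'' by (simp add: algebra_simps)
    \<comment> \<open>The right side is divisible by \<open>p\<close> because \<open>c'\<close> is,
      so \<open>d' * c''\<close> and \<open>c\<close> have the same residue class.\<close>
    then have e: "d' * c'' - c = c' * (c * b' + d * d')" by (simp add: det')
    have "d' * c'' \<in> Zp_units"
      using nonres_cong(2)[OF u(1), of "d' * c''"] e cp(2) Z by (simp add: pZp_mult_Zp Zp_closed)
    then have c''u: "c'' \<in> Zp_units" using u(2) unit[OF u(2)] by (auto simp: mem_Zp_units_iff ord_p_mult)
    then have c''p: "c'' \<notin> pZp 1" using Z unit_iff_not_mem_pZp by blast
    have "nonres (d' * c'') = nonres c" by (rule nonres_rel[OF u(1) e cp(2)]) (intro Zp_closed Z)
    then have n: "nonres c = xor2 (nonres d') (nonres c'')"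
      using u[THEN unit] c''u[THEN unit] by (simp only: symbol_ring)
    show ?thesis
    proof (cases "c' = 0")
      case True
      then show ?thesis using cp c''p u[THEN unit] c''u[THEN unit] zero_in_pZp[of 1] by (simp only: ring)
    next
      case False
      then show ?thesis using cp c''p u[THEN unit] c''u[THEN unit] by (simp only: ring n)
    qed
  next
    assume cp: "c \<in> pZp 1" "c' \<notin> pZp 1"
    then have u: "d \<in> Zp_units" "c' \<in> Zp_units"
      using Z unit_iff_not_mem_pZp lower_right_unit[OF K(1)] by (auto simp: c_def d_def)
    have e: "c'' - d * c' = c * a'" unfolding c'' by (simp add: algebra_simps)
    have dc: "d * c' \<in> Zp_units" using u by (rule Zp_units_mult)
    have c''u: "c'' \<in> Zp_units" by (rule nonres_cong(2)[OF dc]) (simp add: e cp Z pZp_mult_Zp)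
    then have c''p: "c'' \<notin> pZp 1" using Z unit_iff_not_mem_pZp by blast
    have "nonres c'' = nonres (d * c')" by (rule nonres_rel[OF dc e cp(1) Z(3)])
    then have n: "nonres c'' = xor2 (nonres d) (nonres c')"
      using u[THEN unit] by (simp only: symbol_ring)
    show ?thesis
    proof (cases "c = 0")
      case True
      then show ?thesis using cp c''p u[THEN unit] c''u[THEN unit] zero_in_pZp[of 1] by (simp only: ring)
    next
      case False
      then show ?thesis using cp c''p u[THEN unit] c''u[THEN unit] by (simp only: ring n)
    qed
  next
    assume cp: "c \<in> pZp 1" "c' \<in> pZp 1"
    have c''p: "c'' \<in> pZp 1" unfolding c'' using cp Z by (intro pZp_add) (simp_all add: pZp_mult_Zp mult.commute[of d])
    have u: "d \<in> Zp_units" "d' \<in> Zp_units" "d'' \<in> Zp_units"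
      using lower_right_unit[OF K(1)] lower_right_unit[OF K(2)] lower_right_unit[OF K'] cp c''p
      by (simp_all add: c_def d_def c'_def d'_def c''_def d''_def)
    have "nonres d'' = nonres (d * d')"
      by (rule nonres_rel[OF Zp_units_mult[OF u(1,2)] _ cp(1) Z(4)]) (simp add: d'')
    then have n: "nonres d'' = xor2 (nonres d) (nonres d')" using u[THEN unit] by (simp only: symbol_ring)
    \<comment> \<open>After use of the determinant this is the three term relation to which the
      Steinberg identity is applied; if one of \<open>c\<close>, \<open>c'\<close>,
      \<open>c''\<close> is zero it degenerates to an equality of square classes.\<close>
    have "d' * c'' = c + c' * d'' + c * (a' * d' - b' * c' - 1)"
      unfolding c'' d'' by (simp add: algebra_simps)
    then have rel: "d' * c'' = c + c' * d''" by (simp add: det')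
    note facts = cp c''p u[THEN unit] n zero_in_pZp[of 1]
    show ?thesis
    proof (cases "c = 0"; cases "c' = 0")
      assume z: "c = 0" "c' = 0"
      then have "c'' = 0" using rel unit[OF u(2)] by simp
      then show ?thesis using z facts by (simp only: ring)
    next
      assume z: "c = 0" "c' \<noteq> 0"
      then have r: "c' * d'' = d' * c''" using rel by simp
      have z'': "c'' \<noteq> 0" using r z unit[OF u(3)] by auto
      have "oddord c'' = oddord c'" "nonres c' = xor2 (nonres c'') (nonres d)"
        using arg_cong[OF r, of oddord] arg_cong[OF r, of nonres] z z'' u[THEN unit]
        by (simp_all add: parity_xor2 n) (auto simp: xor2_def)
      then show ?thesis using z z'' facts by (simp only: ring)
    next
      assume z: "c \<noteq> 0" "c' = 0"
      then have r: "c = d' * c''" using rel by simp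
      have z'': "c'' \<noteq> 0" using r z by auto
      have "oddord c = oddord c''" "nonres c = xor2 (nonres c'') (nonres d')"
        using arg_cong[OF r, of oddord] arg_cong[OF r, of nonres] z z'' u[THEN unit]
        by (simp_all add: parity_xor2) (auto simp: xor2_def)
      then show ?thesis using z z'' facts by (simp only: ring)
    next
      assume z: "c \<noteq> 0" "c' \<noteq> 0"
      show ?thesis
      proof (cases "c'' = 0")
        case True
        then have r: "c = - (c' * d'')" using rel by (simp add: eq_neg_iff_add_eq_0)
        have "oddord c = oddord c'" "nonres c = xor2 (nonres c') (xor2 (nonres d) (xor2 (nonres d') (nonres (- 1))))"
          unfolding r using z u[THEN unit] by (simp_all only: symbol_ring n)
        then show ?thesis using True z facts by (simp only: ring)
      next
        case False
        have nz: "d' * c'' \<noteq> 0" using False unit[OF u(2)] by simp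
        have "c / (d' * c'') + c' * d'' / (d' * c'') = 1"
          by (simp only: add_divide_distrib[symmetric] rel[symmetric] divide_self[OF nz])
        moreover have "c / (d' * c'') \<noteq> 0" "c' * d'' / (d' * c'') \<noteq> 0"
          using nz z unit[OF u(3)] by simp_all
        ultimately have "hpair (c / (d' * c'')) (c' * d'' / (d' * c'')) = False"
          using steinberg by blast
        moreover have "xor2 (tau_cocycle g h) (xor2 (s_sign g) (xor2 (s_sign h) (s_sign (g * h))))
          = hpair (c / (d' * c'')) (c' * d'' / (d' * c''))"
          using False z facts by (simp only: ring)
        ultimately show ?thesis by - (rule xor2_eq_False, simp only:)
      qed
    qed
  qed
qed

lemma cocycle_integral: "integral_sl2 g \<Longrightarrow> integral_sl2 h \<Longrightarrow> cocycle g h = 1"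
  by (simp add: cocycle_eq tau_cocycle_integral xor2_ring) (simp add: sgnb_def)

lemma cocycle_one:
  fixes g :: "'p sl2"
  shows "cocycle 1 g = 1" "cocycle g 1 = 1"
proof -
  have "kubota_tau (1 :: 'p sl2) = 1" by (simp add: kubota_tau_def entry_1)
  then have t: "tau_cocycle 1 g = False" "tau_cocycle g 1 = False"
    unfolding tau_cocycle_def tau_pair_def
    by (simp_all only: mult_1_left mult_1_right symbol_ring kubota_tau_nonzero)
  have s: "s_sign (1 :: 'p sl2) = False" by (simp add: s_sign_def entry_1)
  have "cocycle 1 g = sgnb False" "cocycle g 1 = sgnb False"
    unfolding cocycle_eq by (simp_all only: t s mult_1_left mult_1_right xor2_ring)
  then show "cocycle 1 g = 1" "cocycle g 1 = 1" by (simp_all add: sgnb_def)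
qed

section \<open>The cover as a group\<close>

lemma mp_eqI: "mp_proj x = mp_proj y \<Longrightarrow> mp_sign x = mp_sign y \<Longrightarrow> x = (y :: 'p mp)"
  by (metis mp_proj_def mp_sign_def pair_of_inject prod.collapse)

lemma mp_sign_cases: "mp_sign (x :: 'p mp) = 1 \<or> mp_sign x = - 1"
  using pair_of[of x] by (auto simp: mp_sign_def)

lemma mp_mk:
  assumes "e = 1 \<or> e = - 1"
  shows "mp_proj (Mp (g, e) :: 'p mp) = g" "mp_sign (Mp (g, e) :: 'p mp) = e"
  using assms by (auto simp: mp_proj_def mp_sign_def Mp_inverse)

definition mp_inv :: "'p mp \<Rightarrow> 'p mp" where
  "mp_inv x = Mp (sl2_inv (mp_proj x), mp_sign x * cocycle (sl2_inv (mp_proj x)) (mp_proj x))"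

lemma mp_inv_simps:
  "mp_proj (mp_inv x) = sl2_inv (mp_proj x)"
  "mp_sign (mp_inv x) = mp_sign x * cocycle (sl2_inv (mp_proj x)) (mp_proj x)"
proof -
  have "mp_sign x * cocycle (sl2_inv (mp_proj x)) (mp_proj x) = 1 \<or>
      mp_sign x * cocycle (sl2_inv (mp_proj x)) (mp_proj x) = - 1"
    using mp_sign_cases[of x] cocycle_sign[of "sl2_inv (mp_proj x)" "mp_proj x"] by auto
  then show "mp_proj (mp_inv x) = sl2_inv (mp_proj x)"
    "mp_sign (mp_inv x) = mp_sign x * cocycle (sl2_inv (mp_proj x)) (mp_proj x)"
    unfolding mp_inv_def by (rule mp_mk)+
qed

text \<open>Associativity is the cocycle identity, and the sign built into \<open>mp_inv\<close>
  squares away the cocycle value in the product with the inverse.\<close>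

sublocale mp: Groups.group "(*) :: 'p mp \<Rightarrow> 'p mp \<Rightarrow> 'p mp" "mp_lift 1" mp_inv
proof
  fix x y z :: "'p mp"
  show "x * y * z = x * (y * z)"
    using cocycle_assoc[of "mp_proj x" "mp_proj y" "mp_proj z"]
    by (intro mp_eqI) (simp_all add: mp_proj_times mp_sign_times mult_ac)
  show "mp_lift 1 * x = x"
    by (intro mp_eqI) (simp_all add: mp_proj_times mp_sign_times mp_lift_simps cocycle_one)
  show "mp_inv x * x = mp_lift 1"
    using mp_sign_cases[of x] cocycle_sign[of "sl2_inv (mp_proj x)" "mp_proj x"]
    by (intro mp_eqI) (auto simp: mp_proj_times mp_sign_times mp_lift_simps mp_inv_simps sl2_inv_left)
qed

lemma mp_sign_times_integral:
  "integral_sl2 (mp_proj x) \<Longrightarrow> integral_sl2 (mp_proj y) \<Longrightarrow> mp_sign (x * y) = mp_sign x * mp_sign y"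
  by (simp add: mp_sign_times cocycle_integral)

lemma mp_lift_mult: "integral_sl2 g \<Longrightarrow> integral_sl2 h \<Longrightarrow> mp_lift g * mp_lift h = mp_lift (g * h)"
  by (intro mp_eqI) (simp_all add: mp_proj_times mp_sign_times mp_lift_simps cocycle_integral)

end

section \<open>Haar integrals of Schwartz functions\<close>

lemma sum_lessThan_periodic_shift:
  fixes F :: "nat \<Rightarrow> 'a::ab_group_add"
  assumes "\<And>j. F (j + P) = F j"
  shows "(\<Sum>j<P. F (j + i)) = (\<Sum>j<P. F j)"
proof (induction i)
  case (Suc i)
  have "(\<Sum>j<P. F (Suc j + i)) + F i = (\<Sum>j<Suc P. F (j + i))"
    by (subst sum.lessThan_Suc_shift) (simp add: add.commute)
  also have "\<dots> = (\<Sum>j<P. F (j + i)) + F i"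
    using assms[of i] by (simp add: add.commute)
  finally show ?case using Suc by simp
qed simp

lemma sum_lessThan_periodic_mult:
  fixes F :: "nat \<Rightarrow> 'a::comm_semiring_1"
  assumes "\<And>j. F (j + P) = F j"
  shows "(\<Sum>j<m * P. F j) = of_nat m * (\<Sum>j<P. F j)"
proof (induction m)
  case (Suc m)
  have per: "F (j + m * P) = F j" for j
  proof (induction m)
    case (Suc m)
    then show ?case using assms[of "j + m * P"] by (simp add: add_ac)
  qed simp
  have "(\<Sum>j<Suc m * P. F j) = (\<Sum>j<m * P. F j) + (\<Sum>j=m * P..<m * P + P. F j)"
    using sum.atLeastLessThan_concat[of 0 "m * P" "m * P + P" F]
    by (simp add: add.commute flip: atLeast0LessThan)
  also have "(\<Sum>j=m * P..<m * P + P. F j) = (\<Sum>j<P. F (j + m * P))"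
    using sum.shift_bounds_nat_ivl[of F 0 "m * P" P] by (simp add: add.commute flip: atLeast0LessThan)
  finally show ?case using Suc per by (simp add: algebra_simps)
qed simp

section \<open>Integrals as exact finite sums\<close>

definition adm :: "int \<Rightarrow> int \<Rightarrow> ('p::prime_card qp \<Rightarrow> complex) \<Rightarrow> bool" where
  "adm L M \<phi> \<longleftrightarrow> (\<forall>x. x \<notin> pZp (- L) \<longrightarrow> \<phi> x = 0) \<and> (\<forall>x. \<forall>z\<in>pZp M. \<phi> (x + z) = \<phi> x)"

definition grid :: "int \<Rightarrow> nat \<Rightarrow> 'p::prime_card qp" where
  "grid L j = of_nat j * pp powi (- L)"

text \<open>One summand for each coset of \<open>pZp M\<close> in \<open>pZp (- L)\<close>, weighted
  by the volume \<open>p ^ (- M)\<close> of the coset. The bounds are kept as parameters because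
  later arguments enlarge them independently.\<close>

definition grid_sum :: "int \<Rightarrow> int \<Rightarrow> ('p::prime_card qp \<Rightarrow> complex) \<Rightarrow> complex" where
  "grid_sum L M \<phi> = (\<Sum>j<CARD('p) ^ nat (L + M). \<phi> (grid L j)) / of_nat CARD('p) powi M"

lemma admD:
  assumes "adm L M \<phi>"
  shows "x \<notin> pZp (- L) \<Longrightarrow> \<phi> x = 0" "z \<in> pZp M \<Longrightarrow> \<phi> (x + z) = \<phi> x"
  using assms by (auto simp: adm_def)

lemma adm_mono: "adm L M \<phi> \<Longrightarrow> L \<le> L' \<Longrightarrow> M \<le> M' \<Longrightarrow> adm L' M' \<phi>"
  unfolding adm_def using pZp_le[of "- L'" "- L"] pZp_le[of M M'] by force

lemma grid_mem: "(grid L j :: 'p::prime_card qp) \<in> pZp (- L)"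
  using pZp_mult_Zp[of "pp powi (- L)" "- L" "of_nat j :: 'p qp"]
  by (simp only: grid_def mem_pZp_iff ord_p_pp_powi Zp_closed mult.commute[of "of_nat j"]) simp

lemma of_nat_diff_mem_pZp_iff:
  "(of_nat i - of_nat j :: 'p::prime_card qp) \<in> pZp (int N) \<longleftrightarrow> i mod CARD('p) ^ N = j mod CARD('p) ^ N"
proof -
  have "int i mod int CARD('p) ^ N = int j mod int CARD('p) ^ N \<longleftrightarrow> i mod CARD('p) ^ N = j mod CARD('p) ^ N"
    by (metis of_nat_eq_iff of_nat_mod of_nat_power)
  then show ?thesis
    using qp_of_zp_diff_mem_pZp_iff[of "of_nat i :: 'p zp" "of_nat j" N]
    by (simp add: qp_of_zp_of_nat residues_of_of_nat)
qed

lemma grid_approx: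
  fixes x :: "'p::prime_card qp"
  assumes "x \<in> pZp (- L)" "0 \<le> L + M"
  obtains j where "j < CARD('p) ^ nat (L + M)" "x - grid L j \<in> pZp M"
proof -
  have "pp powi L * x \<in> Zp"
    using assms(1) mult_pp_powi_mem_pZp_iff[of L x 0] by (simp add: pZp_0)
  then obtain j where j: "j < CARD('p) ^ nat (L + M)" "pp powi L * x - of_nat j \<in> pZp (int (nat (L + M)))"
    by (rule Zp_approx)
  have "pp powi L * (x - grid L j) = pp powi L * x - of_nat j"
    by (simp add: grid_def algebra_simps power_int_minus pp_nonzero)
  then have "x - grid L j \<in> pZp M"
    using j(2) assms(2) mult_pp_powi_mem_pZp_iff[of L "x - grid L j" "L + M"] by simp
  with j(1) show thesis by (rule that)
qed

lemma grid_unique: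
  assumes "(grid L i - grid L j :: 'p::prime_card qp) \<in> pZp M" "0 \<le> L + M"
    "i < CARD('p) ^ nat (L + M)" "j < CARD('p) ^ nat (L + M)"
  shows "i = j"
proof -
  have "grid L i - grid L j = pp powi (- L) * (of_nat i - of_nat j :: 'p qp)"
    by (simp add: grid_def algebra_simps)
  then have "(of_nat i - of_nat j :: 'p qp) \<in> pZp (int (nat (L + M)))"
    using assms(1,2) by (simp only: mult_pp_powi_mem_pZp_iff) (simp add: add.commute)
  then show ?thesis using assms(3,4) by (simp only: of_nat_diff_mem_pZp_iff mod_less)
qed

lemma grid_period:
  assumes "0 \<le> L + M"
  shows "grid L (j + CARD('p) ^ nat (L + M)) = grid L j + (pp powi M :: 'p::prime_card qp)"
proof -
  have "(pp :: 'p qp) ^ nat (L + M) = pp powi (L + M)"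
    using assms by (simp add: power_int_def)
  then show ?thesis
    by (simp add: grid_def algebra_simps pp_powi_add power_int_minus pp_nonzero)
qed

lemma adm_grid_periodic:
  fixes \<phi> :: "'p::prime_card qp \<Rightarrow> complex"
  assumes "adm L M \<phi>" "0 \<le> L + M"
  shows "\<phi> (grid L (j + CARD('p) ^ nat (L + M))) = \<phi> (grid L j)"
  using admD(2)[OF assms(1), of "pp powi M"] assms(2)
  by (simp add: grid_period mem_pZp_iff ord_p_pp_powi)

text \<open>A point of the larger grid lies in \<open>pZp (- L)\<close> exactly if its index is
  divisible by \<open>p\<close>. These points are the old grid, and the others lie outside the
  support.\<close>

lemma grid_sum_Suc_left:
  fixes \<phi> :: "'p::prime_card qp \<Rightarrow> complex"
  assumes "adm L M \<phi>" "0 \<le> L + M"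
  shows "grid_sum (L + 1) M \<phi> = grid_sum L M \<phi>"
proof -
  let ?p = "CARD('p)" and ?P = "CARD('p) ^ nat (L + M)"
  have P: "?p ^ nat (L + 1 + M) = ?p * ?P"
  proof -
    have "nat (L + 1 + M) = Suc (nat (L + M))" using assms(2) by linarith
    then show ?thesis by (simp only: power_Suc)
  qed
  have p0: "0 < ?p" using prime_gt_0_nat[OF prime_card[where 'a='p]] .
  have shift: "grid (L + 1) (?p * i) = (grid L i :: 'p qp)" for i
    by (simp add: grid_def power_int_diff pp_nonzero power_int_minus pp_powi_add)
  have "(\<Sum>j<?p * ?P. \<phi> (grid (L + 1) j)) = (\<Sum>j\<in>(\<lambda>i. ?p * i) ` {..<?P}. \<phi> (grid (L + 1) j))"
  proof (rule sum.mono_neutral_right)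
    show "\<forall>j\<in>{..<?p * ?P} - (\<lambda>i. ?p * i) ` {..<?P}. \<phi> (grid (L + 1) j) = 0"
    proof
      fix j assume j: "j \<in> {..<?p * ?P} - (\<lambda>i. ?p * i) ` {..<?P}"
      have "grid (L + 1) j \<notin> (pZp (- L) :: 'p qp set)"
      proof
        assume "grid (L + 1) j \<in> (pZp (- L) :: 'p qp set)"
        then have "pp powi (- (L + 1)) * (of_nat j - of_nat 0) \<in> (pZp (- L) :: 'p qp set)"
          by (simp add: grid_def mult.commute)
        then have "(of_nat j - of_nat 0 :: 'p qp) \<in> pZp (int 1)"
          by (simp only: mult_pp_powi_mem_pZp_iff) simp
        then have "j mod ?p = 0" by (simp only: of_nat_diff_mem_pZp_iff) simp
        then obtain i where "j = ?p * i" by auto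
        then show False using j p0 by auto
      qed
      then show "\<phi> (grid (L + 1) j) = 0" by (rule admD(1)[OF assms(1)])
    qed
  qed (use p0 in auto)
  also have "\<dots> = (\<Sum>i<?P. \<phi> (grid L i))"
    using p0 by (subst sum.reindex) (auto simp: inj_on_def shift)
  finally show ?thesis by (simp add: grid_sum_def P)
qed

text \<open>Invariance makes the summand periodic, so a grid longer by the factor \<open>p\<close>
  repeats the sum \<open>p\<close> times, which the smaller volume of the cosets
  compensates.\<close>

lemma grid_sum_Suc_right:
  fixes \<phi> :: "'p::prime_card qp \<Rightarrow> complex"
  assumes "adm L M \<phi>" "0 \<le> L + M"
  shows "grid_sum L (M + 1) \<phi> = grid_sum L M \<phi>"
proof -
  let ?p = "CARD('p)" and ?P = "CARD('p) ^ nat (L + M)"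
  have P: "?p ^ nat (L + (M + 1)) = ?p * ?P"
  proof -
    have "nat (L + (M + 1)) = Suc (nat (L + M))" using assms(2) by linarith
    then show ?thesis by (simp only: power_Suc)
  qed
  have "(of_nat ?p :: complex) \<noteq> 0" by simp
  then show ?thesis
    unfolding grid_sum_def P
    using sum_lessThan_periodic_mult[of "\<lambda>j. \<phi> (grid L j)" ?P ?p] adm_grid_periodic[OF assms]
    by (simp add: power_int_add)
qed

lemma grid_sum_mono:
  assumes "adm L M \<phi>" "0 \<le> L + M" "L \<le> L'" "M \<le> M'"
  shows "grid_sum L' M' \<phi> = grid_sum L M \<phi>"
proof -
  have "grid_sum L' M \<phi> = grid_sum L M \<phi>"
    using assms(3)
  proof (induction L' rule: int_ge_induct)
    case (step i)
    then show ?case using grid_sum_Suc_left[of i M \<phi>] adm_mono[OF assms(1), of i M] assms(2) by simp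
  qed simp
  moreover have "grid_sum L' M' \<phi> = grid_sum L' M \<phi>"
    using assms(4)
  proof (induction M' rule: int_ge_induct)
    case (step i)
    then show ?case using grid_sum_Suc_right[of L' i \<phi>] adm_mono[OF assms(1), of L' i] assms(2,3) by simp
  qed simp
  ultimately show ?thesis by simp
qed

text \<open>The defining sequence is the grid sum with both bounds equal to \<open>N\<close>, hence
  constant from \<open>max L M\<close> on.\<close>

lemma haar_integral_eq:
  fixes \<phi> :: "'p::prime_card qp \<Rightarrow> complex"
  assumes "adm L M \<phi>" "0 \<le> L + M"
  shows "haar_integral \<phi> = grid_sum L M \<phi>"
proof -
  let ?S = "\<lambda>N. (\<Sum>j<CARD('p) ^ (2 * N). \<phi> (of_nat j / pp ^ N)) / of_nat (CARD('p) ^ N)"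
  have *: "?S N = grid_sum (int N) (int N) \<phi>" for N
  proof -
    have "nat (int N + int N) = 2 * N" by simp
    then show ?thesis by (simp add: grid_sum_def grid_def power_int_minus divide_inverse)
  qed
  have "?S N = grid_sum L M \<phi>" if "nat (max L M) \<le> N" for N
    unfolding * using that by (intro grid_sum_mono assms) linarith+
  then have "\<forall>\<^sub>F N in sequentially. ?S N = grid_sum L M \<phi>"
    by (rule eventually_sequentiallyI)
  then have "?S \<longlonglongrightarrow> grid_sum L M \<phi>" by (rule tendsto_eventually)
  then show ?thesis unfolding haar_integral_def by (rule limI)
qed

text \<open>The working form of \<open>schwartz\<close>: finite sums are read off the two bounds,
  without topology. The passage from \<open>schwartz\<close> is
  \<open>schwartz_imp_sch\<close>.\<close>

definition sch :: "('p::prime_card qp \<Rightarrow> complex) \<Rightarrow> bool" where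
  "sch \<phi> \<longleftrightarrow> (\<exists>L M. adm L M \<phi>)"

lemma schE:
  assumes "sch \<phi>" obtains L M where "adm L M \<phi>" "L0 \<le> L" "M0 \<le> M"
proof -
  obtain L M where "adm L M \<phi>" using assms by (auto simp: sch_def)
  then have "adm (max L L0) (max M M0) \<phi>" by (rule adm_mono) auto
  then show thesis using that by auto
qed

lemma adm_common:
  assumes "sch \<phi>" "sch \<xi>"
  obtains L M where "adm L M \<phi>" "adm L M \<xi>" "0 \<le> L" "0 \<le> M"
proof -
  obtain L M where 1: "adm L M \<phi>" "0 \<le> L" "0 \<le> M" using schE[OF assms(1)] .
  obtain L' M' where 2: "adm L' M' \<xi>" "L \<le> L'" "M \<le> M'" using schE[OF assms(2)] .
  then have "adm L' M' \<phi>" using adm_mono[OF 1(1)] by blast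
  then show thesis using that 1 2 by auto
qed

lemma sch_add: "sch \<phi> \<Longrightarrow> sch \<xi> \<Longrightarrow> sch (\<lambda>x. \<phi> x + \<xi> x)"
  and haar_add: "sch \<phi> \<Longrightarrow> sch \<xi> \<Longrightarrow> haar_integral (\<lambda>x. \<phi> x + \<xi> x) = haar_integral \<phi> + haar_integral \<xi>"
proof -
  assume "sch \<phi>" "sch \<xi>"
  then obtain L M where LM: "adm L M \<phi>" "adm L M \<xi>" "0 \<le> L" "0 \<le> M" by (rule adm_common)
  then have a: "adm L M (\<lambda>x. \<phi> x + \<xi> x)" by (auto simp: adm_def)
  then show "sch (\<lambda>x. \<phi> x + \<xi> x)" by (auto simp: sch_def)
  show "haar_integral (\<lambda>x. \<phi> x + \<xi> x) = haar_integral \<phi> + haar_integral \<xi>"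
    using LM haar_integral_eq[OF a] haar_integral_eq[OF LM(1)] haar_integral_eq[OF LM(2)]
    by (simp add: grid_sum_def sum.distrib add_divide_distrib)
qed

lemma sch_cmult: "sch \<phi> \<Longrightarrow> sch (\<lambda>x. c * \<phi> x)"
  and haar_cmult: "sch \<phi> \<Longrightarrow> haar_integral (\<lambda>x. c * \<phi> x) = c * haar_integral \<phi>"
proof -
  assume "sch \<phi>"
  then obtain L M where LM: "adm L M \<phi>" "0 \<le> L" "0 \<le> M" by (rule schE)
  then have a: "adm L M (\<lambda>x. c * \<phi> x)" by (auto simp: adm_def)
  then show "sch (\<lambda>x. c * \<phi> x)" by (auto simp: sch_def)
  show "haar_integral (\<lambda>x. c * \<phi> x) = c * haar_integral \<phi>"
    using LM haar_integral_eq[OF a] haar_integral_eq[OF LM(1)]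
    by (simp add: grid_sum_def sum_distrib_left)
qed

lemma sch_zero: "sch (\<lambda>x. 0)" and haar_zero: "haar_integral (\<lambda>x :: 'p::prime_card qp. 0) = 0"
proof -
  have a: "adm 0 0 (\<lambda>x :: 'p qp. 0)" by (simp add: adm_def)
  then show "haar_integral (\<lambda>x :: 'p qp. 0) = 0" using haar_integral_eq[OF a] by (simp add: grid_sum_def)
  show "sch (\<lambda>x. 0)" by (auto simp: sch_def adm_def)
qed

lemma sch_sum: "finite I \<Longrightarrow> (\<And>i. i \<in> I \<Longrightarrow> sch (\<phi> i)) \<Longrightarrow> sch (\<lambda>x. \<Sum>i\<in>I. \<phi> i x)"
  by (induction I rule: finite_induct) (simp_all add: sch_zero sch_add)

lemma haar_sum:
  "finite I \<Longrightarrow> (\<And>i. i \<in> I \<Longrightarrow> sch (\<phi> i)) \<Longrightarrow>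
    haar_integral (\<lambda>x. \<Sum>i\<in>I. \<phi> i x) = (\<Sum>i\<in>I. haar_integral (\<phi> i))"
  by (induction I rule: finite_induct) (simp_all add: haar_zero haar_add sch_sum)

text \<open>Up to an element of \<open>pZp M\<close> the translation is by a grid point, and this
  shifts the indices of the periodic summand.\<close>

lemma sch_translate: "sch \<phi> \<Longrightarrow> sch (\<lambda>x. \<phi> (x + t :: 'p::prime_card qp))"
  and haar_translate: "sch \<phi> \<Longrightarrow> haar_integral (\<lambda>x. \<phi> (x + t)) = haar_integral \<phi>"
proof -
  assume "sch \<phi>"
  then obtain L M where LM: "adm L M \<phi>" "max 0 (- ord_p t) \<le> L" "0 \<le> M" by (rule schE)
  have t: "t \<in> pZp (- L)" using LM(2) by (simp add: mem_pZp_iff)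
  have a: "adm L M (\<lambda>x. \<phi> (x + t))"
    unfolding adm_def
  proof (intro conjI allI impI ballI)
    fix x :: "'p qp" assume "x \<notin> pZp (- L)"
    then have "x + t \<notin> pZp (- L)" using pZp_add_cancel[OF t] by blast
    then show "\<phi> (x + t) = 0" by (rule admD(1)[OF LM(1)])
  next
    fix x z :: "'p qp" assume "z \<in> pZp M"
    then show "\<phi> (x + z + t) = \<phi> (x + t)" using admD(2)[OF LM(1), of z "x + t"] by (simp add: add_ac)
  qed
  then show "sch (\<lambda>x. \<phi> (x + t))" by (auto simp: sch_def)
  obtain i where i: "t - grid L i \<in> pZp M" using grid_approx[OF t, of M] LM(2,3) by auto
  have "\<phi> (grid L j + t) = \<phi> (grid L (j + i))" for j
    using admD(2)[OF LM(1) i, of "grid L (j + i)"] by (simp add: grid_def algebra_simps)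
  then have "grid_sum L M (\<lambda>x. \<phi> (x + t)) = grid_sum L M \<phi>"
    using sum_lessThan_periodic_shift[of "\<lambda>j. \<phi> (grid L j)" "CARD('p) ^ nat (L + M)" i]
      adm_grid_periodic[OF LM(1)] LM(2,3)
    by (simp add: grid_sum_def)
  then show "haar_integral (\<lambda>x. \<phi> (x + t)) = haar_integral \<phi>"
    using haar_integral_eq[OF a] haar_integral_eq[OF LM(1)] LM(2,3) by simp
qed

section \<open>Indicator functions of balls\<close>

definition ball_ind :: "'p::prime_card qp \<Rightarrow> int \<Rightarrow> 'p qp \<Rightarrow> complex" where
  "ball_ind x0 M x = (if x - x0 \<in> pZp M then 1 else 0)"

lemma adm_ball_ind: "- L \<le> M \<Longrightarrow> x0 \<in> pZp (- L) \<Longrightarrow> adm L M (ball_ind x0 M :: 'p::prime_card qp \<Rightarrow> complex)"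
  unfolding adm_def
proof (intro conjI allI impI ballI)
  fix x :: "'p qp" assume LM: "- L \<le> M" "x0 \<in> pZp (- L)" "x \<notin> pZp (- L)"
  then have "x - x0 \<notin> pZp M" using pZp_le[OF LM(1), of "x - x0"] pZp_add_cancel[OF LM(2), of "x - x0"] by auto
  then show "ball_ind x0 M x = 0" by (simp add: ball_ind_def)
next
  fix x z :: "'p qp" assume "z \<in> pZp M"
  then show "ball_ind x0 M (x + z) = ball_ind x0 M x"
    using pZp_add_cancel[of z M "x - x0"] by (simp add: ball_ind_def algebra_simps)
qed

lemma adm_ball_ind_0: "adm (- M) M (ball_ind 0 M)"
  by (rule adm_ball_ind) (simp_all add: zero_in_pZp)

lemma sch_ball_ind: "sch (ball_ind x0 M)"
proof -
  have "adm (max (- M) (- ord_p x0)) M (ball_ind x0 M)"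
    by (rule adm_ball_ind) (auto simp: mem_pZp_iff)
  then show ?thesis by (auto simp: sch_def)
qed

lemma haar_ball_ind_0: "haar_integral (ball_ind 0 M :: 'p::prime_card qp \<Rightarrow> complex) = of_nat CARD('p) powi (- M)"
proof -
  have "grid (- M) 0 = (0 :: 'p qp)" by (simp add: grid_def)
  then show ?thesis
    using haar_integral_eq[OF adm_ball_ind_0[of M, where 'a='p]]
    by (simp add: grid_sum_def ball_ind_def zero_in_pZp power_int_minus divide_inverse)
qed

text \<open>The balls around the grid points partition \<open>pZp (- L)\<close>. By linearity this
  reduces the Fourier analysis to indicators of balls.\<close>

lemma adm_decomp:
  fixes \<phi> :: "'p::prime_card qp \<Rightarrow> complex"
  assumes "adm L M \<phi>" "0 \<le> L + M"
  shows "\<phi> x = (\<Sum>j<CARD('p) ^ nat (L + M). \<phi> (grid L j) * ball_ind (grid L j) M x)"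
proof (cases "x \<in> pZp (- L)")
  case True
  then obtain i where i: "i < CARD('p) ^ nat (L + M)" "x - grid L i \<in> pZp M"
    using grid_approx assms(2) by blast
  have "ball_ind (grid L j) M x = (if j = i then 1 else 0)" if "j < CARD('p) ^ nat (L + M)" for j
  proof (cases "j = i")
    case False
    have "x - grid L j \<notin> pZp M"
    proof
      assume "x - grid L j \<in> pZp M"
      then have "grid L j - grid L i \<in> (pZp M :: 'p qp set)"
        using i(2) pZp_diff_sym pZp_diff_trans by blast
      then show False using grid_unique[OF _ assms(2) that i(1)] False by blast
    qed
    then show ?thesis using False by (simp add: ball_ind_def)
  qed (use i in \<open>simp add: ball_ind_def\<close>)
  then have "(\<Sum>j<CARD('p) ^ nat (L + M). \<phi> (grid L j) * ball_ind (grid L j) M x)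
    = (\<Sum>j<CARD('p) ^ nat (L + M). if j = i then \<phi> (grid L j) else 0)"
    by (intro sum.cong) auto
  also have "\<dots> = \<phi> (grid L i)" using i(1) by (simp add: sum.delta)
  also have "\<dots> = \<phi> x" using admD(2)[OF assms(1) i(2), of "grid L i"] by simp
  finally show ?thesis by simp
next
  case False
  have "adm L M (ball_ind (grid L j) M :: 'p qp \<Rightarrow> complex)" for j
    using assms(2) by (intro adm_ball_ind grid_mem) simp
  then have "ball_ind (grid L j) M x = 0" for j using admD(1) False by blast
  then show ?thesis using False admD(1)[OF assms(1)] by simp
qed

lemma adm_mult:
  fixes \<phi> g :: "'p::prime_card qp \<Rightarrow> complex"
  assumes "adm L M \<phi>" "- L \<le> M" "\<And>x z. x \<in> pZp (- L) \<Longrightarrow> z \<in> pZp M \<Longrightarrow> g (x + z) = g x"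
  shows "adm L M (\<lambda>x. \<phi> x * g x)"
  unfolding adm_def
proof (intro conjI allI impI ballI)
  fix x z :: "'p qp" assume z: "z \<in> pZp M"
  have "z \<in> pZp (- L)" using pZp_le[OF assms(2) z] .
  then show "\<phi> (x + z) * g (x + z) = \<phi> x * g x"
    using z assms(3)[of x z] admD(1)[OF assms(1)] admD(2)[OF assms(1) z] by (cases "x \<in> pZp (- L)") auto
qed (use admD(1)[OF assms(1)] in simp)

text \<open>Compactness of the support is used twice: it bounds the support, and a Lebesgue number
  of the cover by open sets of constancy gives one radius of invariance for all points.\<close>

lemma schwartz_imp_sch: "schwartz \<phi> \<Longrightarrow> sch (\<phi> :: 'p::prime_card qp \<Rightarrow> complex)"
proof -
  assume "schwartz \<phi>"
  then have lc: "locally_constant \<phi>" and cp: "compact (closure {x. \<phi> x \<noteq> 0})"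
    by (auto simp: schwartz_def)
  let ?S = "closure {x. \<phi> x \<noteq> 0}"
  have out: "\<phi> x = 0" if "x \<notin> ?S" for x using that closure_subset[of "{x. \<phi> x \<noteq> 0}"] by auto
  obtain e where e: "\<And>y. y \<in> ?S \<Longrightarrow> dist 0 y \<le> e"
    using compact_imp_bounded[OF cp] bounded_any_center[of _ 0] by blast
  have "\<exists>L. e \<le> real CARD('p) powi (int L)"
  proof -
    have "1 < real CARD('p)" using prime_gt_1_nat[OF prime_card[where 'a='p]] by simp
    then obtain L where "e < real CARD('p) ^ L" using real_arch_pow by blast
    then show ?thesis by (intro exI[of _ L]) simp
  qed
  then obtain L where L: "e \<le> real CARD('p) powi (int L)" by blast
  have supp: "\<phi> x = 0" if x: "x \<notin> pZp (- int L)" for x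
  proof (rule ccontr)
    assume "\<phi> x \<noteq> 0"
    then have "x \<in> ?S" using out by blast
    then have "abs_p (0 - x) \<le> real CARD('p) powi (- (- int L))" using e[of x] L by (simp add: dist_qp_def)
    then have "0 - x \<in> pZp (- int L)" by (simp only: abs_p_le_iff)
    then show False using x by (simp add: pZp_uminus)
  qed
  define G where "G = {U. open U \<and> (\<forall>x\<in>U. \<forall>y\<in>U. \<phi> x = \<phi> y)}"
  have "?S \<subseteq> \<Union>G"
  proof
    fix x
    obtain U where "open U" "x \<in> U" "\<forall>y\<in>U. \<phi> y = \<phi> x" using lc unfolding locally_constant_def by blast
    moreover from this have "\<forall>y\<in>U. \<forall>z\<in>U. \<phi> y = \<phi> z" by metis
    ultimately show "x \<in> \<Union>G" unfolding G_def by blast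
  qed
  moreover have "open U" if "U \<in> G" for U using that by (simp add: G_def)
  ultimately obtain d where d: "d > 0" "\<And>x. x \<in> ?S \<Longrightarrow> \<exists>U\<in>G. ball x d \<subseteq> U"
    using Heine_Borel_lemma[OF cp, of G] by blast
  have near: "\<phi> y = \<phi> x" if xy: "x \<in> ?S" "dist x y < d" for x y
  proof -
    obtain U where "U \<in> G" "ball x d \<subseteq> U" using d(2) xy(1) by blast
    moreover have "x \<in> ball x d" "y \<in> ball x d" using xy(2) d(1) by auto
    ultimately show ?thesis unfolding G_def by blast
  qed
  obtain M where M: "real CARD('p) powi (- int M) < d" using powi_less_obtain[OF d(1)] .
  have inv: "\<phi> (x + z) = \<phi> x" if "z \<in> pZp (int M)" for x z
  proof -
    have "abs_p z < d" using that M by (simp add: abs_p_le_iff[symmetric])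
    then have "dist x (x + z) < d" "dist (x + z) x < d"
      by (simp_all add: dist_qp_def abs_p_uminus)
    \<comment> \<open>If neither point lies in \<open>?S\<close>, both values are 0; otherwise
      \<open>near\<close> is applied from the point that does.\<close>
    then show ?thesis using near[of x "x + z"] near[of "x + z" x] out[of x] out[of "x + z"] by metis
  qed
  have "adm (int L) (int M) \<phi>" using supp inv by (auto simp: adm_def)
  then show ?thesis by (auto simp: sch_def)
qed

lemma schwartz_ball_ind: "schwartz (ball_ind x0 M :: 'p::prime_card qp \<Rightarrow> complex)"
proof -
  let ?U = "{y. y - x0 \<in> pZp M}"
  have "locally_constant (ball_ind x0 M)"
    unfolding locally_constant_def
  proof
    fix x
    have *: "ball_ind x0 M y = ball_ind x0 M x" if "y - x \<in> pZp M" for y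
      using pZp_add_cancel[OF that, of "x - x0"] by (simp add: ball_ind_def)
    show "\<exists>U. open U \<and> x \<in> U \<and> (\<forall>y\<in>U. ball_ind x0 M y = ball_ind x0 M x)"
    proof (intro exI conjI ballI)
      show "open {y. y - x \<in> pZp M}" by (rule open_coset)
      show "x \<in> {y. y - x \<in> pZp M}" by (simp add: zero_in_pZp)
      show "ball_ind x0 M y = ball_ind x0 M x" if "y \<in> {y. y - x \<in> pZp M}" for y
        using that by (intro *) simp
    qed
  qed
  moreover have "{x. ball_ind x0 M x \<noteq> 0} = ?U" by (auto simp: ball_ind_def)
  then have "closure {x. ball_ind x0 M x \<noteq> 0} = ?U" using closed_coset[of x0 M] by simp
  then have "compact (closure {x. ball_ind x0 M x \<noteq> 0})" using compact_coset[of x0 M] by simp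
  ultimately show ?thesis by (simp add: schwartz_def)
qed

section \<open>The Weil index\<close>

locale psi_conductor_zero = odd_residue_char prime_type for prime_type :: "'p::prime_card itself" +
  fixes \<psi> :: "'p qp \<Rightarrow> complex"
  assumes psi_additive: "additive_character \<psi>" and psi_conductor: "conductor_zero \<psi>"
begin

section \<open>Orthogonality for the additive character\<close>

lemma psi_add: "\<psi> (x + y) = \<psi> x * \<psi> y"
  using psi_additive by (simp add: additive_character_def)

lemma psi_Zp: "x \<in> Zp \<Longrightarrow> \<psi> x = 1"
  using psi_conductor by (simp add: conductor_zero_def)

lemma psi_0: "\<psi> 0 = 1"
  by (simp add: psi_Zp Zp_closed)

lemma psi_of_nat_mult: "\<psi> (of_nat n * x) = \<psi> x ^ n"
  by (induction n) (simp_all add: psi_0 psi_add algebra_simps)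

lemma psi_diff_Zp: "x - y \<in> Zp \<Longrightarrow> \<psi> x = \<psi> y"
  using psi_add[of "x - y" y] psi_Zp[of "x - y"] by simp

lemma psi_nontrivial:
  assumes "b \<notin> pZp (- M)" obtains z where "z \<in> pZp M" "\<psi> (b * z) \<noteq> 1"
proof -
  obtain x where x: "x \<in> pZp (- 1)" "\<psi> x \<noteq> 1"
    using psi_conductor by (auto simp: conductor_zero_def)
  have b: "b \<noteq> 0" "ord_p b < - M" using assms by (auto simp: mem_pZp_iff)
  have "x / b \<in> pZp M"
    using x b by (cases "x = 0") (auto simp: mem_pZp_iff ord_p_divide)
  moreover have "b * (x / b) = x" using b by simp
  ultimately show thesis using that x by metis
qed

text \<open>Modulo \<open>Zp\<close> the multiples of \<open>s\<close> exhaust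
  \<open>pZp (- 1)\<close>, so \<open>\<psi> s = 1\<close> would make \<open>\<psi>\<close> trivial
  there.\<close>

lemma psi_ord_minus_1:
  assumes "s \<noteq> 0" "ord_p s = - 1" shows "\<psi> s \<noteq> 1"
proof
  assume s: "\<psi> s = 1"
  obtain x where x: "x \<in> pZp (- 1)" "\<psi> x \<noteq> 1"
    using psi_conductor by (auto simp: conductor_zero_def)
  have "x / s \<in> Zp" using x assms by (cases "x = 0") (auto simp: mem_pZp_iff mem_Zp_iff ord_p_divide)
  then obtain j where j: "x / s - of_nat j \<in> pZp (int 1)" by (rule Zp_approx)
  have "s * (x / s - of_nat j) \<in> Zp" using j assms by (simp add: mult_mem_pZp_iff flip: pZp_0)
  moreover have "s * (x / s - of_nat j) = x - of_nat j * s" using assms by (simp add: algebra_simps)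
  ultimately have "\<psi> x = \<psi> (of_nat j * s)" by (intro psi_diff_Zp) simp
  then show False using x s by (simp add: psi_of_nat_mult)
qed

lemma sch_mult_character:
  assumes "adm L M \<phi>" "- L \<le> M"
  shows "sch (\<lambda>x. \<phi> x * \<psi> (b * x))"
proof -
  define M' where "M' = max M (- ord_p b)"
  have b: "b * z \<in> Zp" if "z \<in> pZp M'" for z
    using that by (cases "b = 0 \<or> z = 0") (auto simp: M'_def mem_Zp_iff mem_pZp_iff ord_p_mult)
  have "adm L M' (\<lambda>x. \<phi> x * \<psi> (b * x))"
    using assms b by (intro adm_mult adm_mono[OF assms(1)])
      (auto simp: M'_def distrib_left psi_add psi_Zp)
  then show ?thesis by (auto simp: sch_def)
qed

lemma sch_ball_character: "sch (\<lambda>x. ball_ind x0 M x * \<psi> (b * x))"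
proof -
  have "adm (max (- M) (- ord_p x0)) M (ball_ind x0 M)"
    by (rule adm_ball_ind) (auto simp: mem_pZp_iff)
  then show ?thesis by (rule sch_mult_character) simp
qed

text \<open>Moving the ball to the origin splits off \<open>\<psi> (b * x0)\<close>. If the
  character is not trivial on the ball, translation by some \<open>z\<close> multiplies the integral
  by \<open>\<psi> (b * z) \<noteq> 1\<close>, so it vanishes.\<close>

lemma haar_ball_character:
  "haar_integral (\<lambda>x. ball_ind x0 M x * \<psi> (b * x)) = \<psi> (b * x0) * (if b \<in> pZp (- M) then of_nat CARD('p) powi (- M) else 0)"
proof -
  let ?F = "\<lambda>x. ball_ind 0 M x * \<psi> (b * x)"
  have "haar_integral (\<lambda>x. ball_ind x0 M x * \<psi> (b * x)) = haar_integral (\<lambda>x. \<psi> (b * x0) * ?F (x + - x0))"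
  proof -
    have "\<psi> (b * x) = \<psi> (b * x0) * \<psi> (b * (x + - x0))" for x
      by (simp add: algebra_simps flip: psi_add)
    then show ?thesis by (simp add: ball_ind_def mult_ac)
  qed
  also have "\<dots> = \<psi> (b * x0) * haar_integral (\<lambda>x. ?F (x + - x0))"
    by (intro haar_cmult sch_translate[where \<phi> = ?F] sch_ball_character)
  also have "haar_integral (\<lambda>x. ?F (x + - x0)) = haar_integral ?F"
    by (intro haar_translate[where \<phi> = ?F] sch_ball_character)
  also have "haar_integral ?F = (if b \<in> pZp (- M) then of_nat CARD('p) powi (- M) else 0)"
  proof (cases "b \<in> pZp (- M)")
    case True
    have "?F x = ball_ind 0 M x" for x
      using pZp_mult[OF True, of x M] by (auto simp: ball_ind_def pZp_0 psi_Zp)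
    then show ?thesis using True by (simp only: haar_ball_ind_0 if_True)
  next
    case False
    then obtain z where z: "z \<in> pZp M" "\<psi> (b * z) \<noteq> 1" by (rule psi_nontrivial)
    have "haar_integral ?F = haar_integral (\<lambda>x. ?F (x + z))"
      by (intro haar_translate[where \<phi> = ?F, symmetric] sch_ball_character)
    also have "\<dots> = haar_integral (\<lambda>x. \<psi> (b * z) * ?F x)"
    proof -
      have "?F (x + z) = \<psi> (b * z) * ?F x" for x
        using pZp_add_cancel[OF z(1), of x] by (simp add: ball_ind_def distrib_left psi_add)
      then show ?thesis by simp
    qed
    also have "\<dots> = \<psi> (b * z) * haar_integral ?F" by (intro haar_cmult sch_ball_character)
    finally show ?thesis using z(2) False by simp
  qed
  finally show ?thesis .
qed

section \<open>Fourier inversion and the self-dual measure\<close>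

context
  fixes a :: "'p qp" assumes a: "a \<noteq> 0"
begin

text \<open>Each ball indicator transforms into a character cut off to the dual ball, whose exponent
  is shifted by \<open>ord_p a\<close> because the pairing is
  \<open>\<psi> (a * x * y)\<close>.\<close>

lemma fourier_adm:
  assumes "adm L M \<phi>" "0 \<le> L + M"
  shows "fourier c (\<lambda>x. \<psi> (a * x)) \<phi> y =
    (\<Sum>j<CARD('p) ^ nat (L + M). of_real c * \<phi> (grid L j) * of_nat CARD('p) powi (- M) *
      (ball_ind 0 (- M - ord_p a) y * \<psi> (a * grid L j * y)))"
proof -
  let ?J = "{..<CARD('p) ^ nat (L + M)}"
  have "haar_integral (\<lambda>x. \<phi> x * \<psi> (a * (x * y))) =
    haar_integral (\<lambda>x. \<Sum>j\<in>?J. \<phi> (grid L j) * (ball_ind (grid L j) M x * \<psi> (a * y * x)))"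
    by (subst adm_decomp[OF assms]) (simp add: sum_distrib_right sum_distrib_left mult_ac)
  also have "\<dots> = (\<Sum>j\<in>?J. haar_integral (\<lambda>x. \<phi> (grid L j) * (ball_ind (grid L j) M x * \<psi> (a * y * x))))"
    by (intro haar_sum sch_cmult sch_ball_character) simp
  also have "\<dots> = (\<Sum>j\<in>?J. \<phi> (grid L j) *
      (\<psi> (a * y * grid L j) * (if a * y \<in> pZp (- M) then of_nat CARD('p) powi (- M) else 0)))"
    by (simp add: haar_cmult sch_ball_character haar_ball_character)
  finally show ?thesis
    unfolding fourier_def
    by (simp add: sum_distrib_left mult_mem_pZp_iff[OF a] ball_ind_def mult_ac if_distrib cong: if_cong)
qed

text \<open>In the second transform orthogonality keeps only the grid ball that contains
  \<open>- x\<close>.\<close>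

lemma fourier_fourier:
  assumes "sch \<phi>"
  shows "fourier c (\<lambda>x. \<psi> (a * x)) (fourier c (\<lambda>x. \<psi> (a * x)) \<phi>) x = (of_real c)\<^sup>2 * of_nat CARD('p) powi ord_p a * \<phi> (- x)"
proof -
  obtain L M where LM: "adm L M \<phi>" "0 \<le> L" "0 \<le> M" using schE[OF assms] .
  let ?J = "{..<CARD('p) ^ nat (L + M)}" and ?R = "- M - ord_p a"
  have sch: "sch (\<lambda>y. ball_ind 0 ?R y * \<psi> (b * y))" for b by (rule sch_ball_character)
  have "haar_integral (\<lambda>y. fourier c (\<lambda>x. \<psi> (a * x)) \<phi> y * \<psi> (a * (y * x)))
    = haar_integral (\<lambda>y. \<Sum>j\<in>?J. of_real c * \<phi> (grid L j) * of_nat CARD('p) powi (- M) *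
        (ball_ind 0 ?R y * \<psi> (a * (grid L j + x) * y)))"
    using LM by (subst fourier_adm[OF LM(1)])
      (simp_all add: sum_distrib_right sum_distrib_left psi_add algebra_simps)
  also have "\<dots> = (\<Sum>j\<in>?J. haar_integral (\<lambda>y. of_real c * \<phi> (grid L j) * of_nat CARD('p) powi (- M) *
        (ball_ind 0 ?R y * \<psi> (a * (grid L j + x) * y))))"
    by (intro haar_sum sch_cmult sch) simp
  also have "\<dots> = (\<Sum>j\<in>?J. of_real c * \<phi> (grid L j) * of_nat CARD('p) powi (- M) *
      (if a * (grid L j + x) \<in> pZp (- ?R) then of_nat CARD('p) powi (- ?R) else 0))"
    by (simp add: haar_cmult sch haar_ball_character psi_0)
  also have "\<dots> = (\<Sum>j\<in>?J. of_real c * of_nat CARD('p) powi ord_p a * (\<phi> (grid L j) * ball_ind (grid L j) M (- x)))"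
  proof (rule sum.cong)
    fix j
    have "a * (grid L j + x) \<in> pZp (- ?R) \<longleftrightarrow> - x - grid L j \<in> pZp M"
    proof -
      have "- x - grid L j = - (grid L j + x)" by simp
      then show ?thesis by (simp only: pZp_uminus mult_mem_pZp_iff[OF a]) simp
    qed
    moreover have "(of_nat CARD('p) :: complex) powi (- ?R) = of_nat CARD('p) powi M * of_nat CARD('p) powi ord_p a" by (simp add: power_int_add)
    moreover have "(of_nat CARD('p) :: complex) powi (- M) * of_nat CARD('p) powi M = 1" by (simp add: power_int_minus)
    ultimately show "of_real c * \<phi> (grid L j) * of_nat CARD('p) powi (- M) *
      (if a * (grid L j + x) \<in> pZp (- ?R) then of_nat CARD('p) powi (- ?R) else 0) =
      of_real c * of_nat CARD('p) powi ord_p a * (\<phi> (grid L j) * ball_ind (grid L j) M (- x))"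
      by (simp add: ball_ind_def mult_ac)
  qed simp
  also have "\<dots> = of_real c * of_nat CARD('p) powi ord_p a * \<phi> (- x)"
    using adm_decomp[OF LM(1), of "- x"] LM by (simp flip: sum_distrib_left)
  finally show ?thesis
    by (subst fourier_def) (simp only: power2_eq_square mult.assoc)
qed

text \<open>The square root of \<open>abs_p a\<close>, by which the self-dual measure changes when
  \<open>\<psi>\<close> is replaced by \<open>\<psi> (a * x)\<close>.\<close>

definition dual_factor :: real where
  "dual_factor = real CARD('p) powr (- real_of_int (ord_p a) / 2)"

lemma dual_factor_square: "dual_factor\<^sup>2 = real CARD('p) powi (- ord_p a)"
proof -
  have "dual_factor\<^sup>2 = real CARD('p) powr (- real_of_int (ord_p a))"
    by (simp add: dual_factor_def power2_eq_square flip: powr_add)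
  also have "\<dots> = real CARD('p) powi (- ord_p a)"
    using powr_real_of_int'[of "real CARD('p)" "- ord_p a"] by simp
  finally show ?thesis .
qed

text \<open>For uniqueness, inversion for the indicator of \<open>Zp\<close> at the point 0
  determines \<open>c\<^sup>2\<close>, and \<open>c\<close> is positive.\<close>

lemma self_dual_factor_eq: "self_dual_factor (\<lambda>x. \<psi> (a * x)) = dual_factor"
  unfolding self_dual_factor_def
proof (rule the_equality)
  have "(complex_of_real dual_factor)\<^sup>2 = of_nat CARD('p) powi (- ord_p a)"
    using arg_cong[OF dual_factor_square, of complex_of_real] by simp
  then have "(complex_of_real dual_factor)\<^sup>2 * of_nat CARD('p) powi ord_p a = 1" by (simp add: power_int_minus)
  moreover have "0 < dual_factor" by (simp add: dual_factor_def)
  ultimately show "0 < dual_factor \<and> (\<forall>\<phi>. schwartz \<phi> \<longrightarrow> (\<forall>x. fourier dual_factor (\<lambda>x. \<psi> (a * x))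
      (fourier dual_factor (\<lambda>x. \<psi> (a * x)) \<phi>) x = \<phi> (- x)))"
    by (simp add: fourier_fourier schwartz_imp_sch)
  fix c :: real
  assume c: "0 < c \<and> (\<forall>\<phi>. schwartz \<phi> \<longrightarrow> (\<forall>x. fourier c (\<lambda>x. \<psi> (a * x)) (fourier c (\<lambda>x. \<psi> (a * x)) \<phi>) x = \<phi> (- x)))"
  have "fourier c (\<lambda>x. \<psi> (a * x)) (fourier c (\<lambda>x. \<psi> (a * x)) (ball_ind 0 0)) 0 = ball_ind 0 0 (- 0 :: 'p qp)"
    by (rule spec[OF mp[OF spec[OF conjunct2[OF c], of "ball_ind 0 0"]], OF schwartz_ball_ind, of 0])
  then have "(complex_of_real c)\<^sup>2 * of_nat CARD('p) powi ord_p a = 1"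
    by (simp add: fourier_fourier sch_ball_ind ball_ind_def zero_in_pZp)
  then have "(complex_of_real c)\<^sup>2 = of_nat CARD('p) powi (- ord_p a)" by (simp add: power_int_minus field_simps)
  then have "complex_of_real (c\<^sup>2) = complex_of_real (dual_factor\<^sup>2)" by (simp add: dual_factor_square)
  then have "c\<^sup>2 = dual_factor\<^sup>2" by (simp only: of_real_eq_iff)
  then show "c = dual_factor" using c \<open>0 < dual_factor\<close> by (simp add: power2_eq_iff_nonneg)
qed

section \<open>Gauss integrals and Weil's identity\<close>

definition gauss_integral :: "int \<Rightarrow> complex" where
  "gauss_integral R = haar_integral (\<lambda>y. ball_ind 0 (- R) y * \<psi> (a * y\<^sup>2))"

lemma adm_gauss:
  assumes "- R \<le> M" "R - ord_p a \<le> M" "- ord_p a \<le> 2 * M"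
  shows "adm R M (\<lambda>y. ball_ind 0 (- R) y * \<psi> (a * y\<^sup>2))"
proof (rule adm_mult)
  show "adm R M (ball_ind 0 (- R) :: 'p qp \<Rightarrow> complex)"
    using adm_mono[OF adm_ball_ind_0[of "- R"], of R M] assms(1) by simp
  fix x z :: "'p qp" assume x: "x \<in> pZp (- R)" and z: "z \<in> pZp M"
  have aa: "a \<in> pZp (ord_p a)" by (simp add: mem_pZp_iff)
  have 1: "a * (x * z) \<in> Zp"
    using pZp_le[OF _ pZp_mult[OF aa pZp_mult[OF x z]], of 0] assms by (simp add: pZp_0)
  have 2: "a * (z * z) \<in> Zp"
    using pZp_le[OF _ pZp_mult[OF aa pZp_mult[OF z z]], of 0] assms by (simp add: pZp_0)
  have "a * (x + z)\<^sup>2 - a * x\<^sup>2 = a * (x * z) + a * (x * z) + a * (z * z)"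
    by (simp add: power2_eq_square algebra_simps)
  then show "\<psi> (a * (x + z)\<^sup>2) = \<psi> (a * x\<^sup>2)"
    using 1 2 by (intro psi_diff_Zp) (simp only: Zp_closed)
qed (use assms in simp)

lemma sch_gauss: "sch (\<lambda>y. ball_ind 0 (- R) y * \<psi> (a * y\<^sup>2))"
proof -
  have "adm R (max (max (- R) (R - ord_p a)) \<bar>ord_p a\<bar>) (\<lambda>y. ball_ind 0 (- R) y * \<psi> (a * y\<^sup>2))"
    by (rule adm_gauss) (simp_all add: max_def abs_if)
  then show ?thesis by (auto simp: sch_def)
qed

text \<open>The integral over the shell of the \<open>y\<close> with \<open>ord_p y = - R - 1\<close> vanishes: translating \<open>y\<close> by
  \<open>i * z\<close> multiplies the integrand by the \<open>i\<close>-th power of a primitive \<open>p\<close>-th root of unity.\<close>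

lemma gauss_integral_Suc:
  assumes "ord_p a \<le> 2 * R"
  shows "gauss_integral (R + 1) = gauss_integral R"
proof -
  let ?g = "\<lambda>R y. ball_ind 0 (- R) y * \<psi> (a * y\<^sup>2)"
  define F where "F = (\<lambda>y. ?g (R + 1) y + - 1 * ?g R y)"
  have schF: "sch F" unfolding F_def by (intro sch_add sch_cmult sch_gauss)
  have F: "haar_integral F = gauss_integral (R + 1) - gauss_integral R"
    unfolding F_def gauss_integral_def
    by (subst haar_add[OF sch_gauss sch_cmult[OF sch_gauss]], subst haar_cmult[OF sch_gauss]) simp
  \<comment> \<open>Chosen so that \<open>2 * a * y * z\<close> has order -1 for \<open>y\<close> in
    the shell, while \<open>a * z * z\<close> is integral and translation by multiples of
    \<open>z\<close> preserves both balls.\<close>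
  define z :: "'p qp" where "z = pp powi (R - ord_p a)"
  have z: "z \<noteq> 0" "ord_p z = R - ord_p a" by (simp_all add: z_def ord_p_pp_powi pp_nonzero)
  have "(\<Sum>i<CARD('p). F (y + of_nat i * z)) = 0" for y
  proof -
    have zR: "of_nat i * z \<in> pZp (- R)" for i
      using pZp_mult_Zp[of z "- R" "of_nat i"] z assms by (simp add: mem_pZp_iff Zp_closed mult.commute)
    then have zR': "of_nat i * z \<in> pZp (- (R + 1))" for i by (rule pZp_le[rotated]) simp
    show ?thesis
    proof (cases "y \<in> pZp (- (R + 1)) \<and> y \<notin> pZp (- R)")
      case False
      then have "F (y + of_nat i * z) = 0" for i
        using pZp_add_cancel[OF zR, of y i] pZp_add_cancel[OF zR', of y i] pZp_le[of "- (R + 1)" "- R" y]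
        by (auto simp: F_def ball_ind_def)
      then show ?thesis by simp
    next
      case True
      then have y: "y \<noteq> 0" "ord_p y = - R - 1" by (auto simp: mem_pZp_iff)
      define r where "r = \<psi> (2 * a * y * z)"
      have o: "ord_p (2 * a * y * z) = - 1" "2 * a * y * z \<noteq> 0"
        using a y z two_nonzero by (simp_all add: ord_p_mult ord_p_two)
      then have r1: "r \<noteq> 1" unfolding r_def by (rule psi_ord_minus_1[rotated])
      have "pp * (2 * a * y * z) \<in> Zp"
        using ord_p_mult[OF pp_nonzero o(2)] o(1) by (simp add: mem_Zp_iff ord_p_pp)
      then have rp: "r ^ CARD('p) = 1"
        unfolding r_def by (simp add: psi_of_nat_mult[symmetric] psi_Zp)
      have "F (y + of_nat i * z) = \<psi> (a * y\<^sup>2) * r ^ i" for i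
      proof -
        have "F (y + of_nat i * z) = \<psi> (a * (y + of_nat i * z)\<^sup>2)"
          using pZp_add_cancel[OF zR, of y i] pZp_add_cancel[OF zR', of y i] True
          by (simp add: F_def ball_ind_def)
        also have "a * (y + of_nat i * z)\<^sup>2 = a * y\<^sup>2 + of_nat i * (2 * a * y * z) + of_nat i * of_nat i * (a * z * z)"
          by (simp add: power2_eq_square algebra_simps)
        also have "\<psi> \<dots> = \<psi> (a * y\<^sup>2) * r ^ i * \<psi> (of_nat i * of_nat i * (a * z * z))"
          by (simp add: psi_add psi_of_nat_mult r_def)
        also have "a * z * z \<in> Zp" using a z assms by (simp add: mem_Zp_iff ord_p_mult)
        then have "\<psi> (of_nat i * of_nat i * (a * z * z)) = 1"
          by (rule psi_Zp[OF Zp_closed(5)[OF Zp_closed(5)[OF Zp_closed(3) Zp_closed(3)]]])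
        finally show ?thesis by simp
      qed
      then have "(\<Sum>i<CARD('p). F (y + of_nat i * z)) = \<psi> (a * y\<^sup>2) * (\<Sum>i<CARD('p). r ^ i)"
        by (simp add: sum_distrib_left)
      also have "(\<Sum>i<CARD('p). r ^ i) = 0" using r1 rp by (simp add: geometric_sum)
      finally show ?thesis by simp
    qed
  qed
  then have "0 = haar_integral (\<lambda>y. \<Sum>i<CARD('p). F (y + of_nat i * z))" by (simp add: haar_zero)
  also have "\<dots> = (\<Sum>i<CARD('p). haar_integral (\<lambda>y. F (y + of_nat i * z)))"
    by (intro haar_sum sch_translate[OF schF]) simp
  also have "\<dots> = of_nat CARD('p) * haar_integral F" by (simp add: haar_translate[OF schF])
  finally show ?thesis using F by simp
qed

text \<open>The integral of \<open>\<psi> (a * y\<^sup>2)\<close> over the whole field makes sense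
  only as this stable value of its truncations.\<close>

lemma gauss_integral_stable:
  assumes "ord_p a \<le> 2 * R" "R \<le> R'" shows "gauss_integral R' = gauss_integral R"
  using assms(2)
proof (induction R' rule: int_ge_induct)
  case (step i)
  then show ?case using gauss_integral_Suc[of i] assms(1) by simp
qed simp

text \<open>The Fourier transform of the indicator of a small ball is a character on a large ball, and
  completing the square in its exponent splits off the Gauss integral.\<close>

lemma weil_identity:
  assumes "sch \<phi>" "ord_p a \<le> 2 * R"
  shows "haar_integral (\<lambda>x. fourier c (\<lambda>x. \<psi> (a * x)) \<phi> x * \<psi> (a * x\<^sup>2)) =
    of_real c * gauss_integral R * haar_integral (\<lambda>x. \<phi> x * \<psi> (a * - (x / 2)\<^sup>2))"
proof -
  let ?k = "ord_p a"
  \<comment> \<open>The bound on \<open>M\<close> makes the ball \<open>pZp ?N\<close> invariant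
    under all translations by \<open>grid L j / 2\<close> and makes \<open>M + ?k\<close> at least
    \<open>R\<close>, so that the Gauss integral is stable.\<close>
  obtain L M where LM: "adm L M \<phi>" "\<bar>?k\<bar> \<le> L" "L + \<bar>?k\<bar> + \<bar>R\<bar> \<le> M"
  proof -
    obtain L0 M0 where L: "adm L0 M0 \<phi>" "\<bar>?k\<bar> \<le> L0" "0 \<le> M0" using schE[OF assms(1)] .
    have "adm L0 (max M0 (L0 + \<bar>?k\<bar> + \<bar>R\<bar>)) \<phi>" using adm_mono[OF L(1)] by simp
    then show thesis using L that by simp
  qed
  have LM0: "0 \<le> L + M" using LM by linarith
  let ?J = "{..<CARD('p) ^ nat (L + M)}" and ?N = "- M - ?k"
  let ?g = "\<lambda>y. ball_ind 0 (- (M + ?k)) y * \<psi> (a * y\<^sup>2)"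
  have half: "x / 2 \<in> pZp i \<longleftrightarrow> x \<in> pZp i" for x :: "'p qp" and i
    using two_nonzero by (cases "x = 0") (simp_all add: mem_pZp_iff ord_p_divide ord_p_two)
  have half_mem: "(grid L j / 2 :: 'p qp) \<in> pZp ?N" for j
    unfolding half using LM by (intro pZp_le[OF _ grid_mem]) simp
  have square: "a * grid L j * y + a * y\<^sup>2 = a * - (grid L j / 2)\<^sup>2 + a * (y + grid L j / 2)\<^sup>2" for j y
  proof -
    define w where "w = grid L j / (2::'p qp)"
    have "grid L j = 2 * w" using two_nonzero by (simp add: w_def)
    then show ?thesis unfolding w_def[symmetric] by (simp add: power2_eq_square algebra_simps)
  qed
  have shift: "ball_ind 0 ?N y * \<psi> (a * grid L j * y) * \<psi> (a * y\<^sup>2) =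
      \<psi> (a * - (grid L j / 2)\<^sup>2) * ?g (y + grid L j / 2)" for j y
  proof -
    have "\<psi> (a * grid L j * y) * \<psi> (a * y\<^sup>2) = \<psi> (a * - (grid L j / 2)\<^sup>2) * \<psi> (a * (y + grid L j / 2)\<^sup>2)"
      by (simp only: square flip: psi_add)
    then show ?thesis
      using pZp_add_cancel[OF half_mem, of y j] by (simp add: ball_ind_def mult.assoc)
  qed
  have "haar_integral (\<lambda>x. fourier c (\<lambda>x. \<psi> (a * x)) \<phi> x * \<psi> (a * x\<^sup>2)) =
    haar_integral (\<lambda>y. \<Sum>j\<in>?J. of_real c * \<phi> (grid L j) * of_nat CARD('p) powi (- M) * \<psi> (a * - (grid L j / 2)\<^sup>2) *
      ?g (y + grid L j / 2))"
    by (simp only: fourier_adm[OF LM(1) LM0] sum_distrib_right mult.assoc shift[unfolded mult.assoc])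
  also have "\<dots> = (\<Sum>j\<in>?J. haar_integral (\<lambda>y. of_real c * \<phi> (grid L j) * of_nat CARD('p) powi (- M) *
      \<psi> (a * - (grid L j / 2)\<^sup>2) * ?g (y + grid L j / 2)))"
    by (intro haar_sum sch_cmult sch_translate[of ?g] sch_gauss) simp
  also have "\<dots> = (\<Sum>j\<in>?J. of_real c * \<phi> (grid L j) * of_nat CARD('p) powi (- M) * \<psi> (a * - (grid L j / 2)\<^sup>2) * gauss_integral (M + ?k))"
    by (subst haar_cmult[OF sch_translate[of ?g, OF sch_gauss]], subst haar_translate[of ?g, OF sch_gauss])
      (simp only: gauss_integral_def)
  also have "gauss_integral (M + ?k) = gauss_integral R"
    using LM assms(2) by (intro gauss_integral_stable) auto
  also have "(\<Sum>j\<in>?J. of_real c * \<phi> (grid L j) * of_nat CARD('p) powi (- M) * \<psi> (a * - (grid L j / 2)\<^sup>2) * gauss_integral R)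
    = of_real c * gauss_integral R * grid_sum L M (\<lambda>x. \<phi> x * \<psi> (a * - (x / 2)\<^sup>2))"
    unfolding grid_sum_def power_int_minus divide_inverse sum_distrib_left sum_distrib_right
    by (rule sum.cong) (simp_all only: mult_ac)
  also have "grid_sum L M (\<lambda>x. \<phi> x * \<psi> (a * - (x / 2)\<^sup>2)) = haar_integral (\<lambda>x. \<phi> x * \<psi> (a * - (x / 2)\<^sup>2))"
  proof (rule haar_integral_eq[symmetric, OF adm_mult[OF LM(1)] LM0])
    fix x z :: "'p qp" assume x: "x \<in> pZp (- L)" and z: "z \<in> pZp M"
    have aa: "a \<in> pZp ?k" by (simp add: mem_pZp_iff)
    have x2: "x / 2 \<in> pZp (- L)" and z2: "z / 2 \<in> pZp M" using x z by (simp_all add: half)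
    have 1: "a * (x / 2 * (z / 2)) \<in> Zp"
      using pZp_le[OF _ pZp_mult[OF aa pZp_mult[OF x2 z2]], of 0] LM by (simp add: pZp_0)
    have 2: "a * (z / 2 * (z / 2)) \<in> Zp"
      using pZp_le[OF _ pZp_mult[OF aa pZp_mult[OF z2 z2]], of 0] LM by (simp add: pZp_0)
    have expand: "a * - (u + w)\<^sup>2 - a * - u\<^sup>2 = - (a * (u * w) + a * (u * w) + a * (w * w))" for u w
      by (simp add: power2_eq_square algebra_simps)
    have "a * - ((x + z) / 2)\<^sup>2 - a * - (x / 2)\<^sup>2 =
        - (a * (x / 2 * (z / 2)) + a * (x / 2 * (z / 2)) + a * (z / 2 * (z / 2)))"
      unfolding add_divide_distrib by (rule expand)
    also have "\<dots> \<in> Zp" by (intro Zp_closed(4,6) 1 2)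
    finally show "\<psi> (a * - ((x + z) / 2)\<^sup>2) = \<psi> (a * - (x / 2)\<^sup>2)"
      by (rule psi_diff_Zp)
  qed (use LM in simp)
  finally show ?thesis .
qed

text \<open>Existence is \<open>weil_identity\<close>. For uniqueness one test function with nonzero
  right side suffices, and the indicator of a ball on which the quadratic phase is 1 serves.\<close>

lemma weil_index_eq:
  assumes "ord_p a \<le> 2 * R"
  shows "weil_index (\<lambda>x. \<psi> (a * x)) = of_real dual_factor * gauss_integral R"
proof -
  let ?c = "of_real dual_factor :: complex"
  have abs2: "abs_p (2::'p qp) powr (- 1 / 2) = 1"
    by (simp add: abs_p_def two_nonzero ord_p_two)
  show ?thesis
    unfolding weil_index_def self_dual_factor_eq Let_def abs2
  proof (rule the_equality)
    show "\<forall>\<phi>. schwartz \<phi> \<longrightarrow>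
      ?c * haar_integral (\<lambda>x. fourier dual_factor (\<lambda>x. \<psi> (a * x)) \<phi> x * \<psi> (a * x\<^sup>2)) =
      ?c * gauss_integral R * complex_of_real 1 * (?c * haar_integral (\<lambda>x. \<phi> x * \<psi> (a * - (x / 2)\<^sup>2)))"
      using weil_identity[OF schwartz_imp_sch assms, of _ dual_factor] by simp
    fix w
    assume w: "\<forall>\<phi>. schwartz \<phi> \<longrightarrow>
      ?c * haar_integral (\<lambda>x. fourier dual_factor (\<lambda>x. \<psi> (a * x)) \<phi> x * \<psi> (a * x\<^sup>2)) =
      w * complex_of_real 1 * (?c * haar_integral (\<lambda>x. \<phi> x * \<psi> (a * - (x / 2)\<^sup>2)))"
    define M where "M = \<bar>ord_p a\<bar>"
    let ?phi = "ball_ind 0 M :: 'p qp \<Rightarrow> complex"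
    have "?phi x * \<psi> (a * - (x / 2)\<^sup>2) = ?phi x" for x
    proof (cases "x \<in> pZp M")
      case True
      then have "a * - (x / 2)\<^sup>2 \<in> Zp"
        using a two_nonzero
        by (cases "x = 0") (auto simp: mem_Zp_iff mem_pZp_iff ord_p_mult ord_p_uminus ord_p_divide
            ord_p_power ord_p_two M_def)
      then show ?thesis by (simp add: psi_Zp)
    qed (simp add: ball_ind_def)
    then have I: "haar_integral (\<lambda>x. ?phi x * \<psi> (a * - (x / 2)\<^sup>2)) = of_nat CARD('p) powi (- M)"
      by (simp only: haar_ball_ind_0)
    have "?c * (?c * gauss_integral R * of_nat CARD('p) powi (- M)) = w * (?c * of_nat CARD('p) powi (- M))"
      using w[rule_format, OF schwartz_ball_ind[of 0 M]] weil_identity[OF sch_ball_ind[of 0 M] assms, of dual_factor] I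
      by simp
    moreover have "?c \<noteq> 0" by (simp add: dual_factor_def)
    ultimately show "w = ?c * gauss_integral R" by simp
  qed
qed

end

definition gauss_sum :: "'p qp \<Rightarrow> complex" where
  "gauss_sum u = (\<Sum>j<CARD('p). \<psi> (u * of_nat (j\<^sup>2) / pp))"

text \<open>On \<open>pZp (- l)\<close> the phase is already 1, so the integral is the volume
  \<open>p ^ l\<close>, which \<open>dual_factor\<close> cancels.\<close>

lemma weil_index_even:
  assumes "a \<noteq> 0" "ord_p a = 2 * l"
  shows "weil_index (\<lambda>x. \<psi> (a * x)) = 1"
proof -
  have "ball_ind 0 (- l) y * \<psi> (a * y\<^sup>2) = ball_ind 0 (- l) y" for y
  proof (cases "y \<in> pZp (- l)")
    case True
    then have "a * y\<^sup>2 \<in> Zp" using assms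
      by (cases "y = 0") (auto simp: mem_pZp_iff mem_Zp_iff ord_p_mult ord_p_power)
    then show ?thesis by (simp add: psi_Zp)
  qed (simp add: ball_ind_def)
  then have "gauss_integral a l = of_nat CARD('p) powi l"
    unfolding gauss_integral_def[OF assms(1)] by (simp only: haar_ball_ind_0) simp
  moreover have "dual_factor a = real CARD('p) powi (- l)"
    using powr_real_of_int'[of "real CARD('p)" "- l"] by (simp add: dual_factor_def[OF assms(1)] assms(2))
  ultimately show ?thesis
    using weil_index_eq[OF assms(1), of l] assms(2) by (simp add: power_int_minus)
qed

text \<open>The integrand is supported in \<open>pZp (- l)\<close> and invariant under
  \<open>pZp (1 - l)\<close>, so the grid has exactly \<open>p\<close> points and the sum over it is
  a quadratic Gauss sum.\<close>

lemma weil_index_odd: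
  assumes "a \<noteq> 0" "ord_p a = 2 * l - 1"
  shows "weil_index (\<lambda>x. \<psi> (a * x)) = gauss_sum (unit_part a) / sqrt (real CARD('p))"
proof -
  let ?F = "\<lambda>y. ball_ind 0 (- l) y * \<psi> (a * y\<^sup>2)"
  have F: "?F (grid l j) = \<psi> (unit_part a * of_nat (j\<^sup>2) / pp)" for j
  proof -
    have "unit_part a * pp powi (2 * l - 1) = a"
      using assms(2) by (simp add: unit_part_def pp_nonzero)
    moreover have "(pp powi (2 * l - 1) :: 'p qp) * (pp powi (- l))\<^sup>2 = pp powi (- 1)"
      using pp_powi_add[of "2 * l - 1" "2 * (- l)", where 'p='p] by (simp only: pp_powi_double) simp
    moreover have "(unit_part a * pp powi (2 * l - 1)) * (grid l j)\<^sup>2 =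
        unit_part a * of_nat (j\<^sup>2) * (pp powi (2 * l - 1) * (pp powi (- l))\<^sup>2)"
      by (simp only: grid_def power_mult_distrib of_nat_power mult_ac)
    ultimately have "a * (grid l j)\<^sup>2 = unit_part a * of_nat (j\<^sup>2) * pp powi (- 1)"
      by (simp only:)
    then show ?thesis by (simp add: ball_ind_def grid_mem divide_inverse)
  qed
  have n1: "nat (l + (1 - l)) = 1" by simp
  have "gauss_integral a l = grid_sum l (1 - l) ?F"
    unfolding gauss_integral_def[OF assms(1)]
    using assms by (intro haar_integral_eq adm_gauss) simp_all
  also have "\<dots> = gauss_sum (unit_part a) * of_nat CARD('p) powi (l - 1)"
    unfolding grid_sum_def n1 F gauss_sum_def
    by (simp add: divide_inverse flip: power_int_minus)
  finally have 1: "gauss_integral a l = gauss_sum (unit_part a) * of_nat CARD('p) powi (l - 1)" .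
  have "dual_factor a * real CARD('p) powi (l - 1) = real CARD('p) powr (1 / 2 - l) * real CARD('p) powr (l - 1)"
    using powr_real_of_int'[of "real CARD('p)" "l - 1"] assms(2)
    by (simp add: dual_factor_def[OF assms(1)] diff_divide_distrib)
  also have "\<dots> = real CARD('p) powr (- (1 / 2))" by (subst powr_add[symmetric]) simp
  also have "\<dots> = 1 / sqrt (real CARD('p))" by (simp add: powr_minus_divide powr_half_sqrt)
  finally have "complex_of_real (dual_factor a * real CARD('p) powi (l - 1)) = complex_of_real (1 / sqrt (real CARD('p)))"
    by (rule arg_cong)
  then have 2: "complex_of_real (dual_factor a) * of_nat CARD('p) powi (l - 1) = 1 / complex_of_real (sqrt (real CARD('p)))"
    by simp
  have "weil_index (\<lambda>x. \<psi> (a * x)) = of_real (dual_factor a) * gauss_integral a l"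
    using assms by (intro weil_index_eq) simp_all
  also have "\<dots> = gauss_sum (unit_part a) * (complex_of_real (dual_factor a) * of_nat CARD('p) powi (l - 1))"
    unfolding 1 by (simp only: mult_ac)
  finally show ?thesis unfolding 2 by simp
qed

end

section \<open>Gauss sums\<close>

context odd_residue_char
begin

section \<open>Periodic sums over residues\<close>

lemma periodic_mod:
  fixes F :: "nat \<Rightarrow> 'b"
  assumes "\<And>j. F (j + P) = F j" shows "F m = F (m mod P)"
proof -
  have "F (j + k * P) = F j" for j k
  proof (induction k)
    case (Suc k)
    then show ?case using assms[of "j + k * P"] by (simp add: add_ac)
  qed simp
  from this[of "m mod P" "m div P"] show ?thesis by simp
qed

text \<open>Multiplication by \<open>T\<close> permutes the residues modulo
  \<open>P\<close>.\<close>

lemma sum_periodic_dilate: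
  fixes F :: "nat \<Rightarrow> complex"
  assumes "\<And>j. F (j + P) = F j" "coprime T P" "0 < P"
  shows "(\<Sum>j<P. F (T * j)) = (\<Sum>j<P. F j)"
proof -
  let ?f = "\<lambda>j. (T * j) mod P"
  have inj: "inj_on ?f {..<P}"
  proof (rule inj_onI)
    fix i j assume ij: "i \<in> {..<P}" "j \<in> {..<P}" "?f i = ?f j"
    then have "[T * i = T * j] (mod P)" by (simp add: cong_def)
    then have "[i = j] (mod P)" using assms(2) by (simp add: cong_mult_lcancel_nat)
    then show "i = j" using ij by (simp add: cong_def)
  qed
  have "?f ` {..<P} = {..<P}"
    using inj assms(3) by (intro endo_inj_surj) auto
  then have "(\<Sum>j<P. F j) = (\<Sum>j\<in>?f ` {..<P}. F j)" by simp
  also have "\<dots> = (\<Sum>j<P. F (?f j))" using inj by (simp add: sum.reindex)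
  also have "\<dots> = (\<Sum>j<P. F (T * j))" using periodic_mod[of F P] assms(1) by simp
  finally show ?thesis by simp
qed

text \<open>For \<open>m \<noteq> 0\<close> and a root \<open>i\<close>, any root \<open>j\<close>
  makes \<open>p\<close> divide \<open>(j - i) * (j + i)\<close>, so the roots are \<open>i\<close>
  and \<open>p - i\<close>, which differ because \<open>p\<close> is odd.\<close>

lemma card_square_roots:
  assumes "m < CARD('p)"
  shows "int (card {j. j < CARD('p) \<and> j\<^sup>2 mod CARD('p) = m}) = 1 + Legendre (int m) (int CARD('p))"
proof -
  let ?p = "CARD('p)"
  let ?S = "{j. j < ?p \<and> j\<^sup>2 mod ?p = m}"
  have pr: "prime ?p" by (rule prime_card)
  have int_iff: "j\<^sup>2 mod ?p = m \<longleftrightarrow> [(int j)\<^sup>2 = int m] (mod int ?p)" for j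
  proof -
    have "j\<^sup>2 mod ?p = m \<longleftrightarrow> [j\<^sup>2 = m] (mod ?p)" using assms by (simp add: cong_def)
    also have "\<dots> \<longleftrightarrow> [(int j)\<^sup>2 = int m] (mod int ?p)" using cong_int_iff[of "j\<^sup>2" m ?p] by simp
    finally show ?thesis .
  qed
  have m0: "[int m = 0] (mod int ?p) \<longleftrightarrow> m = 0"
    using assms by (simp add: cong_def)
  consider "m = 0" | "m \<noteq> 0" "?S = {}" | i where "m \<noteq> 0" "i \<in> ?S" by blast
  then show ?thesis
  proof cases
    case 1
    have "?S = {0}"
    proof (intro subset_antisym subsetI)
      fix j assume "j \<in> ?S"
      then have "?p dvd j" using 1 pr prime_dvd_power[of ?p j 2] by auto
      then show "j \<in> {0}" using \<open>j \<in> ?S\<close> by (auto dest: nat_dvd_not_less)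
    qed (use 1 assms in auto)
    then show ?thesis using 1 by (simp add: Legendre_def)
  next
    case 2
    have "\<not> QuadRes (int ?p) (int m)"
    proof
      assume "QuadRes (int ?p) (int m)"
      then obtain y where y: "[y\<^sup>2 = int m] (mod int ?p)" by (auto simp: QuadRes_def)
      define j where "j = nat (y mod int ?p)"
      have p0: "0 < int ?p" using p_gt_2 by simp
      have j: "int j = y mod int ?p" using p0 by (simp add: j_def)
      then have "j < ?p" using p0 by (metis of_nat_less_iff pos_mod_bound)
      moreover have "[(int j)\<^sup>2 = int m] (mod int ?p)"
        using y unfolding j cong_def by (simp add: power_mod)
      ultimately show False using 2 int_iff by blast
    qed
    then show ?thesis using 2 m0 by (simp add: Legendre_def)
  next
    case 3
    then have i: "i < ?p" "[(int i)\<^sup>2 = int m] (mod int ?p)" using int_iff by auto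
    have Q: "QuadRes (int ?p) (int m)" using i(2) by (auto simp: QuadRes_def)
    have i0: "i \<noteq> 0"
    proof
      assume "i = 0"
      then have "[0 = int m] (mod int ?p)" using i by simp
      then show False using m0 3(1) cong_sym by blast
    qed
    have "?S = {i, ?p - i}"
    proof (intro subset_antisym subsetI)
      fix j assume j: "j \<in> ?S"
      then have "[(int j)\<^sup>2 = (int i)\<^sup>2] (mod int ?p)" using i(2) int_iff cong_sym cong_trans by blast
      then have "int ?p dvd (int j - int i) * (int j + int i)"
        by (simp add: cong_iff_dvd_diff power2_eq_square algebra_simps)
      then have "int ?p dvd int j - int i \<or> int ?p dvd int j + int i"
        using prime_dvd_mult_iff prime_card_int[where 'a='p] by blast
      then show "j \<in> {i, ?p - i}"
      proof
        assume "int ?p dvd int j - int i"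
        then have "[j = i] (mod ?p)" by (simp add: cong_iff_dvd_diff flip: cong_int_iff)
        then show ?thesis using j i by (simp add: cong_def)
      next
        assume "int ?p dvd int j + int i"
        then have "?p dvd j + i" by (metis of_nat_add of_nat_dvd_iff)
        then obtain t where t: "j + i = ?p * t" by (elim dvdE)
        have "?p * t < ?p * 2" "0 < ?p * t" using t j i i0 by (auto simp flip: t)
        then have "t = 1" by simp
        then show ?thesis using t by auto
      qed
    next
      fix j assume "j \<in> {i, ?p - i}"
      moreover have "[(int (?p - i))\<^sup>2 = int m] (mod int ?p)"
      proof -
        have "(int (?p - i))\<^sup>2 - (int i)\<^sup>2 = int ?p * (int ?p - 2 * int i)"
          using i(1) by (simp add: of_nat_diff power2_eq_square algebra_simps)
        then have "[(int (?p - i))\<^sup>2 = (int i)\<^sup>2] (mod int ?p)" by (simp add: cong_iff_dvd_diff)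
        then show ?thesis using i(2) cong_trans by blast
      qed
      ultimately have "j < ?p \<and> [(int j)\<^sup>2 = int m] (mod int ?p)" using i i0 by auto
      then show "j \<in> ?S" by (simp only: int_iff mem_Collect_eq)
    qed
    moreover have "i \<noteq> ?p - i"
    proof
      assume "i = ?p - i"
      then have "?p = 2 * i" using i(1) by linarith
      then show False using odd_p by (metis dvd_triv_left)
    qed
    ultimately have "card ?S = 2" by simp
    then show ?thesis using Q m0 3(1) by (simp add: Legendre_def)
  qed
qed

text \<open>When the indices are grouped by their squares, the residue \<open>m\<close> occurs
  \<open>1 + Legendre m p\<close> times.\<close>

lemma sum_periodic_squares:
  fixes F :: "nat \<Rightarrow> complex"
  assumes per: "\<And>j. F (j + CARD('p)) = F j"
  shows "(\<Sum>j<CARD('p). F (j\<^sup>2)) =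
    (\<Sum>m<CARD('p). F m) + (\<Sum>m<CARD('p). of_int (Legendre (int m) (int CARD('p))) * F m)"
proof -
  let ?p = "CARD('p)"
  have "(\<Sum>j<?p. F (j\<^sup>2)) = (\<Sum>j<?p. F (j\<^sup>2 mod ?p))"
    using periodic_mod[of F ?p] per by simp
  also have "\<dots> = (\<Sum>m<?p. \<Sum>j\<in>{j \<in> {..<?p}. j\<^sup>2 mod ?p = m}. F (j\<^sup>2 mod ?p))"
    using p_gt_2 by (intro sum.group[symmetric]) auto
  also have "\<dots> = (\<Sum>m<?p. of_int (int (card {j. j < ?p \<and> j\<^sup>2 mod ?p = m})) * F m)"
    by (intro sum.cong) simp_all
  also have "\<dots> = (\<Sum>m<?p. (1 + of_int (Legendre (int m) (int ?p))) * F m)"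
    by (intro sum.cong) (simp_all only: card_square_roots lessThan_iff of_int_add of_int_1)
  finally show ?thesis by (simp add: distrib_right sum.distrib)
qed

end

context psi_conductor_zero
begin

section \<open>The Gauss sum of the additive character\<close>

lemma psi_periodic:
  assumes "u \<in> Zp" shows "\<psi> (u * of_nat (j + CARD('p)) / pp) = \<psi> (u * of_nat j / pp)"
  using assms pp_nonzero[where 'p='p] by (intro psi_diff_Zp) (simp add: field_simps)

lemma sum_psi_unit:
  assumes "u \<in> Zp_units" shows "(\<Sum>j<CARD('p). \<psi> (u * of_nat j / pp)) = 0"
proof -
  define r where "r = \<psi> (u / pp)"
  have "\<psi> (u * of_nat j / pp) = r ^ j" for j
    using psi_of_nat_mult[of j "u / pp"] by (simp add: r_def mult.commute)
  moreover have "r \<noteq> 1"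
    using assms pp_nonzero[where 'p='p] unfolding r_def
    by (intro psi_ord_minus_1) (simp_all add: mem_Zp_units_iff ord_p_divide ord_p_pp)
  moreover have "r ^ CARD('p) = 1"
    using psi_of_nat_mult[of "CARD('p)" "u / pp"] assms pp_nonzero[where 'p='p]
    by (simp add: r_def psi_Zp Zp_units_def)
  ultimately show ?thesis by (simp add: geometric_sum)
qed

lemma gauss_sum_Legendre:
  assumes "u \<in> Zp_units"
  shows "gauss_sum u = (\<Sum>m<CARD('p). of_int (Legendre (int m) (int CARD('p))) * \<psi> (u * of_nat m / pp))"
  using sum_periodic_squares[of "\<lambda>j. \<psi> (u * of_nat j / pp)"] psi_periodic[of u] sum_psi_unit[OF assms] assms
  by (simp add: gauss_sum_def Zp_units_def)

text \<open>With \<open>U\<close> an integer representing \<open>u\<close>, the substitution of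
  \<open>U * m\<close> for \<open>m\<close> absorbs \<open>u\<close> into the exponent and costs the
  factor \<open>Legendre U p\<close>, which is its own inverse.\<close>

lemma gauss_sum_unit:
  assumes u: "u \<in> Zp_units" shows "gauss_sum u = of_int (chi u) * gauss_sum 1"
proof -
  let ?p = "CARD('p)"
  let ?L = "\<lambda>m. of_int (Legendre (int m) (int ?p)) :: complex"
  have uZ: "u \<in> Zp" using u by (simp add: Zp_units_def)
  define U where "U = nat (residue_mod_p u)"
  have U: "int U = residue_mod_p u" using residue_mod_p[OF uZ] by (simp add: U_def)
  have uU: "u - of_nat U \<in> pZp 1"
    using residue_mod_p(3)[OF uZ] by (metis U of_int_of_nat_eq)
  have LU: "?L U = of_int (chi u)" by (simp add: chi_def U)
  have LU2: "?L U * ?L U = 1" using chi_unit_cases[OF u] by (auto simp: LU)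
  have "\<not> ?p dvd U"
  proof
    assume "?p dvd U"
    then have "[int U = 0] (mod int ?p)" by (simp add: cong_0_iff)
    then have "?L U = 0" by (simp add: Legendre_def)
    then show False using LU2 by simp
  qed
  then have cop: "coprime U ?p" using prime_imp_coprime[OF prime_card[where 'a='p]] by (simp add: coprime_commute)
  have "of_int (Legendre (int m) (int ?p)) * \<psi> (u * of_nat m / pp) =
      of_int (chi u) * (?L (U * m) * \<psi> (1 * of_nat (U * m) / pp))" for m
  proof -
    have "u * of_nat m / pp - 1 * of_nat (U * m) / pp = (u - of_nat U) * of_nat m / pp"
      using pp_nonzero[where 'p='p] by (simp add: field_simps)
    moreover have "(u - of_nat U) * of_nat m / pp \<in> Zp"
    proof -
      have "(u - of_nat U) * of_nat m \<in> pZp 1" using uU by (intro pZp_mult_Zp Zp_closed)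
      then show ?thesis using mult_pp_powi_mem_pZp_iff[of "- 1" "(u - of_nat U) * of_nat m" 0]
        by (simp add: pZp_0 divide_inverse mult.commute)
    qed
    ultimately have "\<psi> (u * of_nat m / pp) = \<psi> (1 * of_nat (U * m) / pp)" by (intro psi_diff_Zp) simp
    moreover have "?L (U * m) = ?L U * ?L m" by (simp add: Legendre_mult)
    ultimately show ?thesis using LU2 by (simp add: LU mult.assoc[symmetric])
  qed
  then have "gauss_sum u = of_int (chi u) * (\<Sum>m<?p. ?L (U * m) * \<psi> (1 * of_nat (U * m) / pp))"
    unfolding gauss_sum_Legendre[OF u] by (simp only: sum_distrib_left)
  also have "(\<Sum>m<?p. ?L (U * m) * \<psi> (1 * of_nat (U * m) / pp)) = (\<Sum>m<?p. ?L m * \<psi> (1 * of_nat m / pp))"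
  proof (rule sum_periodic_dilate[OF _ cop])
    fix j
    have "?L (j + ?p) = ?L j" by (simp add: Legendre_cong[of "int j + int ?p" "int j"] cong_def)
    then show "?L (j + ?p) * \<psi> (1 * of_nat (j + ?p) / pp) = ?L j * \<psi> (1 * of_nat j / pp)"
      using psi_periodic[OF Zp_closed(2), of j] by simp
  qed (use p_gt_2 in simp)
  also have "\<dots> = gauss_sum 1" by (rule gauss_sum_Legendre[OF one_in_Zp_units, symmetric])
  finally show ?thesis .
qed

text \<open>Translating the inner variable makes the exponent \<open>j\<^sup>2 - (h + j)\<^sup>2\<close> linear in \<open>j\<close>.\<close>

lemma gauss_sum_mult_conj: "gauss_sum 1 * gauss_sum (- 1) = of_nat CARD('p)"
proof -
  let ?p = "CARD('p)"
  define G where "G = (\<lambda>h. \<psi> (- 1 * of_nat (h\<^sup>2) / pp))"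
  have per: "G (h + ?p) = G h" for h
  proof -
    have "of_nat ((h + ?p)\<^sup>2) = (of_nat (h\<^sup>2) + pp * (2 * of_nat h + pp) :: 'p qp)"
      by (simp add: power2_eq_square algebra_simps)
    then have "- 1 * of_nat ((h + ?p)\<^sup>2) / pp - - 1 * of_nat (h\<^sup>2) / pp = - (2 * of_nat h + pp :: 'p qp)"
      using pp_nonzero[where 'p='p] by (simp add: field_simps)
    moreover have "- (2 * of_nat h + pp) \<in> (Zp :: 'p qp set)"
      using Zp_closed(3)[of "2 * h + ?p", where 'p='p] Zp_closed(6) by (metis of_nat_add of_nat_mult of_nat_numeral)
    ultimately show ?thesis unfolding G_def by (intro psi_diff_Zp) simp
  qed
  define r where "r = (\<lambda>h. \<psi> (- 2 * of_nat h / pp))"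
  have tm: "\<psi> (1 * of_nat (j\<^sup>2) / pp) * G (h + j) = G h * r h ^ j" for h j
  proof -
    have "1 * of_nat (j\<^sup>2) / pp + - 1 * of_nat ((h + j)\<^sup>2) / pp =
        - 1 * of_nat (h\<^sup>2) / pp + of_nat j * (- 2 * of_nat h / pp :: 'p qp)"
      using pp_nonzero[where 'p='p] by (simp add: field_simps power2_eq_square)
    then show ?thesis
      unfolding G_def r_def by (simp only: flip: psi_add psi_of_nat_mult)
  qed
  have geom: "(\<Sum>j<?p. r h ^ j) = (if h = 0 then of_nat ?p else 0)" if "h < ?p" for h
  proof (cases "h = 0")
    case False
    have "\<not> int ?p dvd int h" using that False zdvd_not_zless[of "int h" "int ?p"] by simp
    then have "of_nat h \<in> (Zp_units :: 'p qp set)"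
      using of_int_mem_pZp_1_iff[of "int h", where 'p='p] unit_iff_not_mem_pZp[of "of_nat h :: 'p qp"]
      by (simp add: Zp_closed)
    then have u: "- 2 * of_nat h \<in> (Zp_units :: 'p qp set)"
      using two_unit ord_p_uminus[OF two_nonzero] by (intro Zp_units_mult) (auto simp: mem_Zp_units_iff)
    have "r h ^ j = \<psi> (- 2 * of_nat h * of_nat j / pp)" for j
      using psi_of_nat_mult[of j "- 2 * of_nat h / pp"] by (simp add: r_def mult_ac)
    then show ?thesis using sum_psi_unit[OF u] False by simp
  qed (simp add: r_def psi_0)
  have "gauss_sum 1 * gauss_sum (- 1) = (\<Sum>j<?p. \<psi> (1 * of_nat (j\<^sup>2) / pp) * (\<Sum>h<?p. G h))"
    by (simp add: gauss_sum_def G_def sum_distrib_right)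
  also have "\<dots> = (\<Sum>j<?p. \<psi> (1 * of_nat (j\<^sup>2) / pp) * (\<Sum>h<?p. G (h + j)))"
    using sum_lessThan_periodic_shift[of G ?p] per by simp
  also have "\<dots> = (\<Sum>j<?p. \<Sum>h<?p. G h * r h ^ j)"
    by (simp only: sum_distrib_left tm)
  also have "\<dots> = (\<Sum>h<?p. G h * (\<Sum>j<?p. r h ^ j))"
    by (subst sum.swap) (simp only: sum_distrib_left)
  also have "\<dots> = (\<Sum>h<?p. if h = 0 then G h * of_nat ?p else 0)"
    by (intro sum.cong) (simp_all add: geom)
  also have "\<dots> = of_nat ?p" using p_gt_2 by (simp add: G_def psi_0 sum.delta)
  finally show ?thesis .
qed

lemma minus_one_unit: "(- 1 :: 'p qp) \<in> Zp_units"
  by (simp add: Zp_units_def Zp_closed)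

text \<open>\<open>gauss_sum (- 1)\<close> is \<open>chi (- 1) * gauss_sum 1\<close>, and
  \<open>chi (- 1)\<close> is its own inverse.\<close>

lemma gauss_sum_square: "(gauss_sum 1)\<^sup>2 = of_int (chi (- 1)) * of_nat CARD('p)"
proof -
  have "of_int (chi (- 1)) * (gauss_sum 1)\<^sup>2 = of_nat CARD('p)"
    using gauss_sum_mult_conj gauss_sum_unit[OF minus_one_unit] by (simp add: power2_eq_square mult_ac)
  then show ?thesis using chi_unit_cases[OF minus_one_unit] by (auto simp: minus_equation_iff)
qed

lemma weil_index_psi: "weil_index \<psi> = 1"
  using weil_index_even[of 1 0] by (simp add: ord_p_1)

text \<open>A fourth root of unity. The multiplication rule for Weil ratios depends on it only
  through its square, so the determination of the sign of the Gauss sum is avoided.\<close>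

definition gauss_sign :: complex where
  "gauss_sign = gauss_sum 1 / sqrt (real CARD('p))"

lemma gauss_sign_square: "gauss_sign\<^sup>2 = of_int (sgnb (nonres (- 1)))"
proof -
  have "(complex_of_real (sqrt (real CARD('p))))\<^sup>2 = of_nat CARD('p)"
    by (metis of_real_of_nat_eq of_real_power real_sqrt_pow2 of_nat_0_le_iff)
  then have "gauss_sign\<^sup>2 = of_int (chi (- 1))"
    by (simp add: gauss_sign_def power_divide gauss_sum_square)
  then show ?thesis
    using chi_unit_cases[OF minus_one_unit] by (auto simp: nonres_unit[OF minus_one_unit] sgnb_def)
qed

lemma weil_ratio_eq:
  assumes "a \<noteq> 0"
  shows "weil_ratio a \<psi> = (if oddord a then of_int (sgnb (nonres a)) * gauss_sign else 1)"
proof (cases "oddord a")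
  case False
  then obtain l where "ord_p a = 2 * l" by (auto simp: oddord_def elim: evenE)
  then show ?thesis using False weil_index_even[OF assms] by (simp add: weil_ratio_def weil_index_psi)
next
  case True
  then obtain l where "ord_p a = 2 * l + 1" by (auto simp: oddord_def elim: oddE)
  then have "ord_p a = 2 * (l + 1) - 1" by simp
  then have "weil_ratio a \<psi> = gauss_sum (unit_part a) / sqrt (real CARD('p))"
    using weil_index_odd[OF assms, of "l + 1"] by (simp add: weil_ratio_def weil_index_psi)
  also have "gauss_sum (unit_part a) = of_int (sgnb (nonres a)) * gauss_sum 1"
    using gauss_sum_unit[OF unit_part_unit[OF assms]] chi_unit_cases[OF unit_part_unit[OF assms]]
    by (auto simp: nonres_def sgnb_def)
  finally show ?thesis using True by (simp add: gauss_sign_def)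
qed

lemma weil_ratio_unit: "u \<in> Zp_units \<Longrightarrow> weil_ratio u \<psi> = 1"
  using oddord_unit[of u] by (simp add: weil_ratio_eq Zp_units_def)

text \<open>When both orders are odd, the two factors \<open>gauss_sign\<close> multiply to
  \<open>chi (- 1)\<close>, which accounts for the term with \<open>nonres (- 1)\<close> in
  \<open>hpair\<close>; the other two terms compare the residue signs.\<close>

lemma weil_ratio_mult:
  assumes "a \<noteq> 0" "b \<noteq> 0"
  shows "weil_ratio a \<psi> * weil_ratio b \<psi> = of_int (sgnb (hpair a b)) * weil_ratio (a * b) \<psi>"
  using assms gauss_sign_square
  by (auto simp: weil_ratio_eq oddord_mult nonres_mult hpair_def sgnb_def power2_eq_square)

end

section \<open>Characters and equivariant functions\<close>

text \<open>Squaring moves a number within \<open>1 / 2\<close> of 1 away from 1 by a factor \<open>3 / 2\<close>, so the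
  multiplicative group of the complex numbers has no small subgroups.\<close>

lemma complex_no_small_subgroup:
  fixes z :: complex
  assumes "\<And>k. norm (z ^ k - 1) \<le> 1 / 2" shows "z = 1"
proof (rule ccontr)
  assume z: "z \<noteq> 1"
  have grow: "(3 / 2) ^ k * norm (z - 1) \<le> norm (z ^ (2 ^ k) - 1)" for k
  proof (induction k)
    case (Suc k)
    define w where "w = z ^ (2 ^ k)"
    have "norm (2 :: complex) \<le> norm (w + 1) + norm (w - 1)"
      using norm_triangle_ineq4[of "w + 1" "w - 1"] by simp
    then have "3 / 2 \<le> norm (w + 1)" using assms[of "2 ^ k"] by (simp add: w_def)
    then have "3 / 2 * norm (w - 1) \<le> norm (w + 1) * norm (w - 1)" by (rule mult_right_mono) simp
    also have "\<dots> = norm (z ^ (2 ^ Suc k) - 1)"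
      by (simp add: w_def power_mult power2_eq_square algebra_simps flip: norm_mult power_mult)
        (simp add: power_mult power2_eq_square mult.commute[of 2])
    finally show ?case using Suc by (simp add: w_def)
  qed simp
  obtain k where "1 / norm (z - 1) < (3 / 2) ^ k" using real_arch_pow[of "3 / 2"] by auto
  then have "1 < (3 / 2) ^ k * norm (z - 1)" using z by (simp add: field_simps)
  then show False using grow[of k] assms[of "2 ^ k"] by linarith
qed

text \<open>Continuity sends some subgroup \<open>1 + p ^ k Zp\<close> into the disc of radius 1 / 2
  around 1, so all powers of \<open>\<theta> u\<close> stay in it. The result ensures that the
  \<open>LEAST\<close> in \<open>conductor_exponent\<close> is attained.\<close>

lemma multiplicative_character_trivial:
  fixes \<theta> :: "'p::prime_card qp \<Rightarrow> complex"
  assumes "multiplicative_character \<theta>"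
  shows "\<exists>m. \<forall>u\<in>unit_filtration m. \<theta> u = 1"
proof -
  have cont: "continuous_on (- {0}) \<theta>"
    using assms by (auto simp: multiplicative_character_def)
  have nz: "x \<noteq> 0 \<Longrightarrow> \<theta> x \<noteq> 0" and mult: "x \<noteq> 0 \<Longrightarrow> y \<noteq> 0 \<Longrightarrow> \<theta> (x * y) = \<theta> x * \<theta> y" for x y
    using assms by (auto simp: multiplicative_character_def)
  have one: "\<theta> 1 = 1" using mult[of 1 1] nz[of 1] by simp
  obtain d where d: "d > 0" "\<And>x. x \<in> - {0} \<Longrightarrow> dist x 1 < d \<Longrightarrow> dist (\<theta> x) (\<theta> 1) < 1 / 2"
    using cont[unfolded continuous_on_iff, rule_format, of 1 "1 / 2"] by auto
  obtain N where N: "real CARD('p) powi (- int N) < d" using powi_less_obtain[OF d(1)] .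
  have "\<theta> u = 1" if u: "u \<in> unit_filtration (Suc N)" for u
  proof (rule complex_no_small_subgroup)
    fix k
    have u1: "u - 1 \<in> pZp (int (Suc N))" using u by (simp add: unit_filtration_def)
    have u0: "u \<noteq> 0" using one_plus_pZp_unit[OF u1] by (simp add: Zp_units_def)
    have uZ: "u \<in> Zp" using one_plus_pZp_unit[OF u1] by (simp add: Zp_units_def)
    have "u ^ k - 1 \<in> pZp (int (Suc N))"
    proof (induction k)
      case (Suc k)
      have "u ^ Suc k - 1 = (u - 1) * u ^ k + (u ^ k - 1)" by (simp add: algebra_simps)
      also have "\<dots> \<in> pZp (int (Suc N))" by (intro pZp_add Suc.IH pZp_mult_Zp u1 Zp_closed uZ)
      finally show ?case .
    qed (simp add: zero_in_pZp)
    then have "u ^ k - 1 \<in> pZp (int N)" by (rule pZp_le[rotated]) simp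
    then have "dist (u ^ k) 1 < d" using N by (simp add: dist_qp_def flip: abs_p_le_iff)
    then have "dist (\<theta> (u ^ k)) (\<theta> 1) < 1 / 2" using u0 by (intro d(2)) auto
    moreover have "\<theta> (u ^ k) = \<theta> u ^ k"
      by (induction k) (simp_all add: one mult u0)
    ultimately show "norm (\<theta> u ^ k - 1) \<le> 1 / 2" by (simp add: dist_norm one)
  qed
  then show ?thesis by blast
qed

lemma abs_p_mult: "abs_p (x * y) = abs_p x * abs_p (y :: 'p::prime_card qp)"
  using power_int_add[of "real CARD('p)" "- ord_p x" "- ord_p y"]
  by (cases "x = 0 \<or> y = 0") (auto simp: abs_p_def ord_p_mult)

lemma abs_p_unit: "u \<in> Zp_units \<Longrightarrow> abs_p u = (1 :: real)"
  by (simp add: abs_p_def mem_Zp_units_iff)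

locale principal_series = psi_conductor_zero prime_type \<psi>
  for prime_type :: "'p::prime_card itself" and \<psi> :: "'p qp \<Rightarrow> complex" +
  fixes \<mu> \<eta> :: "'p qp \<Rightarrow> complex" and n :: nat
  assumes mu_character: "multiplicative_character \<mu>" and mu_conductor: "conductor_exponent \<mu> = n"
    and n_gt_1: "n > 1" and eta_cases: "\<eta> = trivial_char \<or> \<eta> = legendre_char"
    and mu_eta: "\<mu> (- 1) = \<eta> (- 1)"
begin

section \<open>The two characters on units\<close>

lemma mu_mult: "x \<noteq> 0 \<Longrightarrow> y \<noteq> 0 \<Longrightarrow> \<mu> (x * y) = \<mu> x * \<mu> y"
  using mu_character by (auto simp: multiplicative_character_def)

lemma mu_near_1:
  assumes "u - 1 \<in> pZp (int n)" shows "\<mu> u = 1"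
proof -
  have "\<forall>u\<in>unit_filtration n. \<mu> u = 1"
    using LeastI_ex[OF multiplicative_character_trivial[OF mu_character]]
    unfolding mu_conductor[symmetric] conductor_exponent_def .
  then show ?thesis using assms n_gt_1 by (simp add: unit_filtration_def)
qed

lemma mu_nontrivial:
  assumes "0 < r" "r < n" obtains u where "u - 1 \<in> pZp (int r)" "\<mu> u \<noteq> 1"
proof -
  have "\<not> (\<forall>u\<in>unit_filtration r. \<mu> u = 1)"
    using not_less_Least[of r "\<lambda>m. \<forall>u\<in>unit_filtration m. \<mu> u = 1"] assms(2)
    unfolding mu_conductor[symmetric] conductor_exponent_def .
  then show thesis using assms(1) that by (auto simp: unit_filtration_def)
qed

lemma eta_mult: "u \<in> Zp_units \<Longrightarrow> v \<in> Zp_units \<Longrightarrow> \<eta> (u * v) = \<eta> u * \<eta> v"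
  using eta_cases by (auto simp: trivial_char_def legendre_char_eq_chi chi_mult Zp_units_def)

lemma eta_cong: "u \<in> Zp \<Longrightarrow> v - u \<in> pZp 1 \<Longrightarrow> \<eta> v = \<eta> u"
  using eta_cases chi_cong[of u v] by (auto simp: trivial_char_def legendre_char_eq_chi)

lemma eta_1: "\<eta> 1 = 1"
  using eta_cases by (auto simp: trivial_char_def legendre_char_eq_chi chi_1)

lemma eta_near_1: "u - 1 \<in> pZp 1 \<Longrightarrow> \<eta> u = 1"
  using eta_cong[of 1 u] by (simp add: Zp_closed eta_1)

lemma eta_square: "u \<in> Zp_units \<Longrightarrow> \<eta> u * \<eta> u = 1"
  using eta_cases chi_unit_cases[of u] by (auto simp: trivial_char_def legendre_char_eq_chi)

lemma eta_nonzero: "u \<in> Zp_units \<Longrightarrow> \<eta> u \<noteq> 0"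
  using eta_square[of u] by auto

lemma conductor_eta: "conductor_exponent \<eta> \<le> 1"
  unfolding conductor_exponent_def
  by (rule Least_le) (simp add: unit_filtration_def eta_near_1)

text \<open>Since 2 is a unit, \<open>p\<close> does not divide both \<open>u - 1\<close> and
  \<open>u + 1\<close>, so \<open>u\<close> or \<open>- u\<close> is 1 modulo \<open>p ^ n\<close>.
  In the second case the values at -1 decide.\<close>

lemma mu_eq_eta:
  assumes u: "u \<in> Zp_units" and sq: "u * u - 1 \<in> pZp (int n)"
  shows "\<mu> u = \<eta> u"
proof -
  have uZ: "u \<in> Zp" using u by (simp add: Zp_units_def)
  have fac: "(u - 1) * (u + 1) \<in> pZp (int n)" using sq by (simp add: algebra_simps)
  have n1: "x \<in> pZp (int n) \<Longrightarrow> x \<in> pZp 1" for x :: "'p qp"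
    using n_gt_1 by (rule_tac pZp_le[of 1 "int n"]) simp_all
  show ?thesis
  proof (cases "u + 1 \<in> Zp_units")
    case True
    then have "u - 1 \<in> pZp (int n)"
      using fac unit_mult_mem_pZp_iff[OF True, of "u - 1"] by (simp add: mult.commute)
    then show ?thesis using n1 by (simp add: mu_near_1 eta_near_1)
  next
    case False
    then have "u + 1 \<in> pZp 1" using uZ unit_iff_not_mem_pZp Zp_closed by blast
    moreover have "u - 1 \<in> Zp_units"
    proof (rule ccontr)
      assume "u - 1 \<notin> Zp_units"
      then have "u - 1 \<in> pZp 1" using uZ unit_iff_not_mem_pZp Zp_diff Zp_closed(2) by blast
      then have "(u + 1) - (u - 1) \<in> pZp 1" using \<open>u + 1 \<in> pZp 1\<close> by (rule pZp_diff[rotated])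
      then show False using two_unit unit_iff_not_mem_pZp[of "2 :: 'p qp"] by (simp add: Zp_units_def)
    qed
    then have "u + 1 \<in> pZp (int n)" using fac unit_mult_mem_pZp_iff by blast
    then have m: "- u - 1 \<in> pZp (int n)" using pZp_uminus[of "u + 1"] by simp
    have mu: "\<mu> u = \<mu> (- 1) * \<mu> (- u)" using mu_mult[of "- 1" "- u"] u by (simp add: Zp_units_def)
    have "- u \<in> Zp_units" using u by (simp add: mem_Zp_units_iff ord_p_uminus)
    then have "\<eta> u = \<eta> (- 1) * \<eta> (- u)" using eta_mult[OF minus_one_unit, of "- u"] by simp
    then show ?thesis using mu mu_near_1[OF m] eta_near_1[OF n1[OF m]] mu_eta by simp
  qed
qed

section \<open>Level subgroups, the Borel subgroup and their characters\<close>

lemma K_level_iff: "(k :: 'p mp) \<in> full_preimage (K_level m) \<longleftrightarrow>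
    integral_sl2 (mp_proj k) \<and> entry (mp_proj k) 2 1 \<in> pZp (int m)"
  by (simp add: full_preimage_def K_level_def integral_sl2_def)

lemma K_levelD:
  assumes "(k :: 'p mp) \<in> full_preimage (K_level m)"
  shows "integral_sl2 (mp_proj k)" "entry (mp_proj k) i j \<in> Zp" "entry (mp_proj k) 2 1 \<in> pZp (int m)"
  using assms integral_sl2_entry by (auto simp: K_level_iff)

lemma K_level_unit:
  assumes "(k :: 'p mp) \<in> full_preimage (K_level m)" "0 < m"
  shows "entry (mp_proj k) 2 2 \<in> Zp_units"
  using lower_right_unit[OF K_levelD(1)[OF assms(1)]] pZp_le[OF _ K_levelD(3)[OF assms(1)], of 1] assms(2)
  by simp

lemma K_level_mult:
  "(k :: 'p mp) \<in> full_preimage (K_level m) \<Longrightarrow> l \<in> full_preimage (K_level m) \<Longrightarrow> k * l \<in> full_preimage (K_level m)"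
  by (auto simp: K_level_iff mp_proj_times integral_sl2_mult entry_mult mult.commute[of _ "entry (mp_proj l) 2 1"]
      intro!: pZp_add pZp_mult_Zp integral_sl2_entry)

lemma K_level_inv: "(k :: 'p mp) \<in> full_preimage (K_level m) \<Longrightarrow> mp_inv k \<in> full_preimage (K_level m)"
  by (simp add: K_level_iff mp_inv_simps integral_sl2_inv entry_sl2_inv pZp_uminus)

lemma K_level_one: "(mp_lift 1 :: 'p mp) \<in> full_preimage (K_level m)"
  by (simp add: K_level_iff mp_lift_simps integral_sl2_iff entry_1 Zp_closed zero_in_pZp)

text \<open>For positive level the lower left entries are divisible by \<open>p\<close>, so lower
  right entries multiply modulo \<open>p\<close>; the signs multiply because the cover splits over
  integral matrices.\<close>

lemma eta_cover_mult:
  assumes k: "k \<in> full_preimage (K_level m)" and l: "l \<in> full_preimage (K_level m)" and m: "0 < m"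
  shows "eta_cover \<eta> (k * l) = eta_cover \<eta> k * eta_cover \<eta> l"
proof -
  let ?d = "entry (mp_proj k) 2 2" and ?d' = "entry (mp_proj l) 2 2"
  have "entry (mp_proj (k * l)) 2 2 - ?d * ?d' = entry (mp_proj k) 2 1 * entry (mp_proj l) 1 2"
    by (simp add: mp_proj_times entry_mult)
  also have "\<dots> \<in> pZp 1"
    using K_levelD[OF k] K_levelD[OF l] m by (intro pZp_mult_Zp pZp_le[of 1 "int m"]) auto
  finally have "\<eta> (entry (mp_proj (k * l)) 2 2) = \<eta> (?d * ?d')"
    by (rule eta_cong[rotated]) (intro Zp_closed K_levelD[OF k] K_levelD[OF l])
  then show ?thesis
    using eta_mult[OF K_level_unit[OF k m] K_level_unit[OF l m]]
      mp_sign_times_integral[OF K_levelD(1)[OF k] K_levelD(1)[OF l]]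
    by (simp add: eta_cover_def)
qed

lemma Borel_iff: "b \<in> Borel \<longleftrightarrow> entry (mp_proj b) 2 1 = 0"
  by (simp add: Borel_def full_preimage_def)

lemma Borel_diag: "b \<in> Borel \<Longrightarrow> entry (mp_proj b) 1 1 * entry (mp_proj b) 2 2 = 1"
  using entry_det[of "mp_proj b"] by (simp add: Borel_iff)

lemma Borel_mult: "b \<in> Borel \<Longrightarrow> c \<in> Borel \<Longrightarrow> b * c \<in> (Borel :: 'p mp set)"
  by (simp add: Borel_iff mp_proj_times entry_mult)

lemma Borel_inv: "b \<in> Borel \<Longrightarrow> mp_inv b \<in> Borel"
  by (simp add: Borel_iff mp_inv_simps entry_sl2_inv)

lemma Borel_one: "mp_lift 1 \<in> (Borel :: 'p mp set)"
  by (simp add: Borel_iff mp_lift_simps entry_1)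

text \<open>On the Borel subgroup the cocycle is the Hilbert symbol of the upper left entries, and
  the same symbol measures the failure of the Weil ratio to be multiplicative.\<close>

lemma mu_B_mult:
  assumes b: "b \<in> Borel" and c: "c \<in> Borel"
  shows "mu_B \<psi> \<mu> (b * c) = mu_B \<psi> \<mu> b * mu_B \<psi> \<mu> c"
proof -
  define a a' where "a = entry (mp_proj b) 1 1" and "a' = entry (mp_proj c) 1 1"
  define d d' where "d = entry (mp_proj b) 2 2" and "d' = entry (mp_proj c) 2 2"
  have ad: "a * d = 1" "a' * d' = 1" using Borel_diag[OF b] Borel_diag[OF c] by (simp_all add: a_def a'_def d_def d'_def)
  then have nz: "a \<noteq> 0" "a' \<noteq> 0" "d \<noteq> 0" "d' \<noteq> 0" by auto
  have e11: "entry (mp_proj (b * c)) 1 1 = a * a'"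
    using c by (simp add: mp_proj_times entry_mult Borel_iff a_def a'_def)
  have tau: "kubota_tau (mp_proj b) = d" "kubota_tau (mp_proj c) = d'"
    "kubota_tau (mp_proj b * mp_proj c) = d * d'"
    using b c by (simp_all add: kubota_tau_def Borel_iff entry_mult d_def d'_def)
  have s: "s_sign (mp_proj b) = False" "s_sign (mp_proj c) = False" "s_sign (mp_proj b * mp_proj c) = False"
    using b c by (simp_all add: s_sign_def Borel_iff entry_mult)
  have "d = inverse a" "d' = inverse a'" using inverse_unique[OF ad(1)] inverse_unique[OF ad(2)] by simp_all
  then have par: "oddord d = oddord a" "nonres d = nonres a" "oddord d' = oddord a'" "nonres d' = nonres a'"
    using nz by (simp_all add: oddord_inverse nonres_inverse)
  have "cocycle (mp_proj b) (mp_proj c) = sgnb (hpair (d * d' * d) (d * d' * d'))"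
    unfolding cocycle_eq by (simp only: s tau tau_cocycle_def tau_pair_def xor2_ring)
  also have "hpair (d * d' * d) (d * d' * d') = hpair a a'"
    by (simp only: symbol_ring nz par)
  finally have "mp_sign (b * c) = mp_sign b * mp_sign c * sgnb (hpair a a')"
    by (simp add: mp_sign_times)
  moreover have "inverse (weil_ratio a \<psi>) * inverse (weil_ratio a' \<psi>) =
      of_int (sgnb (hpair a a')) * inverse (weil_ratio (a * a') \<psi>)"
    using weil_ratio_mult[OF nz(1,2)] by (simp add: sgnb_def flip: inverse_mult_distrib)
  ultimately show ?thesis
    unfolding mu_B_def Let_def e11 a_def[symmetric] a'_def[symmetric]
    by (simp add: abs_p_mult mu_mult nz)
qed

lemma mu_B_unit:
  assumes "entry (mp_proj b) 1 1 \<in> Zp_units"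
  shows "mu_B \<psi> \<mu> b = of_int (mp_sign b) * \<mu> (entry (mp_proj b) 1 1)"
  using assms by (simp add: mu_B_def Let_def abs_p_unit weil_ratio_unit)

section \<open>Equivariance implies local constancy\<close>

lemma V_etaD:
  assumes "f \<in> V_eta \<psi> \<mu> \<eta> m"
  shows "b \<in> Borel \<Longrightarrow> f (b * g) = mu_B \<psi> \<mu> b * f g"
    "k \<in> full_preimage (K_level m) \<Longrightarrow> f (g * k) = f g * eta_cover \<eta> k"
  using assms by (auto simp: V_eta_def V_def)

lemma principal_congruence_entries:
  assumes "k \<in> principal_congruence m"
  shows "entry k 1 1 - 1 \<in> pZp (int m)" "entry k 1 2 \<in> pZp (int m)"
    "entry k 2 1 \<in> pZp (int m)" "entry k 2 2 - 1 \<in> pZp (int m)" "integral_sl2 (k :: 'p sl2)"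
proof -
  show c: "entry k 1 1 - 1 \<in> pZp (int m)" "entry k 1 2 \<in> pZp (int m)"
    "entry k 2 1 \<in> pZp (int m)" "entry k 2 2 - 1 \<in> pZp (int m)"
    using assms by (auto simp: principal_congruence_def mat_def forall_2)
  have "y \<in> Zp" if "y \<in> pZp (int m)" for y :: "'p qp" using pZp_imp_Zp[OF _ that] by simp
  moreover from this have "y \<in> Zp" if "y - 1 \<in> pZp (int m)" for y :: "'p qp"
    using Zp_closed(4)[of "y - 1" 1] that by (simp add: Zp_closed)
  ultimately show "integral_sl2 k" using c by (simp add: integral_sl2_iff)
qed

lemma principal_congruence_mult:
  fixes k l :: "'p sl2"
  assumes "k \<in> principal_congruence m" "l \<in> principal_congruence m"
  shows "k * l \<in> principal_congruence m"
proof -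
  note ck = principal_congruence_entries(1-4)[OF assms(1)] and cl = principal_congruence_entries(1-4)[OF assms(2)]
  note Z = integral_sl2_entry[OF principal_congruence_entries(5)]
  have "entry k 1 1 * entry l 1 1 - 1 = (entry k 1 1 - 1) * entry l 1 1 + (entry l 1 1 - 1)"
    "entry k 2 2 * entry l 2 2 - 1 = (entry k 2 2 - 1) * entry l 2 2 + (entry l 2 2 - 1)"
    by (simp_all add: algebra_simps)
  moreover have "(entry k 1 1 - 1) * entry l 1 1 + (entry l 1 1 - 1) + entry k 1 2 * entry l 2 1 \<in> pZp (int m)"
    "(entry k 2 2 - 1) * entry l 2 2 + (entry l 2 2 - 1) + entry k 2 1 * entry l 1 2 \<in> pZp (int m)"
    "entry l 1 2 * entry k 1 1 + entry k 1 2 * entry l 2 2 \<in> pZp (int m)"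
    "entry k 2 1 * entry l 1 1 + entry l 2 1 * entry k 2 2 \<in> pZp (int m)"
    by (intro pZp_add pZp_mult_Zp ck cl Z[OF assms(1)] Z[OF assms(2)])+
  ultimately show ?thesis
    by (simp add: principal_congruence_def mat_def forall_2 entry_mult mult.commute add.commute
        add_diff_eq diff_add_eq)
qed

text \<open>Level \<open>Suc m\<close> rather than \<open>m\<close> makes the lower right entries 1
  modulo \<open>p\<close> also for \<open>m = 0\<close>; then \<open>eta_cover\<close> is 1 and
  \<open>f\<close> is constant on open cosets.\<close>

lemma locally_constantI:
  fixes f :: "'p mp \<Rightarrow> complex"
  assumes "\<And>g k. k \<in> full_preimage (K_level m) \<Longrightarrow> f (g * k) = f g * eta_cover \<eta> k"
  shows "locally_constant f"
  unfolding locally_constant_def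
proof
  fix g :: "'p mp"
  let ?P = "principal_congruence (Suc m) :: 'p sl2 set"
  let ?U = "(\<lambda>k. g * mp_lift k) ` ?P"
  have one: "(1 :: 'p sl2) \<in> ?P"
    by (simp add: principal_congruence_def one_sl2.rep_eq zero_in_pZp)
  have "open ?U"
    unfolding open_mp_def
  proof (intro ballI exI)
    fix x k assume x: "x \<in> ?U" and k: "k \<in> ?P"
    then obtain l where l: "l \<in> ?P" "x = g * mp_lift l" by auto
    have "x * mp_lift k = g * mp_lift (l * k)"
      using l k by (simp add: mp.assoc mp_lift_mult principal_congruence_entries(5))
    then show "x * mp_lift k \<in> ?U" using principal_congruence_mult[OF l(1) k] by blast
  qed
  moreover have "g \<in> ?U"
    using image_eqI[OF _ one, of g "\<lambda>k. g * mp_lift k"] by (simp add: mp.right_neutral)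
  moreover have "f y = f g" if y: "y \<in> ?U" for y
  proof -
    obtain k where k: "k \<in> ?P" "y = g * mp_lift k" using y by auto
    have c: "entry k 2 1 \<in> pZp (int (Suc m))" "entry k 2 2 - 1 \<in> pZp (int (Suc m))"
      using principal_congruence_entries[OF k(1)] by simp_all
    have "mp_lift k \<in> full_preimage (K_level m)"
      using principal_congruence_entries(5)[OF k(1)] pZp_le[OF _ c(1), of "int m"]
      by (simp add: K_level_iff mp_lift_simps)
    moreover have "eta_cover \<eta> (mp_lift k) = 1"
      using pZp_le[OF _ c(2), of 1] by (simp add: eta_cover_def mp_lift_simps eta_near_1)
    ultimately show ?thesis using assms k(2) by simp
  qed
  ultimately show "\<exists>U. open U \<and> g \<in> U \<and> (\<forall>y\<in>U. f y = f g)" by blast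
qed

lemma V_etaI:
  assumes "\<And>b g. b \<in> Borel \<Longrightarrow> f (b * g) = mu_B \<psi> \<mu> b * f g"
    "\<And>g k. k \<in> full_preimage (K_level m) \<Longrightarrow> f (g * k) = f g * eta_cover \<eta> k"
  shows "f \<in> V_eta \<psi> \<mu> \<eta> m"
  using assms locally_constantI[of m f] by (auto simp: V_eta_def V_def)

lemma V_eta_subspace: "fun_space.subspace (V_eta \<psi> \<mu> \<eta> m)"
  unfolding fun_space.subspace_def
  by (auto intro!: V_etaI simp: V_etaD algebra_simps)

section \<open>Supports of equivariant functions\<close>

abbreviation Y :: "'p qp \<Rightarrow> 'p mp" where
  "Y s \<equiv> mp_lift (lower_unip s)"

lemma integral_lower_unip: "s \<in> Zp \<Longrightarrow> integral_sl2 (lower_unip s :: 'p sl2)"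
  by (simp add: integral_sl2_iff entry_lower_unip Zp_closed)

lemma Y_neg: "s \<in> Zp \<Longrightarrow> Y (- s) * Y s = mp_lift 1"
proof -
  assume s: "s \<in> Zp"
  have "lower_unip (- s) * lower_unip s = (1 :: 'p sl2)"
    by (rule sl2_eqI) (simp_all add: entry_mult entry_lower_unip entry_1)
  then show ?thesis using s by (simp add: mp_lift_mult integral_lower_unip Zp_closed)
qed

lemma V_eta_eq_0I:
  assumes f: "f \<in> V_eta \<psi> \<mu> \<eta> m"
    and small: "\<And>s. s \<in> pZp 1 \<Longrightarrow> f (Y s) = 0" and one: "f (Y 1) = 0"
  shows "f g = 0"
proof -
  let ?c = "entry (mp_proj g) 2 1" and ?d = "entry (mp_proj g) 2 2"
  show ?thesis
  proof (cases "?d \<noteq> 0 \<and> ?c / ?d \<in> pZp 1")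
    case True
    define s where "s = ?c / ?d"
    have s: "s \<in> Zp" using True pZp_imp_Zp[of 1 s] by (simp add: s_def)
    have "g * Y (- s) \<in> Borel"
      using True by (simp add: Borel_iff mp_proj_times mp_lift_simps entry_mult entry_lower_unip s_def)
    then have "f (g * Y (- s) * Y s) = mu_B \<psi> \<mu> (g * Y (- s)) * f (Y s)"
      by (rule V_etaD(1)[OF f])
    then show ?thesis using small[of s] True Y_neg[OF s] by (simp add: mp.assoc s_def mp.right_neutral)
  next
    case False
    have c: "?c \<noteq> 0" using False entry_det[of "mp_proj g"] by (auto simp: zero_in_pZp)
    define r where "r = ?d / ?c"
    have r: "r \<in> Zp"
    proof (cases "?d = 0")
      case True
      then show ?thesis by (simp add: r_def Zp_closed)
    next
      case d: False
      then show ?thesis using False c by (auto simp: r_def mem_pZp_iff mem_Zp_iff ord_p_divide)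
    qed
    \<comment> \<open>The lower row of \<open>g\<close> is \<open>c\<close> times
      \<open>(1, r)\<close>; right multiplication by \<open>x\<close> makes it \<open>c\<close>
      times \<open>(1, 1)\<close>, which is the shape of an element of the Borel subgroup times
      \<open>y(1)\<close>.\<close>
    define x where "x = mk_sl2 1 (1 - r) 0 (1 :: 'p qp)"
    have x: "entry x 1 1 = 1" "entry x 1 2 = 1 - r" "entry x 2 1 = 0" "entry x 2 2 = 1"
      by (simp_all add: x_def entry_mk_sl2)
    have xK: "mp_lift x \<in> full_preimage (K_level m)"
      by (simp add: K_level_iff mp_lift_simps integral_sl2_iff x Zp_closed Zp_diff r zero_in_pZp)
    have "g * mp_lift x * Y (- 1) \<in> Borel"
      using c by (simp add: Borel_iff mp_proj_times mp_lift_simps entry_mult entry_lower_unip x r_def field_simps)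
    then have "f (g * mp_lift x * Y (- 1) * Y 1) = mu_B \<psi> \<mu> (g * mp_lift x * Y (- 1)) * f (Y 1)"
      by (rule V_etaD(1)[OF f])
    then have "f (g * mp_lift x) = 0"
      using one Y_neg[OF Zp_closed(2)] by (simp add: mp.assoc mp.right_neutral)
    then show ?thesis
      using V_etaD(2)[OF f xK, of g] by (simp add: eta_cover_def mp_lift_simps x eta_1)
  qed
qed

text \<open>The matrix with rows \<open>(a, e)\<close> and \<open>(0, 1 / a)\<close> and its conjugate by \<open>y(s)\<close>, which lies in
  \<open>K_level m\<close>, act on the value at \<open>y(s)\<close> by \<open>\<mu> a\<close> and by 1.\<close>

lemma V_eta_stabiliser:
  assumes f: "f \<in> V_eta \<psi> \<mu> \<eta> m" and a: "a - 1 \<in> pZp 1" and s: "s \<in> Zp" and e: "e \<in> Zp"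
    and es: "e * s \<in> pZp 1" and m: "s * (1 / a - a - e * s) \<in> pZp (int m)"
  shows "f (Y s) = 0 \<or> \<mu> a = 1"
proof -
  have au: "a \<in> Zp_units" using a by (rule one_plus_pZp_unit) simp
  then have a0: "a \<noteq> 0" and aZ: "a \<in> Zp" "1 / a \<in> Zp" by (simp_all add: Zp_units_def divide_inverse)
  define b where "b = mk_sl2 a e 0 (1 / a)"
  define k where "k = mk_sl2 (a + e * s) e (s * (1 / a - a - e * s)) (1 / a - e * s)"
  have b: "entry b 1 1 = a" "entry b 1 2 = e" "entry b 2 1 = 0" "entry b 2 2 = 1 / a"
    using a0 unfolding b_def by (auto intro!: entry_mk_sl2)
  have "(a + e * s) * (1 / a - e * s) - e * (s * (1 / a - a - e * s)) = 1"
    using a0 by (simp add: field_simps)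
  from entry_mk_sl2[OF this]
  have k: "entry k 1 1 = a + e * s" "entry k 1 2 = e"
    "entry k 2 1 = s * (1 / a - a - e * s)" "entry k 2 2 = 1 / a - e * s"
    unfolding k_def .
  have bI: "integral_sl2 b" by (simp add: integral_sl2_iff b aZ e Zp_closed)
  have kI: "integral_sl2 k" using aZ e s by (simp add: integral_sl2_iff k Zp_closed Zp_diff)
  have "b * lower_unip s = lower_unip s * k"
    by (rule sl2_eqI) (simp_all add: entry_mult entry_lower_unip b k algebra_simps)
  then have "mp_lift b * Y s = Y s * mp_lift k"
    using bI kI integral_lower_unip[OF s] by (simp add: mp_lift_mult)
  moreover have "f (mp_lift b * Y s) = \<mu> a * f (Y s)"
    using V_etaD(1)[OF f, of "mp_lift b" "Y s"] au
    by (simp add: Borel_iff mp_lift_simps b mu_B_unit)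
  moreover have "mp_lift k \<in> full_preimage (K_level m)"
    using kI m by (simp add: K_level_iff mp_lift_simps k)
  then have "f (Y s * mp_lift k) = f (Y s) * \<eta> (1 / a - e * s)"
    using V_etaD(2)[OF f, of "mp_lift k" "Y s"] by (simp add: eta_cover_def mp_lift_simps k)
  moreover have "\<eta> (1 / a - e * s) = 1"
  proof -
    have "a * (1 / a - 1) = - (a - 1)" using a0 by (simp add: field_simps)
    then have "1 / a - 1 \<in> pZp 1"
      using a unit_mult_mem_pZp_iff[OF au, of "1 / a - 1" 1] pZp_uminus[of "a - 1" 1] by simp
    then have "(1 / a - 1) - e * s \<in> pZp 1" using es by (rule pZp_diff)
    then show ?thesis by (intro eta_near_1) (simp add: algebra_simps)
  qed
  ultimately have "\<mu> a * f (Y s) = f (Y s)" by simp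
  then show ?thesis by auto
qed

lemma inverse_minus_self_mem:
  assumes "a - 1 \<in> pZp k" "1 \<le> k" shows "1 / a - a \<in> (pZp k :: 'p qp set)"
proof -
  have au: "a \<in> Zp_units" using assms by (rule one_plus_pZp_unit)
  then have a: "a \<noteq> 0" "a \<in> Zp" by (simp_all add: Zp_units_def)
  have "a * (1 / a - a) = - ((a - 1) * (a + 1))" using a by (simp add: field_simps)
  also have "\<dots> \<in> pZp k" unfolding pZp_uminus using assms(1) a by (intro pZp_mult_Zp Zp_closed)
  finally show ?thesis using unit_mult_mem_pZp_iff[OF au] by blast
qed

text \<open>For \<open>s = 1\<close> the choice \<open>e = 1 / a - a\<close> makes the lower left
  entry of the conjugate vanish, hence works at every level \<open>m\<close>.\<close>

lemma V_eta_Y_one: 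
  assumes "f \<in> V_eta \<psi> \<mu> \<eta> m" shows "f (Y 1) = 0"
proof -
  obtain a where a: "a - 1 \<in> pZp (int 1)" "\<mu> a \<noteq> 1" using mu_nontrivial[of 1] n_gt_1 by auto
  have a': "1 / a - a \<in> pZp 1" using a(1) by (intro inverse_minus_self_mem) simp_all
  then have "1 / a - a \<in> Zp" by (rule pZp_imp_Zp[rotated]) simp
  then show ?thesis
    using V_eta_stabiliser[OF assms, of a 1 "1 / a - a"] a a' by (simp add: Zp_closed zero_in_pZp)
qed

lemma V_eta_Y_support:
  assumes f: "f \<in> V_eta \<psi> \<mu> \<eta> m" and s: "s \<in> pZp 1" and nz: "f (Y s) \<noteq> 0"
  shows "s \<noteq> 0" "int n \<le> ord_p s" "ord_p s \<le> int m - int n"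
proof -
  have sZ: "s \<in> Zp" using s by (rule pZp_imp_Zp[rotated]) simp
  have trivial: "\<mu> a = 1" if "a - 1 \<in> pZp 1" "s * (1 / a - a) \<in> pZp (int m)" for a
    using V_eta_stabiliser[OF f that(1) sZ, of 0] that(2) nz by (simp add: Zp_closed zero_in_pZp)
  have ms: "s \<notin> pZp (int m)"
  proof
    \<comment> \<open>Then \<open>e = 0\<close> is admissible for every \<open>a\<close> in
      \<open>1 + p Zp\<close>, which contradicts the conductor being larger than 1.\<close>
    assume sm: "s \<in> pZp (int m)"
    obtain a where a: "a - 1 \<in> pZp (int 1)" "\<mu> a \<noteq> 1" using mu_nontrivial[of 1] n_gt_1 by auto
    have "1 / a - a \<in> pZp 1" using a(1) by (intro inverse_minus_self_mem) simp_all
    then have a': "1 / a - a \<in> Zp" by (rule pZp_imp_Zp[rotated]) simp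
    show False using trivial[of a] a pZp_mult_Zp[OF sm a'] by simp
  qed
  then show s0: "s \<noteq> 0" by (auto simp: zero_in_pZp)
  have v: "1 \<le> ord_p s" "ord_p s < int m" using s ms s0 by (auto simp: mem_pZp_iff)
  show "int n \<le> ord_p s"
  proof (rule ccontr)
    assume "\<not> int n \<le> ord_p s"
    then have "0 < nat (ord_p s)" "nat (ord_p s) < n" using v by linarith+
    then obtain a where a: "a - 1 \<in> pZp (int (nat (ord_p s)))" "\<mu> a \<noteq> 1"
      by (rule mu_nontrivial)
    have a1: "a - 1 \<in> pZp 1" using a(1) v by (intro pZp_le[OF _ a(1)]) simp
    have a': "1 / a - a \<in> pZp (ord_p s)" using a(1) v by (intro inverse_minus_self_mem) simp_all
    have "s * ((1 / a - a) / s) \<in> pZp (ord_p s)" using a' s0 by simp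
    \<comment> \<open>This is the \<open>e\<close> for which the conjugate is upper
      triangular.\<close>
    then have e: "(1 / a - a) / s \<in> Zp" unfolding mult_mem_pZp_iff[OF s0] by (simp add: pZp_0)
    have "(1 / a - a) / s * s = 1 / a - a" using s0 by simp
    moreover have "1 / a - a \<in> pZp 1" using a' v by (intro pZp_le[OF _ a']) simp
    ultimately show False
      using V_eta_stabiliser[OF f a1 sZ e] a(2) nz by (simp add: zero_in_pZp)
  qed
  show "ord_p s \<le> int m - int n"
  proof (rule ccontr)
    assume "\<not> ord_p s \<le> int m - int n"
    then have "0 < nat (int m - ord_p s)" "nat (int m - ord_p s) < n" using v by linarith+
    then obtain a where a: "a - 1 \<in> pZp (int (nat (int m - ord_p s)))" "\<mu> a \<noteq> 1"
      by (rule mu_nontrivial)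
    have a1: "a - 1 \<in> pZp 1" using a(1) v by (intro pZp_le[OF _ a(1)]) simp
    have "1 / a - a \<in> pZp (int m - ord_p s)" using a(1) v by (intro inverse_minus_self_mem) simp_all
    then have "s * (1 / a - a) \<in> pZp (int m)" by (simp add: mult_mem_pZp_iff[OF s0])
    then show False using trivial[OF a1] a(2) by simp
  qed
qed

lemma V_eta_trivial:
  assumes "m < 2 * n" shows "V_eta \<psi> \<mu> \<eta> m = {0}"
proof -
  have "f g = 0" if f: "f \<in> V_eta \<psi> \<mu> \<eta> m" for f g
  proof (rule V_eta_eq_0I[OF f])
    fix s :: "'p qp" assume s: "s \<in> pZp 1"
    show "f (Y s) = 0"
      using V_eta_Y_support[OF f s] assms by force
  qed (rule V_eta_Y_one[OF f])
  moreover have "0 \<in> V_eta \<psi> \<mu> \<eta> m"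
    using V_eta_subspace fun_space.subspace_0 by blast
  ultimately show ?thesis by (auto simp: fun_eq_iff)
qed

section \<open>Independence of the factorisation\<close>

lemma pp_power_eq: "(pp ^ n :: 'p qp) = pp powi int n"
  by simp

text \<open>If \<open>b\<close> in the Borel subgroup and \<open>k\<close> in \<open>K_level (2 * n)\<close> satisfy
  \<open>b y(\<kappa> p ^ n) = y(\<kappa>' p ^ n) k\<close>, then the upper left entry \<open>a\<close> of \<open>b\<close> is a unit with
  \<open>\<kappa> \<equiv> \<kappa>' a\<^sup>2\<close> modulo \<open>p\<close>, and \<open>a \<equiv> \<plusminus>1\<close> modulo \<open>p ^ n\<close> if \<open>\<kappa> = \<kappa>'\<close>.\<close>

lemma stabiliser:
  assumes b: "b \<in> Borel" and k: "k \<in> full_preimage (K_level (2 * n))"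
    and \<kappa>: "\<kappa> \<in> Zp_units" "\<kappa>' \<in> Zp_units"
    and eq: "b * Y (\<kappa> * pp ^ n) = Y (\<kappa>' * pp ^ n) * k"
  shows "chi \<kappa> = chi \<kappa>'" "\<kappa> = \<kappa>' \<Longrightarrow> mu_B \<psi> \<mu> b = eta_cover \<eta> k"
proof -
  define P where "P = (pp ^ n :: 'p qp)"
  have P: "P \<noteq> 0" "ord_p P = int n" "P \<in> pZp (int n)"
    unfolding P_def pp_power_eq by (simp_all only: mem_pZp_iff ord_p_pp_powi pp_powi_nonzero not_False_eq_True order.refl simp_thms)
  define s s' where "s = \<kappa> * P" and "s' = \<kappa>' * P"
  have \<kappa>Z: "\<kappa> \<in> Zp" "\<kappa>' \<in> Zp" using \<kappa> by (simp_all add: Zp_units_def)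
  have sn: "s \<in> pZp (int n)" "s' \<in> pZp (int n)"
    using pZp_mult_Zp[OF P(3) \<kappa>Z(1)] pZp_mult_Zp[OF P(3) \<kappa>Z(2)] by (simp_all add: s_def s'_def mult.commute)
  then have sZ: "s \<in> Zp" "s' \<in> Zp" using pZp_imp_Zp[of "int n"] by simp_all
  have n1: "x \<in> pZp (int n) \<Longrightarrow> x \<in> pZp 1" for x :: "'p qp"
    using n_gt_1 by (rule_tac pZp_le[of 1 "int n"]) simp_all
  define a e d where "a = entry (mp_proj b) 1 1" and "e = entry (mp_proj b) 1 2" and "d = entry (mp_proj b) 2 2"
  define A B C D where "A = entry (mp_proj k) 1 1" and "B = entry (mp_proj k) 1 2"
    and "C = entry (mp_proj k) 2 1" and "D = entry (mp_proj k) 2 2"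
  have b21: "entry (mp_proj b) 2 1 = 0" using b by (simp add: Borel_iff)
  have ad: "a * d = 1" using Borel_diag[OF b] by (simp add: a_def d_def)
  have kZ: "A \<in> Zp" "B \<in> Zp" "C \<in> Zp" "D \<in> Zp" using K_levelD(2)[OF k] by (simp_all add: A_def B_def C_def D_def)
  have CP: "C \<in> pZp (int n + int n)" using K_levelD(3)[OF k] by (simp add: C_def flip: mult_2)
  have proj: "mp_proj b * lower_unip s = lower_unip s' * mp_proj k"
    using arg_cong[OF eq, of mp_proj] by (simp add: mp_proj_times mp_lift_simps s_def s'_def P_def)
  have "a + e * s = A" "e = B" "d * s = s' * A + C" "d = s' * B + D"
    using arg_cong[OF proj, of "\<lambda>g. entry g 1 1"] arg_cong[OF proj, of "\<lambda>g. entry g 1 2"]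
      arg_cong[OF proj, of "\<lambda>g. entry g 2 1"] arg_cong[OF proj, of "\<lambda>g. entry g 2 2"] b21
    by (simp_all add: entry_mult entry_lower_unip a_def e_def d_def A_def B_def C_def D_def)
  then have rel: "A = a + e * s" "e \<in> Zp" "d * s = s' * A + C" "d = s' * e + D" using kZ by auto
  have dZ: "d \<in> Zp" unfolding rel(4) using sZ kZ rel(2) by (intro Zp_closed)
  have "a = A - e * s" using rel(1) by simp
  then have aZ: "a \<in> Zp" using Zp_diff[OF kZ(1) Zp_closed(5)[OF rel(2) sZ(1)]] by simp
  have d: "d = inverse a" using inverse_unique[OF ad] by simp
  have au: "a \<in> Zp_units" using ad aZ dZ d by (auto simp: Zp_units_def)
  have a0: "a \<noteq> 0" using au by (simp add: Zp_units_def)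
  \<comment> \<open>Level \<open>2 * n\<close> enters here: both terms on the right are divisible by
    \<open>p ^ (2 * n)\<close>, so cancelling \<open>P\<close> leaves a congruence modulo
    \<open>p ^ n\<close>.\<close>
  have "P * (d * \<kappa> - \<kappa>' * a) = C + s' * (e * s)"
    using rel(1,3) by (simp add: s_def s'_def algebra_simps)
  also have "\<dots> \<in> pZp (int n + int n)"
    using CP pZp_mult[OF sn(2) pZp_mult_Zp[OF sn(1) rel(2)]] by (intro pZp_add) (simp_all add: mult.commute)
  finally have main: "d * \<kappa> - \<kappa>' * a \<in> pZp (int n)"
    by (simp add: mult_mem_pZp_iff[OF P(1)] P(2))
  have "a * (d * \<kappa> - \<kappa>' * a) = (a * d) * \<kappa> - \<kappa>' * a\<^sup>2"
    by (simp add: algebra_simps power2_eq_square)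
  then have "\<kappa> - \<kappa>' * a\<^sup>2 = a * (d * \<kappa> - \<kappa>' * a)" by (simp add: ad)
  then have main': "\<kappa> - \<kappa>' * a\<^sup>2 \<in> pZp (int n)"
    using main unit_mult_mem_pZp_iff[OF au] by metis
  have "chi \<kappa> = chi (\<kappa>' * a\<^sup>2)"
    using n1[OF main'] \<kappa>Z aZ by (intro chi_cong) (auto intro: Zp_closed)
  then show "chi \<kappa> = chi \<kappa>'" using chi_square[OF au] \<kappa>Z aZ by (simp add: chi_mult Zp_closed)
  assume same: "\<kappa> = \<kappa>'"
  have "\<kappa> * (a * a - 1) \<in> pZp (int n)"
    using main' pZp_uminus[of "\<kappa> - \<kappa>' * a\<^sup>2"] by (simp add: same algebra_simps power2_eq_square)
  then have "a * a - 1 \<in> pZp (int n)" using unit_mult_mem_pZp_iff[OF \<kappa>(1)] by blast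
  then have "\<mu> a = \<eta> a" by (rule mu_eq_eta[OF au])
  moreover have "\<eta> D = \<eta> a"
  proof -
    have "d - D = s' * e" using rel(4) by simp
    then have "\<eta> d = \<eta> D" using n1[OF pZp_mult_Zp[OF sn(2) rel(2)]] by (intro eta_cong kZ) simp
    moreover have "\<eta> a * \<eta> d = 1"
      using eta_mult[OF au Zp_units_inverse[OF au]] a0 by (simp add: d eta_1)
    ultimately show ?thesis using eta_square[OF au] eta_nonzero[OF au] by (metis mult_left_cancel)
  qed
  \<comment> \<open>All factors on both sides of the relation are integral, so the cocycle
    contributes no sign.\<close>
  moreover have "mp_sign b = mp_sign k"
  proof -
    have bI: "integral_sl2 (mp_proj b)"
      using aZ rel(2) dZ b21 by (simp add: integral_sl2_iff Zp_closed a_def e_def d_def)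
    have "mp_sign (b * Y s) = mp_sign b" "mp_sign (Y s' * k) = mp_sign k"
      using bI K_levelD(1)[OF k] integral_lower_unip sZ
      by (simp_all add: mp_sign_times_integral mp_lift_simps)
    then show ?thesis using eq by (simp add: s_def s'_def P_def)
  qed
  ultimately show "mu_B \<psi> \<mu> b = eta_cover \<eta> k"
    using mu_B_unit[of b] au by (simp add: eta_cover_def a_def D_def)
qed

text \<open>Moving \<open>b'\<close> to the left side and \<open>k\<close> to the right side gives
  the relation of \<open>stabiliser\<close> for \<open>mp_inv b' * b\<close> and
  \<open>k' * mp_inv k\<close>.\<close>

lemma factorisations:
  assumes b: "b \<in> Borel" "b' \<in> Borel"
    and k: "k \<in> full_preimage (K_level (2 * n))" "k' \<in> full_preimage (K_level (2 * n))"
    and \<kappa>: "\<kappa> \<in> Zp_units" "\<kappa>' \<in> Zp_units"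
    and eq: "b * Y (\<kappa> * pp ^ n) * k = b' * Y (\<kappa>' * pp ^ n) * k'"
  shows "chi \<kappa> = chi \<kappa>'"
    "\<kappa> = \<kappa>' \<Longrightarrow> mu_B \<psi> \<mu> b * eta_cover \<eta> k = mu_B \<psi> \<mu> b' * eta_cover \<eta> k'"
proof -
  define c l where "c = mp_inv b' * b" and "l = k' * mp_inv k"
  have c: "c \<in> Borel" and l: "l \<in> full_preimage (K_level (2 * n))"
    using b k by (simp_all add: c_def l_def Borel_mult Borel_inv K_level_mult K_level_inv)
  have bc: "b = b' * c" and kl: "k' = l * k"
    by (simp_all add: c_def l_def mp.assoc mp.left_inverse) (simp_all add: mp.right_neutral flip: mp.assoc)
  have "b' * (c * Y (\<kappa> * pp ^ n) * k) = b' * (Y (\<kappa>' * pp ^ n) * l * k)"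
    using eq by (simp add: bc kl mp.assoc)
  then have "c * Y (\<kappa> * pp ^ n) * k = Y (\<kappa>' * pp ^ n) * l * k" by (simp only: mp.left_cancel)
  then have "c * Y (\<kappa> * pp ^ n) = Y (\<kappa>' * pp ^ n) * l" by (simp only: mp.right_cancel)
  note st = stabiliser[OF c l \<kappa> this]
  show "chi \<kappa> = chi \<kappa>'" by (rule st(1))
  assume "\<kappa> = \<kappa>'"
  then have "mu_B \<psi> \<mu> c = eta_cover \<eta> l" by (rule st(2))
  then show "mu_B \<psi> \<mu> b * eta_cover \<eta> k = mu_B \<psi> \<mu> b' * eta_cover \<eta> k'"
    using mu_B_mult[OF b(2) c] eta_cover_mult[OF l k(1)] n_gt_1 by (simp add: bc kl)
qed

text \<open>Despite the name, one double coset for the Borel and level subgroups: the one that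
  carries \<open>f_kappa\<close>.\<close>

definition big_cell :: "'p qp \<Rightarrow> 'p mp set" where
  "big_cell \<kappa> = {b * Y (\<kappa> * pp ^ n) * k | b k. b \<in> Borel \<and> k \<in> full_preimage (K_level (2 * n))}"

text \<open>The choice in \<open>f_kappa\<close> may return another factorisation; by
  \<open>factorisations\<close> it yields the same value.\<close>

lemma f_kappa_eq:
  assumes "\<kappa> \<in> Zp_units" "b \<in> Borel" "k \<in> full_preimage (K_level (2 * n))"
  shows "f_kappa \<psi> \<mu> \<eta> n \<kappa> (b * Y (\<kappa> * pp ^ n) * k) = mu_B \<psi> \<mu> b * eta_cover \<eta> k"
proof -
  define fact where "fact = (\<lambda>(b', k'). b' \<in> Borel \<and> k' \<in> full_preimage (K_level (2 * n)) \<and>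
      b * Y (\<kappa> * pp ^ n) * k = b' * Y (\<kappa> * pp ^ n) * k')"
  have "fact (b, k)" using assms by (simp add: fact_def)
  then have ex: "\<exists>bk. fact bk" by blast
  obtain b' k' where bk: "(SOME bk. fact bk) = (b', k')" by fastforce
  have "fact (b', k')" using someI_ex[OF ex] by (simp add: bk)
  then have "mu_B \<psi> \<mu> b * eta_cover \<eta> k = mu_B \<psi> \<mu> b' * eta_cover \<eta> k'"
    using factorisations(2)[OF assms(2) _ assms(3) _ assms(1) assms(1)] by (simp add: fact_def)
  then show ?thesis
    unfolding f_kappa_def Let_def fact_def[symmetric] using ex bk by simp
qed

lemma f_kappa_outside: "g \<notin> big_cell \<kappa> \<Longrightarrow> f_kappa \<psi> \<mu> \<eta> n \<kappa> g = 0"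
  unfolding f_kappa_def Let_def big_cell_def by auto

lemma big_cell_left:
  assumes "b \<in> Borel" "g \<in> big_cell \<kappa>" shows "b * g \<in> big_cell \<kappa>"
  using assms unfolding big_cell_def mem_Collect_eq by (metis Borel_mult mp.assoc)

lemma big_cell_right:
  assumes "l \<in> full_preimage (K_level (2 * n))" "g \<in> big_cell \<kappa>" shows "g * l \<in> big_cell \<kappa>"
  using assms unfolding big_cell_def mem_Collect_eq by (metis K_level_mult mp.assoc)

lemma f_kappa_in_V_eta:
  assumes \<kappa>: "\<kappa> \<in> Zp_units"
  shows "f_kappa \<psi> \<mu> \<eta> n \<kappa> \<in> V_eta \<psi> \<mu> \<eta> (2 * n)"
proof (rule V_etaI)
  let ?f = "f_kappa \<psi> \<mu> \<eta> n \<kappa>"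
  fix b g :: "'p mp" assume b: "b \<in> Borel"
  show "?f (b * g) = mu_B \<psi> \<mu> b * ?f g"
  proof (cases "g \<in> big_cell \<kappa>")
    case True
    then obtain c k where g: "c \<in> Borel" "k \<in> full_preimage (K_level (2 * n))" "g = c * Y (\<kappa> * pp ^ n) * k"
      by (auto simp: big_cell_def)
    have "b * g = (b * c) * Y (\<kappa> * pp ^ n) * k" by (simp add: g(3) mp.assoc)
    then have "?f (b * g) = mu_B \<psi> \<mu> (b * c) * eta_cover \<eta> k"
      using f_kappa_eq[OF \<kappa> Borel_mult[OF b g(1)] g(2)] by simp
    then show ?thesis using f_kappa_eq[OF \<kappa> g(1,2)] mu_B_mult[OF b g(1)] by (simp add: g(3) mult.assoc)
  next
    case False
    have "b * g \<notin> big_cell \<kappa>"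
    proof
      assume "b * g \<in> big_cell \<kappa>"
      then have "mp_inv b * (b * g) \<in> big_cell \<kappa>" using big_cell_left[OF Borel_inv[OF b]] by blast
      then show False using False by (simp add: mp.left_inverse mp.left_neutral flip: mp.assoc)
    qed
    then show ?thesis using False by (simp add: f_kappa_outside)
  qed
next
  let ?f = "f_kappa \<psi> \<mu> \<eta> n \<kappa>"
  have n0: "0 < 2 * n" using n_gt_1 by simp
  fix g l :: "'p mp" assume l: "l \<in> full_preimage (K_level (2 * n))"
  show "?f (g * l) = ?f g * eta_cover \<eta> l"
  proof (cases "g \<in> big_cell \<kappa>")
    case True
    then obtain c k where g: "c \<in> Borel" "k \<in> full_preimage (K_level (2 * n))" "g = c * Y (\<kappa> * pp ^ n) * k"
      by (auto simp: big_cell_def)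
    have "g * l = c * Y (\<kappa> * pp ^ n) * (k * l)" by (simp add: g(3) mp.assoc)
    then have "?f (g * l) = mu_B \<psi> \<mu> c * eta_cover \<eta> (k * l)"
      using f_kappa_eq[OF \<kappa> g(1) K_level_mult[OF g(2) l]] by simp
    then show ?thesis
      using f_kappa_eq[OF \<kappa> g(1,2)] eta_cover_mult[OF g(2) l n0] by (simp add: g(3) mult.assoc)
  next
    case False
    have "g * l \<notin> big_cell \<kappa>"
    proof
      assume "g * l \<in> big_cell \<kappa>"
      then have "g * l * mp_inv l \<in> big_cell \<kappa>" using big_cell_right[OF K_level_inv[OF l]] by blast
      then show False using False by (simp add: mp.assoc mp.right_neutral)
    qed
    then show ?thesis using False by (simp add: f_kappa_outside)
  qed
qed

text \<open>Units in different square classes give disjoint double cosets, so evaluation at the base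
  points separates the functions.\<close>

lemma f_kappa_Y:
  assumes "\<kappa> \<in> Zp_units" "\<kappa>' \<in> Zp_units"
  shows "f_kappa \<psi> \<mu> \<eta> n \<kappa> (Y (\<kappa> * pp ^ n)) = 1"
    "chi \<kappa> \<noteq> chi \<kappa>' \<Longrightarrow> f_kappa \<psi> \<mu> \<eta> n \<kappa> (Y (\<kappa>' * pp ^ n)) = 0"
proof -
  have one: "mu_B \<psi> \<mu> (mp_lift 1) = 1"
    using mu_near_1[of 1] by (simp add: mu_B_unit mp_lift_simps entry_1 one_in_Zp_units zero_in_pZp)
  have "f_kappa \<psi> \<mu> \<eta> n \<kappa> (mp_lift 1 * Y (\<kappa> * pp ^ n) * mp_lift 1) = 1"
    using f_kappa_eq[OF assms(1) Borel_one K_level_one] one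
    by (simp add: eta_cover_def mp_lift_simps entry_1 eta_1)
  then show "f_kappa \<psi> \<mu> \<eta> n \<kappa> (Y (\<kappa> * pp ^ n)) = 1"
    by (simp add: mp.left_neutral mp.right_neutral)
  assume ne: "chi \<kappa> \<noteq> chi \<kappa>'"
  have "Y (\<kappa>' * pp ^ n) \<notin> big_cell \<kappa>"
  proof
    assume "Y (\<kappa>' * pp ^ n) \<in> big_cell \<kappa>"
    then obtain b k where bk: "b \<in> Borel" "k \<in> full_preimage (K_level (2 * n))"
      "Y (\<kappa>' * pp ^ n) = b * Y (\<kappa> * pp ^ n) * k"
      by (auto simp: big_cell_def)
    then have "b * Y (\<kappa> * pp ^ n) * k = mp_lift 1 * Y (\<kappa>' * pp ^ n) * mp_lift 1"
      by (simp add: mp.left_neutral mp.right_neutral)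
    then show False
      using factorisations(1)[OF bk(1) Borel_one bk(2) K_level_one assms] ne by blast
  qed
  then show "f_kappa \<psi> \<mu> \<eta> n \<kappa> (Y (\<kappa>' * pp ^ n)) = 0" by (rule f_kappa_outside)
qed

text \<open>Conjugating \<open>y(s)\<close> by a diagonal matrix with entry \<open>t\<close> gives
  \<open>y(s * t\<^sup>2)\<close>. One diagonal factor is absorbed by equivariance under the Borel
  subgroup, the other by equivariance under the level subgroup.\<close>

lemma V_eta_Y_square_class:
  assumes f: "f \<in> V_eta \<psi> \<mu> \<eta> (2 * n)" and s: "s \<in> Zp" and t: "t \<in> Zp_units" and 0: "f (Y s) = 0"
  shows "f (Y (s * t\<^sup>2)) = 0"
proof -
  have t0: "t \<noteq> 0" and tZ: "t \<in> Zp" "inverse t \<in> Zp" using t by (simp_all add: Zp_units_def)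
  define h where "h = mk_sl2 t 0 0 (inverse t)"
  define h' where "h' = mk_sl2 (inverse t) 0 0 t"
  have h: "entry h 1 1 = t" "entry h 1 2 = 0" "entry h 2 1 = 0" "entry h 2 2 = inverse t"
    using t0 unfolding h_def by (auto intro!: entry_mk_sl2)
  have h': "entry h' 1 1 = inverse t" "entry h' 1 2 = 0" "entry h' 2 1 = 0" "entry h' 2 2 = t"
    using t0 unfolding h'_def by (auto intro!: entry_mk_sl2)
  have I: "integral_sl2 h" "integral_sl2 h'" "integral_sl2 (lower_unip s)"
    using tZ integral_lower_unip[OF s] by (simp_all add: integral_sl2_iff h h' Zp_closed)
  have "lower_unip (s * t\<^sup>2) = h' * (lower_unip s * h)"
    using t0 by (intro sl2_eqI)
      (simp_all add: entry_mult entry_lower_unip h h' power2_eq_square)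
  then have "Y (s * t\<^sup>2) = mp_lift h' * (Y s * mp_lift h)"
    using I by (simp add: mp_lift_mult integral_sl2_mult)
  moreover have "mp_lift h' \<in> Borel" by (simp add: Borel_iff mp_lift_simps h')
  moreover have "mp_lift h \<in> full_preimage (K_level (2 * n))"
    using I by (simp add: K_level_iff mp_lift_simps h zero_in_pZp)
  ultimately show ?thesis using V_etaD[OF f] 0 by simp
qed

section \<open>Dimension and conductor\<close>

context
  fixes lam :: "'p qp"
  assumes lam: "lam \<in> Zp_units" "\<not> (\<exists>x\<in>Zp. lam - x\<^sup>2 \<in> pZp 1)"
begin

lemma chi_lam: "chi lam = - 1"
  using chi_unit[OF lam(1)] lam(2) by simp

lemma V_eta_determined:
  assumes f: "f \<in> V_eta \<psi> \<mu> \<eta> (2 * n)" and 0: "f (Y (1 * pp ^ n)) = 0" "f (Y (lam * pp ^ n)) = 0"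
  shows "f g = 0"
proof (rule V_eta_eq_0I[OF f])
  fix s :: "'p qp" assume s: "s \<in> pZp 1"
  have PZ: "(pp ^ n :: 'p qp) \<in> Zp" by (intro Zp_closed)
  show "f (Y s) = 0"
  proof (rule ccontr)
    assume nz: "f (Y s) \<noteq> 0"
    note supp = V_eta_Y_support[OF f s nz]
    have ord: "ord_p s = int n" using supp(2,3) by simp
    define u where "u = unit_part s"
    have u: "u \<in> Zp_units" unfolding u_def by (rule unit_part_unit[OF supp(1)])
    have su: "s = pp ^ n * u" by (simp add: u_def unit_part_def ord pp_nonzero)
    show False
    proof (cases "chi u = 1")
      case True
      then obtain t where t: "t \<in> Zp_units" "t\<^sup>2 = u" using unit_square[OF u] by blast
      then show False using V_eta_Y_square_class[OF f PZ t(1)] 0(1) nz su by simp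
    next
      case False
      then have "chi u = - 1" using chi_unit_cases[OF u] by blast
      \<comment> \<open>The product of two nonsquare units is a square, whence
        \<open>u = lam * (t / lam)\<^sup>2\<close>.\<close>
      then have "chi (u * lam) = 1" using chi_lam u lam(1) by (simp add: chi_mult Zp_units_def)
      then obtain t where t: "t \<in> Zp_units" "t\<^sup>2 = u * lam"
        using unit_square[OF Zp_units_mult[OF u lam(1)]] by blast
      have lam0: "lam \<noteq> 0" using lam(1) by (simp add: Zp_units_def)
      have "t / lam \<in> Zp_units" using t(1) Zp_units_inverse[OF lam(1)] by (simp add: divide_inverse Zp_units_mult)
      moreover have "lam * pp ^ n * (t / lam)\<^sup>2 = s"
      proof -
        have "lam * pp ^ n * (t / lam)\<^sup>2 = pp ^ n * (t\<^sup>2 / lam)"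
          using lam0 by (simp add: power2_eq_square)
        then show ?thesis using lam0 by (simp add: t(2) su)
      qed
      moreover have "lam * pp ^ n \<in> Zp" using lam(1) PZ by (intro Zp_closed) (simp add: Zp_units_def)
      ultimately show False using V_eta_Y_square_class[OF f] 0(2) nz by metis
    qed
  qed
qed (rule V_eta_Y_one[OF f])

text \<open>The values at \<open>y(p ^ n)\<close> and \<open>y(lam * p ^ n)\<close> are coordinates
  dual to \<open>f1\<close> and \<open>fl\<close>. Subtracting the combination with the same
  coordinates leaves an element that is 0 by \<open>V_eta_determined\<close>, and the same
  coordinates give independence.\<close>

lemma f_kappa_basis:
  defines "f1 \<equiv> f_kappa \<psi> \<mu> \<eta> n 1" and "fl \<equiv> f_kappa \<psi> \<mu> \<eta> n lam"
  shows "V_eta \<psi> \<mu> \<eta> (2 * n) = fun_space.span {f1, fl}"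
    "fun_space.dim (V_eta \<psi> \<mu> \<eta> (2 * n)) = 2"
proof -
  let ?V = "V_eta \<psi> \<mu> \<eta> (2 * n)" and ?y1 = "Y (1 * pp ^ n)" and ?yl = "Y (lam * pp ^ n)"
  have ne: "chi 1 \<noteq> chi lam" by (simp add: chi_1 chi_lam)
  have val: "f1 ?y1 = 1" "f1 ?yl = 0" "fl ?y1 = 0" "fl ?yl = 1"
    unfolding f1_def fl_def
    by (rule f_kappa_Y[OF one_in_Zp_units lam(1)] f_kappa_Y[OF lam(1) one_in_Zp_units] ne ne[symmetric])+
  have mem: "f1 \<in> ?V" "fl \<in> ?V"
    unfolding f1_def fl_def by (rule f_kappa_in_V_eta one_in_Zp_units lam)+
  have "?V \<subseteq> fun_space.span {f1, fl}"
  proof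
    fix f assume f: "f \<in> ?V"
    define g where "g = f - ((\<lambda>x. f ?y1 * f1 x) + (\<lambda>x. f ?yl * fl x))"
    have "g \<in> ?V"
      unfolding g_def using V_eta_subspace[of "2 * n"] f mem
      by (intro fun_space.subspace_diff fun_space.subspace_add fun_space.subspace_scale)
    moreover have "g ?y1 = 0" "g ?yl = 0" by (simp_all only: g_def minus_apply plus_fun_apply val) simp_all
    ultimately have "g x = 0" for x by (rule V_eta_determined)
    then have "g = 0" by (simp add: fun_eq_iff)
    then have "f = (\<lambda>x. f ?y1 * f1 x) + (\<lambda>x. f ?yl * fl x)" by (simp add: g_def)
    also have "\<dots> \<in> fun_space.span {f1, fl}"
      by (intro fun_space.span_add fun_space.span_scale fun_space.span_base) simp_all
    finally show "f \<in> fun_space.span {f1, fl}" .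
  qed
  moreover have "fun_space.span {f1, fl} \<subseteq> ?V"
    using mem V_eta_subspace by (intro fun_space.span_minimal) simp_all
  ultimately show span: "?V = fun_space.span {f1, fl}" by blast
  have "f1 \<noteq> fl" using val by auto
  moreover have "fl \<noteq> 0" using val(4) by auto
  moreover have "f1 \<notin> fun_space.span {fl}"
  proof
    assume "f1 \<in> fun_space.span {fl}"
    then obtain c where "f1 = (\<lambda>x. c * fl x)" by (auto simp: fun_space.span_singleton)
    then have "f1 ?y1 = c * fl ?y1" by simp
    then show False using val by simp
  qed
  ultimately have "fun_space.independent {f1, fl}"
    by (simp add: fun_space.independent_insert)
  then have "fun_space.dim (fun_space.span {f1, fl}) = card {f1, fl}"
    by (rule fun_space.dim_span_eq_card_independent)
  then show "fun_space.dim ?V = 2" using span \<open>f1 \<noteq> fl\<close> by simp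
qed

lemma eta_conductor_eq: "eta_conductor \<psi> \<mu> \<eta> = 2 * n"
  unfolding eta_conductor_def
proof (rule Least_equality)
  have "f_kappa \<psi> \<mu> \<eta> n 1 \<in> V_eta \<psi> \<mu> \<eta> (2 * n)" by (rule f_kappa_in_V_eta[OF one_in_Zp_units])
  moreover have "f_kappa \<psi> \<mu> \<eta> n 1 \<noteq> 0"
    using f_kappa_Y(1)[OF one_in_Zp_units one_in_Zp_units] by auto
  ultimately have "V_eta \<psi> \<mu> \<eta> (2 * n) \<noteq> {0}" by blast
  then show "conductor_exponent \<eta> \<le> 2 * n \<and> V_eta \<psi> \<mu> \<eta> (2 * n) \<noteq> {0}"
    using conductor_eta n_gt_1 by simp
  fix m assume "conductor_exponent \<eta> \<le> m \<and> V_eta \<psi> \<mu> \<eta> m \<noteq> {0}"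
  then show "2 * n \<le> m" using V_eta_trivial[of m] by (meson not_le)
qed

end

end

theorem proposition4p2:
  fixes \<psi> \<mu> \<eta> :: "'p::prime_card qp \<Rightarrow> complex"
    and lam :: "'p qp"
    and n :: nat
  assumes "odd CARD('p)"
    and "additive_character \<psi>" and "conductor_zero \<psi>"
    and "multiplicative_character \<mu>" and "conductor_exponent \<mu> = n" and "n > 1"
    and "\<eta> = trivial_char \<or> \<eta> = legendre_char"
    and "lam \<in> Zp_units" and "\<not> (\<exists>x\<in>Zp. lam - x\<^sup>2 \<in> pZp 1)"
    and "\<mu> (- 1) = \<eta> (- 1)"
  shows "(\<forall>\<kappa>\<in>{1, lam}. \<forall>b\<in>Borel. \<forall>k\<in>full_preimage (K_level (2 * n)).
            f_kappa \<psi> \<mu> \<eta> n \<kappa> (b * mp_lift (lower_unip (\<kappa> * pp ^ n)) * k)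
              = mu_B \<psi> \<mu> b * eta_cover \<eta> k) \<and>
         V_eta \<psi> \<mu> \<eta> (2 * n) = fun_space.span {f_kappa \<psi> \<mu> \<eta> n 1, f_kappa \<psi> \<mu> \<eta> n lam} \<and>
         fun_space.dim (V_eta \<psi> \<mu> \<eta> (2 * n)) = 2 \<and>
         eta_conductor \<psi> \<mu> \<eta> = 2 * n"
proof -
  interpret principal_series "TYPE('p)" \<psi> \<mu> \<eta> n
    using assms by unfold_locales auto
  show ?thesis
    using f_kappa_eq[OF one_in_Zp_units] f_kappa_eq[OF assms(8)] f_kappa_basis[OF assms(8,9)]
      eta_conductor_eq[OF assms(8,9)]
    by blast
qed

end
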